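(* Let $\nu_\theta:[0,T]\times\mathbb{R}\times\mathcal{P}_2(\mathbb{R})\to\mathbb{R}$ satisfy the Lipschitz regularity conditions (i)–(iii) in the context, let $\mu_0\in\mathcal{P}_2(\mathbb{R})$, and let $(\mu_t)_{t\in[0,T]}\in C([0,T],\mathcal{P}_2(\mathbb{R}))$ be the unique measure flow such that $\mu_t$ is the law of the unique strong solution $M_t$ of $$dM_t=\nu_\theta(t,M_t,\mu_t)\,dW_t,\qquad \mathrm{Law}(M_t)=\mu_t,\quad\mathrm{Law}(M_0)=\mu_0.$$ If $\mu_t$ admits a density $u(t,x)$ for all $t\in[0,T]$ such that $u\in C^{1,2}([0,T]\times\mathbb{R})$, then $u$ is a classical solution of the Neural McKean–Vlasov equation $$\partial_tu(t,x)=\tfrac12\partial_{xx}\big[\nu_\theta(t,x,\mu_t)^2u(t,x)\big],$$ with initial condition $u(0,x)=u_0(x)$, where $u_0$ is the density of $\mu_0$ and $\mu_t$ is the measure with density $u(t,\cdot)$. In general (without the $C^{1,2}$ regularity), $u$ is a weak solution of this equation, i.e. a solution in the sense of distributions.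
   Context: $T>0$ is fixed; $W$ is a one-dimensional standard Brownian motion. $\mathcal{P}_2(\mathbb{R})$ is the space of probability measures on $\mathbb{R}$ with finite second moment, with the 2-Wasserstein metric $W_2$; $\delta_0$ is the Dirac mass at $0$. The function $\nu_\theta$ arises as the implicitly defined volatility: $\nu_\theta(t,x,\mu)$ is the unique root $z$ of $g_\theta(t,x,\mu,z)=0$ for a driver $g_\theta:[0,T]\times\mathbb{R}\times\mathcal{P}_2(\mathbb{R})\times\mathbb{R}\to\mathbb{R}$. Lipschitz regularity conditions: $\nu_\theta$ is measurable and there are constants $L_x,L_\mu,C>0$ such that for all $t\in[0,T]$, $x,y\in\mathbb{R}$, $\mu,\pi\in\mathcal{P}_2(\mathbb{R})$: (i) $|\nu_\theta(t,x,\mu)-\nu_\theta(t,y,\mu)|\le L_x|x-y|$; (ii) $|\nu_\theta(t,x,\mu)-\nu_\theta(t,x,\pi)|\le L_\mu W_2(\mu,\pi)$; (iii) $|\nu_\theta(t,x,\mu)|^2\le C^2(1+|x|^2+W_2(\mu,\delta_0)^2)$.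
   Formalization: Since the volatility is only measurable in t, the classical equation can fail at single times; it is proved for all x at almost every t, and at every t where the volatility (with the measure fixed at μ_t) is continuous in time; u(0,x)=u_0(x) holds a.e., and everywhere if u_0 is continuous. *)

theory Defs
  imports "HOL-Probability.Probability"
begin

section \<open>The Wasserstein space of order 2 over the real line\<close>

definition P2 :: "real measure set" where
  "P2 = {m. prob_space m \<and> sets m = sets borel \<and> integrable m (\<lambda>x. x\<^sup>2)}"

definition couplings :: "real measure \<Rightarrow> real measure \<Rightarrow> (real \<times> real) measure set" where
  "couplings m n = {p. sets p = sets (borel \<Otimes>\<^sub>M borel) \<and>
     distr p borel fst = m \<and> distr p borel snd = n}"

text \<open>For arguments in \<^const>\<open>P2\<close> the infimum is over a nonempty set of finite nonnegative costs.\<close>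

definition W2 :: "real measure \<Rightarrow> real measure \<Rightarrow> real" where
  "W2 m n = sqrt (INF p\<in>couplings m n. \<integral>z. (fst z - snd z)\<^sup>2 \<partial>p)"

text \<open>The Borel sigma-algebra of the metric space given by \<^const>\<open>P2\<close> and \<^const>\<open>W2\<close>. Its
  elements are sets of measures; it is itself presented as a measure in order to form products.\<close>

definition W2_open :: "real measure set \<Rightarrow> bool" where
  "W2_open U \<longleftrightarrow> U \<subseteq> P2 \<and> (\<forall>m\<in>U. \<exists>r>0. \<forall>n\<in>P2. W2 m n < r \<longrightarrow> n \<in> U)"

definition borel_P2 :: "real measure measure" where
  "borel_P2 = sigma P2 {U. W2_open U}"

definition W2_continuous_flow :: "real \<Rightarrow> (real \<Rightarrow> real measure) \<Rightarrow> bool" where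
  "W2_continuous_flow T \<mu> \<longleftrightarrow> (\<forall>t\<in>{0..T}. \<mu> t \<in> P2) \<and>
     (\<forall>t\<in>{0..T}. ((\<lambda>s. W2 (\<mu> s) (\<mu> t)) \<longlongrightarrow> 0) (at t within {0..T}))"

definition lipschitz_regular :: "real \<Rightarrow> (real \<Rightarrow> real \<Rightarrow> real measure \<Rightarrow> real) \<Rightarrow> bool" where
  "lipschitz_regular T \<nu> \<longleftrightarrow>
     (\<lambda>(t, x, m). \<nu> t x m) \<in>
        borel_measurable (restrict_space borel {0..T} \<Otimes>\<^sub>M borel \<Otimes>\<^sub>M borel_P2) \<and>
     (\<exists>L\<^sub>x>0. \<exists>L\<^sub>\<mu>>0. \<exists>C>0. \<forall>t\<in>{0..T}. \<forall>x y. \<forall>m\<in>P2. \<forall>n\<in>P2.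
        \<bar>\<nu> t x m - \<nu> t y m\<bar> \<le> L\<^sub>x * \<bar>x - y\<bar> \<and>
        \<bar>\<nu> t x m - \<nu> t x n\<bar> \<le> L\<^sub>\<mu> * W2 m n \<and>
        \<bar>\<nu> t x m\<bar>\<^sup>2 \<le> C\<^sup>2 * (1 + \<bar>x\<bar>\<^sup>2 + (W2 m (return borel 0))\<^sup>2))"


section \<open>Brownian motion and the Ito integral\<close>

definition rv_sets :: "'a measure \<Rightarrow> ('a \<Rightarrow> real) \<Rightarrow> 'a set set" where
  "rv_sets M Y = {Y -` B \<inter> space M | B. B \<in> sets borel}"

definition generated_by :: "'a measure \<Rightarrow> (real \<Rightarrow> 'a \<Rightarrow> real) \<Rightarrow> real set \<Rightarrow> 'a measure" where
  "generated_by M W I = sigma (space M) (\<Union>s\<in>I. rv_sets M (W s))"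

definition brownian_motion :: "'a measure \<Rightarrow> (real \<Rightarrow> 'a \<Rightarrow> real) \<Rightarrow> bool" where
  "brownian_motion M W \<longleftrightarrow>
     prob_space M \<and>
     (\<forall>t\<ge>0. W t \<in> borel_measurable M) \<and>
     (AE \<omega> in M. W 0 \<omega> = 0) \<and>
     (AE \<omega> in M. continuous_on {0..} (\<lambda>t. W t \<omega>)) \<and>
     (\<forall>s t. 0 \<le> s \<and> s < t \<longrightarrow>
        distributed M lborel (\<lambda>\<omega>. W t \<omega> - W s \<omega>) (normal_density 0 (sqrt (t - s))) \<and>
        prob_space.indep_set M (rv_sets M (\<lambda>\<omega>. W t \<omega> - W s \<omega>)) (sets (generated_by M W {0..s})))"

text \<open>Filtration to which a strong solution with initial value \<open>\<xi>\<close> has to be adapted: generated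
  by \<open>\<xi>\<close> and the driving Brownian motion up to time \<open>t\<close>, augmented by the null sets. Only the
  sigma-algebra of the measure returned is meaningful.\<close>

definition driving_filtration ::
    "'a measure \<Rightarrow> (real \<Rightarrow> 'a \<Rightarrow> real) \<Rightarrow> ('a \<Rightarrow> real) \<Rightarrow> real \<Rightarrow> 'a measure" where
  "driving_filtration M W \<xi> t =
     sigma (space M) (rv_sets M \<xi> \<union> (\<Union>s\<in>{0..t}. rv_sets M (W s)) \<union> null_sets M)"

text \<open>Simple integrands on \<open>[0,t]\<close>: the process equal to \<open>h i\<close> on \<open>(\<tau> i, \<tau> (i + 1)]\<close> for \<open>i < n\<close>,
  with \<open>h i\<close> bounded and known at time \<open>\<tau> i\<close>.\<close>

definition simple_integrand ::
    "'a measure \<Rightarrow> (real \<Rightarrow> 'a measure) \<Rightarrow> real \<Rightarrow> nat \<Rightarrow> (nat \<Rightarrow> real) \<Rightarrow> (nat \<Rightarrow> 'a \<Rightarrow> real) \<Rightarrow> bool" where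
  "simple_integrand M F t n \<tau> h \<longleftrightarrow>
     0 \<le> \<tau> 0 \<and> (\<forall>i<n. \<tau> i \<le> \<tau> (Suc i)) \<and> \<tau> n \<le> t \<and>
     (\<forall>i<n. h i \<in> borel_measurable (F (\<tau> i)) \<and> (\<exists>K. \<forall>\<omega>\<in>space M. \<bar>h i \<omega>\<bar> \<le> K))"

definition simple_process ::
    "nat \<Rightarrow> (nat \<Rightarrow> real) \<Rightarrow> (nat \<Rightarrow> 'a \<Rightarrow> real) \<Rightarrow> real \<Rightarrow> 'a \<Rightarrow> real" where
  "simple_process n \<tau> h s \<omega> = (\<Sum>i<n. h i \<omega> * indicator {\<tau> i<..\<tau> (Suc i)} s)"

definition simple_integral ::
    "(real \<Rightarrow> 'a \<Rightarrow> real) \<Rightarrow> nat \<Rightarrow> (nat \<Rightarrow> real) \<Rightarrow> (nat \<Rightarrow> 'a \<Rightarrow> real) \<Rightarrow> 'a \<Rightarrow> real" where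
  "simple_integral W n \<tau> h \<omega> = (\<Sum>i<n. h i \<omega> * (W (\<tau> (Suc i)) \<omega> - W (\<tau> i) \<omega>))"

text \<open>\<open>J\<close> is a version of the Ito integral of \<open>H\<close> against \<open>W\<close> over \<open>[0,t]\<close>: the integrand is
  jointly measurable, adapted and square integrable, and \<open>J\<close> is the limit in \<open>L\<^sup>2(M)\<close> of the
  integrals of simple integrands converging to \<open>H\<close> in \<open>L\<^sup>2([0,t] \<times> M)\<close>. By the Ito isometry this
  determines \<open>J\<close> almost surely when \<open>W\<close> is a Brownian motion relative to \<open>F\<close>.\<close>

definition has_ito_integral ::
    "'a measure \<Rightarrow> (real \<Rightarrow> 'a measure) \<Rightarrow> (real \<Rightarrow> 'a \<Rightarrow> real) \<Rightarrow> (real \<Rightarrow> 'a \<Rightarrow> real) \<Rightarrow> real \<Rightarrow>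
     ('a \<Rightarrow> real) \<Rightarrow> bool" where
  "has_ito_integral M F W H t J \<longleftrightarrow>
     (\<lambda>(s, \<omega>). H s \<omega>) \<in> borel_measurable (restrict_space borel {0..t} \<Otimes>\<^sub>M M) \<and>
     (\<forall>s\<in>{0..t}. H s \<in> borel_measurable (F s)) \<and>
     (\<integral>\<^sup>+\<omega>. (\<integral>\<^sup>+s\<in>{0..t}. ennreal ((H s \<omega>)\<^sup>2) \<partial>lborel) \<partial>M) < \<infinity> \<and>
     J \<in> borel_measurable M \<and>
     (\<exists>n \<tau> h. (\<forall>k. simple_integrand M F t (n k) (\<tau> k) (h k)) \<and>
        (\<lambda>k. \<integral>\<^sup>+\<omega>. (\<integral>\<^sup>+s\<in>{0..t}.
            ennreal ((simple_process (n k) (\<tau> k) (h k) s \<omega> - H s \<omega>)\<^sup>2) \<partial>lborel) \<partial>M) \<longlonglongrightarrow> 0 \<and>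
        (\<lambda>k. \<integral>\<^sup>+\<omega>. ennreal ((simple_integral W (n k) (\<tau> k) (h k) \<omega> - J \<omega>)\<^sup>2) \<partial>M) \<longlonglongrightarrow> 0)"

text \<open>Strong solution \<open>X\<close> on \<open>[0,T]\<close> of \<open>dX\<^sub>t = \<nu>(t, X\<^sub>t, \<mu>\<^sub>t) dW\<^sub>t\<close> with \<open>Law(X\<^sub>t) = \<mu>\<^sub>t\<close> and
  \<open>Law(X\<^sub>0) = \<mu>0\<close>. As usual, the initial value is independent of the driving Brownian motion.\<close>

definition mckean_vlasov_strong_solution ::
    "'a measure \<Rightarrow> (real \<Rightarrow> 'a \<Rightarrow> real) \<Rightarrow> real \<Rightarrow> (real \<Rightarrow> real \<Rightarrow> real measure \<Rightarrow> real) \<Rightarrow>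
     real measure \<Rightarrow> (real \<Rightarrow> real measure) \<Rightarrow> (real \<Rightarrow> 'a \<Rightarrow> real) \<Rightarrow> bool" where
  "mckean_vlasov_strong_solution M W T \<nu> \<mu>0 \<mu> X \<longleftrightarrow>
     X 0 \<in> borel_measurable M \<and>
     prob_space.indep_set M (rv_sets M (X 0)) (sets (generated_by M W {0..})) \<and>
     distr M borel (X 0) = \<mu>0 \<and>
     (\<forall>t\<in>{0..T}. X t \<in> borel_measurable (driving_filtration M W (X 0) t)) \<and>
     (AE \<omega> in M. continuous_on {0..T} (\<lambda>t. X t \<omega>)) \<and>
     (\<forall>t\<in>{0..T}. distr M borel (X t) = \<mu> t) \<and>
     (\<forall>t\<in>{0..T}. has_ito_integral M (driving_filtration M W (X 0)) W
        (\<lambda>s \<omega>. \<nu> s (X s \<omega>) (\<mu> s)) t (\<lambda>\<omega>. X t \<omega> - X 0 \<omega>))"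


section \<open>The Neural McKean--Vlasov equation\<close>

definition is_density :: "(real \<Rightarrow> real) \<Rightarrow> real measure \<Rightarrow> bool" where
  "is_density f m \<longleftrightarrow> f \<in> borel_measurable borel \<and> (\<forall>x. 0 \<le> f x) \<and> m = density lborel (\<lambda>x. ennreal (f x))"

text \<open>Class \<open>C\<^sup>1\<^sup>,\<^sup>2\<close> on \<open>[0,T] \<times> \<real>\<close>, with one-sided time derivatives at \<open>0\<close> and \<open>T\<close>.\<close>

definition C12 :: "real \<Rightarrow> (real \<Rightarrow> real \<Rightarrow> real) \<Rightarrow> bool" where
  "C12 T u \<longleftrightarrow> (\<exists>u\<^sub>t u\<^sub>x u\<^sub>x\<^sub>x.
     (\<forall>t\<in>{0..T}. \<forall>x. ((\<lambda>s. u s x) has_real_derivative u\<^sub>t t x) (at t within {0..T}) \<and>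
        (u t has_real_derivative u\<^sub>x t x) (at x) \<and>
        (u\<^sub>x t has_real_derivative u\<^sub>x\<^sub>x t x) (at x)) \<and>
     (\<forall>f\<in>{u, u\<^sub>t, u\<^sub>x, u\<^sub>x\<^sub>x}. continuous_on ({0..T} \<times> UNIV) (\<lambda>(t, x). f t x)))"

definition has_second_derivative :: "(real \<Rightarrow> real) \<Rightarrow> real \<Rightarrow> real \<Rightarrow> bool" where
  "has_second_derivative f d x \<longleftrightarrow>
     (\<exists>f'. (\<forall>y. (f has_real_derivative f' y) (at y)) \<and> (f' has_real_derivative d) (at x))"

text \<open>The equation \<open>\<partial>\<^sub>t u = 1/2 \<partial>\<^sub>x\<^sub>x (\<nu>(t, x, \<mu>\<^sub>t)\<^sup>2 u)\<close> holds at time \<open>t\<close> and every point \<open>x\<close>,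
  where \<open>\<mu>\<^sub>t\<close> has density \<open>u t\<close>; existence of both derivatives is part of the claim.\<close>

definition mckean_vlasov_pde_at ::
    "real \<Rightarrow> (real \<Rightarrow> real \<Rightarrow> real measure \<Rightarrow> real) \<Rightarrow> (real \<Rightarrow> real \<Rightarrow> real) \<Rightarrow> real \<Rightarrow> bool" where
  "mckean_vlasov_pde_at T \<nu> u t \<longleftrightarrow> (\<forall>x. \<exists>d e.
     ((\<lambda>s. u s x) has_real_derivative d) (at t within {0..T}) \<and>
     has_second_derivative (\<lambda>y. (\<nu> t y (density lborel (\<lambda>z. ennreal (u t z))))\<^sup>2 * u t y) e x \<and>
     d = 1 / 2 * e)"

text \<open>The density of the initial law is only determined almost everywhere, so the initial
  condition is pointwise precisely for its continuous version.\<close>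

definition initial_condition :: "(real \<Rightarrow> real \<Rightarrow> real) \<Rightarrow> (real \<Rightarrow> real) \<Rightarrow> bool" where
  "initial_condition u u\<^sub>0 \<longleftrightarrow>
     (AE x in lborel. u 0 x = u\<^sub>0 x) \<and> (continuous_on UNIV u\<^sub>0 \<longrightarrow> (\<forall>x. u 0 x = u\<^sub>0 x))"

text \<open>Classical solution whose equation is required at the times in \<open>S\<close>; for \<open>S = {0..T}\<close> this is
  the usual notion. The set of times is a parameter because \<open>\<nu>\<close> is merely measurable in time:
  changing \<open>\<nu>\<close> at a single time affects neither the process nor its laws, so the equation cannot
  hold pointwise at every time without continuity of \<open>\<nu>\<close> in time.\<close>

definition classical_solution ::
    "real \<Rightarrow> (real \<Rightarrow> real \<Rightarrow> real measure \<Rightarrow> real) \<Rightarrow> real set \<Rightarrow> (real \<Rightarrow> real) \<Rightarrow>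
     (real \<Rightarrow> real \<Rightarrow> real) \<Rightarrow> bool" where
  "classical_solution T \<nu> S u\<^sub>0 u \<longleftrightarrow>
     C12 T u \<and> (\<forall>t\<in>S. mckean_vlasov_pde_at T \<nu> u t) \<and> initial_condition u u\<^sub>0"

text \<open>Smooth functions with compact support in \<open>(-\<infinity>,T) \<times> \<real>\<close>; \<open>D i j\<close> is the partial derivative
  of order \<open>i\<close> in time and \<open>j\<close> in space. The support may meet \<open>t = 0\<close>, so that the weak
  formulation also carries the initial condition.\<close>

definition test_function :: "real \<Rightarrow> (real \<Rightarrow> real \<Rightarrow> real) \<Rightarrow> bool" where
  "test_function T \<phi> \<longleftrightarrow>
     (\<exists>D :: nat \<Rightarrow> nat \<Rightarrow> real \<Rightarrow> real \<Rightarrow> real. D 0 0 = \<phi> \<and>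
        (\<forall>i j. continuous_on UNIV (\<lambda>(t, x). D i j t x) \<and>
           (\<forall>t x. ((\<lambda>s. D i j s x) has_real_derivative D (Suc i) j t x) (at t) \<and>
              (D i j t has_real_derivative D i (Suc j) t x) (at x)))) \<and>
     (\<exists>K. compact K \<and> K \<subseteq> {..<T} \<times> UNIV \<and> (\<forall>t x. (t, x) \<notin> K \<longrightarrow> \<phi> t x = 0))"

definition weak_integrand ::
    "(real \<Rightarrow> real \<Rightarrow> real measure \<Rightarrow> real) \<Rightarrow> (real \<Rightarrow> real \<Rightarrow> real) \<Rightarrow> (real \<Rightarrow> real \<Rightarrow> real) \<Rightarrow>
     real \<Rightarrow> real \<Rightarrow> real" where
  "weak_integrand \<nu> u \<phi> t x = u t x *
     (deriv (\<lambda>s. \<phi> s x) t +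
      1 / 2 * (\<nu> t x (density lborel (\<lambda>z. ennreal (u t z))))\<^sup>2 * deriv (deriv (\<phi> t)) x)"

text \<open>Solution in the sense of distributions, including the initial condition. Integrability is
  spelled out since the integral of a non-integrable function is \<open>0\<close> by convention. Integrals are
  iterated because densities chosen separately for each time need not be jointly measurable.\<close>

definition weak_solution ::
    "real \<Rightarrow> (real \<Rightarrow> real \<Rightarrow> real measure \<Rightarrow> real) \<Rightarrow> (real \<Rightarrow> real) \<Rightarrow>
     (real \<Rightarrow> real \<Rightarrow> real) \<Rightarrow> bool" where
  "weak_solution T \<nu> u\<^sub>0 u \<longleftrightarrow> (\<forall>\<phi>. test_function T \<phi> \<longrightarrow>
     (\<forall>t\<in>{0..T}. integrable lborel (weak_integrand \<nu> u \<phi> t)) \<and>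
     set_integrable lborel {0..T} (\<lambda>t. \<integral>x. \<bar>weak_integrand \<nu> u \<phi> t x\<bar> \<partial>lborel) \<and>
     set_integrable lborel {0..T} (\<lambda>t. \<integral>x. weak_integrand \<nu> u \<phi> t x \<partial>lborel) \<and>
     integrable lborel (\<lambda>x. u\<^sub>0 x * \<phi> 0 x) \<and>
     (LINT t:{0..T}|lborel. (\<integral>x. weak_integrand \<nu> u \<phi> t x \<partial>lborel)) +
       (\<integral>x. u\<^sub>0 x * \<phi> 0 x \<partial>lborel) = 0)"

end

theory Submission
  imports Defs
begin

text \<open>
  Everything follows from Dynkin's formula
  \<open>E \<phi>(t, X\<^sub>t) - E \<phi>(0, X\<^sub>0) = \<integral>\<^sub>0\<^sup>t E (\<partial>\<^sub>t\<phi> + \<nu>\<^sup>2 \<partial>\<^sub>x\<^sub>x\<phi> / 2)(r, X\<^sub>r) dr\<close>.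
  For the integral of a simple process it holds on each interval on which the integrand is constant, by a
  second-order Taylor expansion with a remainder of order \<open>3/2\<close> in the length of the time step. The general
  case follows by letting simple integrands converge to the volatility, the Ito isometry giving
  \<open>L\<^sup>2\<close> convergence of the paths at every intermediate time.

  Writing expectations as integrals against \<open>u\<close>, Dynkin's formula with a test function that vanishes at \<open>T\<close>
  is the weak form of the equation. If \<open>u\<close> is of class \<open>C\<^sup>1\<^sup>,\<^sup>2\<close>, the formula for compactly supported functions
  of \<open>x\<close> alone says that \<open>\<integral> \<partial>\<^sub>t u f dx\<close> and \<open>\<integral> \<nu>\<^sup>2 u f'' dx / 2\<close> have the same primitive in time; so they agree
  for almost all times, for a countable family of \<open>f\<close> at once, and wherever \<open>\<nu>\<close> is continuous in time.
  The functions \<open>f\<close> are chosen such that \<open>f''\<close> approximates \<open>\<delta>\<^sub>p - (1 - p) \<delta>\<^sub>0 - p \<delta>\<^sub>1\<close>. Hence \<open>\<nu>\<^sup>2 u\<close> differs from a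
  second primitive of \<open>2 \<partial>\<^sub>t u\<close> by an affine function.
\<close>

section \<open>Brownian increments and the Ito isometry\<close>

text \<open>The Ito integral is given only time by time, as a limit in \<open>L^2\<close>, so there
  is no integral process to which an Ito formula could be applied. Dynkin's formula involves only
  the law at each single time, and for that fixed-time limits suffice. The volatility grows
  linearly, so its square is merely integrable; the limits therefore have to separate a bounded test
  factor from an integrable one. Test functions need \<open>\<phi>t\<close> and
  \<open>\<phi>xx\<close> to be Lipschitz but no further smoothness: this gives the remainder of
  order 3/2, and it admits the piecewise cubic functions used for the classical equation. There,
  nothing is known about integrability of the time derivative of \<open>u\<close> over the whole
  line, so the functions of \<open>x\<close> must have compact support. Their second derivatives
  then annihilate affine functions, and subtracting from the point mass at \<open>p\<close> its
  linear interpolation by masses at 0 and 1 achieves this. Since \<nu> is only measurable in time,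
  the exceptional times must not depend on the point \<open>x\<close>; rational \<open>p\<close> and
  widths \<open>1 / (n + 1)\<close> keep the family countable, and continuity in space recovers all
  other points.\<close>

lemma rv_sets_subset: "Y \<in> borel_measurable M \<Longrightarrow> rv_sets M Y \<subseteq> sets M"
  by (auto simp: rv_sets_def)

lemma rv_sets_sigma_sets: "sigma_sets (space M) (rv_sets M Y) = rv_sets M Y"
proof -
  have "rv_sets M Y = (\<lambda>B. Y -` B \<inter> space M) ` sigma_sets UNIV (sets borel)"
    by (auto simp: rv_sets_def sets.sigma_sets_eq[of "borel::real measure", simplified])
  also have "\<dots> = sigma_sets (space M) ((\<lambda>B. Y -` B \<inter> space M) ` sets borel)"
    using sigma_sets_vimage_commute[of Y "space M" UNIV "sets borel"] by (simp add: Setcompr_eq_image)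
  finally have eq: "rv_sets M Y = sigma_sets (space M) ((\<lambda>B. Y -` B \<inter> space M) ` sets borel)" .
  show ?thesis unfolding eq by (rule sigma_sets_sigma_sets_eq) auto
qed

lemma Int_stable_rv_sets: "Int_stable (rv_sets M Y)"
proof (rule Int_stableI)
  fix a b assume "a \<in> rv_sets M Y" "b \<in> rv_sets M Y"
  then obtain A B where "A \<in> sets borel" "B \<in> sets borel" "a \<inter> b = Y -` (A \<inter> B) \<inter> space M"
    by (auto simp: rv_sets_def)
  then show "a \<inter> b \<in> rv_sets M Y" unfolding rv_sets_def by blast
qed

lemma sets_generated_by:
  "sets (generated_by M W I) = sigma_sets (space M) (\<Union>s\<in>I. rv_sets M (W s))"
  unfolding generated_by_def by (rule sets_measure_of) (auto simp: rv_sets_def)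

context prob_space
begin

lemma integrable_bounded:
  "f \<in> borel_measurable M \<Longrightarrow> (\<And>w. w \<in> space M \<Longrightarrow> \<bar>f w\<bar> \<le> K) \<Longrightarrow> integrable M f" for f :: "'a \<Rightarrow> real"
  by (rule integrable_const_bound[of _ K]) auto

lemma integrable_bounded_mult:
  fixes h Y :: "'a \<Rightarrow> real"
  assumes "h \<in> borel_measurable M" "\<forall>w\<in>space M. \<bar>h w\<bar> \<le> K" "integrable M Y"
  shows "integrable M (\<lambda>w. h w * Y w)"
proof (rule Bochner_Integration.integrable_bound)
  show "integrable M (\<lambda>w. K * \<bar>Y w\<bar>)" using assms(3) by auto
  show "(\<lambda>w. h w * Y w) \<in> borel_measurable M" using assms by auto
  show "AE w in M. norm (h w * Y w) \<le> norm (K * \<bar>Y w\<bar>)"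
  proof (rule AE_I2)
    fix w assume "w \<in> space M"
    then have "\<bar>h w\<bar> \<le> K" using assms by auto
    then show "norm (h w * Y w) \<le> norm (K * \<bar>Y w\<bar>)"
      by (auto simp: abs_mult intro!: mult_right_mono)
  qed
qed

end

section \<open>The augmented filtration and independence of future increments\<close>

locale driven_bm = prob_space M for M :: "'a measure" +
  fixes W :: "real \<Rightarrow> 'a \<Rightarrow> real" and \<xi> :: "'a \<Rightarrow> real"
  assumes bm: "brownian_motion M W"
    and init_measurable: "\<xi> \<in> borel_measurable M"
    and init_indep: "indep_set (rv_sets M \<xi>) (sets (generated_by M W {0..}))"
begin

abbreviation F :: "real \<Rightarrow> 'a measure" where "F \<equiv> driving_filtration M W \<xi>"

lemma W_measurable: "0 \<le> t \<Longrightarrow> W t \<in> borel_measurable M"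
  using bm by (auto simp: brownian_motion_def)

lemma space_F [simp]: "space (F t) = space M"
  unfolding driving_filtration_def by (simp add: space_measure_of_conv)

lemma sets_F: "sets (F t) =
    sigma_sets (space M) (rv_sets M \<xi> \<union> (\<Union>s\<in>{0..t}. rv_sets M (W s)) \<union> null_sets M)"
  unfolding driving_filtration_def
  by (rule sets_measure_of) (auto simp: rv_sets_def dest: null_setsD2 sets.sets_into_space)

lemma sets_F_subset: "sets (F t) \<subseteq> sets M"
  unfolding sets_F
  by (rule sets.sigma_sets_subset) (auto dest: rv_sets_subset[OF W_measurable, THEN subsetD] rv_sets_subset[OF init_measurable, THEN subsetD])

lemma F_mono: "s \<le> t \<Longrightarrow> sets (F s) \<subseteq> sets (F t)"
  unfolding sets_F by (rule sigma_sets_mono') auto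

lemma measurable_F_mono: "s \<le> t \<Longrightarrow> Z \<in> borel_measurable (F s) \<Longrightarrow> Z \<in> borel_measurable (F t)"
  using F_mono[of s t] by (auto simp: measurable_def)

lemma measurable_F: "Z \<in> borel_measurable (F s) \<Longrightarrow> Z \<in> borel_measurable M"
  using sets_F_subset[of s] by (auto simp: measurable_def)

lemma init_measurable_F: "\<xi> \<in> borel_measurable (F t)"
proof (rule measurableI)
  fix A :: "real set" assume "A \<in> sets borel"
  then have "\<xi> -` A \<inter> space M \<in> rv_sets M \<xi>" by (auto simp: rv_sets_def)
  then show "\<xi> -` A \<inter> space (F t) \<in> sets (F t)" unfolding sets_F by auto
qed auto

lemma W_measurable_F:
  assumes "0 \<le> s" "s \<le> t" shows "W s \<in> borel_measurable (F t)"
proof (rule measurableI)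
  fix A :: "real set" assume "A \<in> sets borel"
  then have "W s -` A \<inter> space M \<in> rv_sets M (W s)" by (auto simp: rv_sets_def)
  then show "W s -` A \<inter> space (F t) \<in> sets (F t)" using assms unfolding sets_F by auto
qed auto

text \<open>Intersections of events of \<open>\<xi>\<close> and of the past of \<open>W\<close>, together with the null sets, form an
  intersection-stable generator of the filtration.\<close>

lemma increment_indep_F:
  assumes st: "0 \<le> s" "s < t"
  shows "indep_set (sets (F s)) (rv_sets M (\<lambda>w. W t w - W s w))"
proof -
  let ?D = "\<lambda>w. W t w - W s w"
  let ?G = "sets (generated_by M W {0..s})"
  let ?H = "sets (generated_by M W {0..})"
  define P where "P = {A \<inter> B | A B. A \<in> rv_sets M \<xi> \<and> B \<in> ?G} \<union> null_sets M"
  have D: "?D \<in> borel_measurable M"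
    using st by (intro borel_measurable_diff W_measurable) auto
  have xs: "rv_sets M \<xi> \<subseteq> sets M" by (rule rv_sets_subset[OF init_measurable])
  have Ds: "rv_sets M ?D \<subseteq> sets M" by (rule rv_sets_subset[OF D])
  have gen_sub: "sets (generated_by M W I) \<subseteq> sets M" if "I \<subseteq> {0..}" for I
    unfolding sets_generated_by
    by (rule sets.sigma_sets_subset) (use that in \<open>auto dest: rv_sets_subset[OF W_measurable, THEN subsetD, rotated]\<close>)
  have GH: "?G \<subseteq> ?H" unfolding sets_generated_by by (rule sigma_sets_mono') auto
  have WH: "W r \<in> borel_measurable (generated_by M W {0..})" if "0 \<le> r" for r
  proof (rule measurableI)
    fix A :: "real set" assume "A \<in> sets borel"
    then have "W r -` A \<inter> space M \<in> rv_sets M (W r)" by (auto simp: rv_sets_def)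
    then have "W r -` A \<inter> space M \<in> ?H" using that unfolding sets_generated_by by auto
    then show "W r -` A \<inter> space (generated_by M W {0..}) \<in> ?H"
      by (simp add: generated_by_def space_measure_of_conv)
  qed auto
  have "?D \<in> borel_measurable (generated_by M W {0..})"
    using st by (intro borel_measurable_diff WH) auto
  then have DH: "rv_sets M ?D \<subseteq> ?H"
    by (auto simp: rv_sets_def generated_by_def space_measure_of_conv dest!: measurable_sets)
  have DG: "indep_set (rv_sets M ?D) ?G"
    using bm st unfolding brownian_motion_def by auto
  have "indep_set P (rv_sets M ?D)"
  proof (rule indep_setI)
    show "P \<subseteq> events" using xs gen_sub[of "{0..s}"] by (auto simp: P_def)
    show "rv_sets M ?D \<subseteq> events" by fact
    fix a c assume a: "a \<in> P" and c: "c \<in> rv_sets M ?D"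
    from a consider (1) A B where "a = A \<inter> B" "A \<in> rv_sets M \<xi>" "B \<in> ?G" | (2) "a \<in> null_sets M"
      unfolding P_def by blast
    then show "prob (a \<inter> c) = prob a * prob c"
    proof cases
      case 1
      then have "B \<in> ?H" using GH by auto
      \<comment> \<open>The past event \<open>B\<close> and the increment event \<open>c\<close>
        both belong to the whole of \<open>W\<close>. So \<open>A\<close> splits off first, by
        independence of the initial value, and only then does independence of the increments
        separate \<open>B\<close> from \<open>c\<close>.\<close>
      have "B \<inter> c \<in> ?H" using \<open>B \<in> ?H\<close> c DH by auto
      have "prob (a \<inter> c) = prob (A \<inter> (B \<inter> c))" using 1 by (simp add: Int_assoc)
      also have "\<dots> = prob A * prob (B \<inter> c)"
        using indep_setD[OF init_indep \<open>A \<in> rv_sets M \<xi>\<close> \<open>B \<inter> c \<in> ?H\<close>] .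
      also have "prob (B \<inter> c) = prob c * prob B"
        using indep_setD[OF DG c \<open>B \<in> ?G\<close>] by (simp add: Int_commute)
      also have "prob A * (prob c * prob B) = prob (A \<inter> B) * prob c"
        using indep_setD[OF init_indep \<open>A \<in> rv_sets M \<xi>\<close> \<open>B \<in> ?H\<close>] by simp
      finally show ?thesis using 1 by simp
    next
      case 2
      then have "a \<inter> c \<in> null_sets M" using c Ds by (intro null_set_Int2) auto
      then show ?thesis using 2 by (simp add: measure_eq_0_null_sets)
    qed
  qed
  moreover have "Int_stable P"
  proof (rule Int_stableI)
    fix a b assume ab: "a \<in> P" "b \<in> P"
    have Ps: "P \<subseteq> events" using xs gen_sub[of "{0..s}"] by (auto simp: P_def)
    show "a \<inter> b \<in> P"
    proof (cases "a \<in> null_sets M \<or> b \<in> null_sets M")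
      case True
      then have "a \<inter> b \<in> null_sets M"
        using ab Ps by (auto intro: null_set_Int1 null_set_Int2)
      then show ?thesis by (simp add: P_def)
    next
      case False
      then obtain A B A' B' where *: "a = A \<inter> B" "A \<in> rv_sets M \<xi>" "B \<in> ?G"
          "b = A' \<inter> B'" "A' \<in> rv_sets M \<xi>" "B' \<in> ?G"
        using ab unfolding P_def by blast
      have "a \<inter> b = (A \<inter> A') \<inter> (B \<inter> B')" using * by auto
      moreover have "A \<inter> A' \<in> rv_sets M \<xi>" using Int_stable_rv_sets * by (auto simp: Int_stable_def)
      ultimately show ?thesis using * unfolding P_def by blast
    qed
  qed
  ultimately have ind: "indep_set (sigma_sets (space M) P) (rv_sets M ?D)"
    using indep_set_sigma_sets[OF _ _ Int_stable_rv_sets[of M ?D]] by (simp add: rv_sets_sigma_sets)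
  have "sets (F s) \<subseteq> sigma_sets (space M) P"
    unfolding sets_F
  proof (rule sigma_sets_mono, safe)
    fix A assume "A \<in> rv_sets M \<xi>"
    moreover have "space M \<in> ?G" unfolding sets_generated_by by (rule sigma_sets_top)
    moreover have "A = A \<inter> space M" using \<open>A \<in> rv_sets M \<xi>\<close> by (auto simp: rv_sets_def)
    ultimately have "A \<in> P" unfolding P_def by blast
    then show "A \<in> sigma_sets (space M) P" by auto
  next
    fix B r assume B: "B \<in> rv_sets M (W r)" "r \<in> {0..s}"
    then have "B \<in> ?G" unfolding sets_generated_by by (intro sigma_sets.Basic) auto
    moreover have "space M \<in> rv_sets M \<xi>" by (auto simp: rv_sets_def intro!: exI[of _ UNIV])
    moreover have "B = space M \<inter> B" using B by (auto simp: rv_sets_def)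
    ultimately have "B \<in> P" unfolding P_def by blast
    then show "B \<in> sigma_sets (space M) P" by auto
  next
    fix A assume "A \<in> null_sets M"
    then show "A \<in> sigma_sets (space M) P" by (auto simp: P_def)
  qed
  then show ?thesis
    using ind indep_setD[OF ind] sets_F_subset Ds by (intro indep_setI) auto
qed

lemma indep_var_increment:
  assumes "0 \<le> s" "s < t" "Z \<in> borel_measurable (F s)"
  shows "indep_var borel Z borel (\<lambda>w. W t w - W s w)"
  unfolding indep_var_eq
proof (intro conjI)
  show "Z \<in> borel_measurable M" using assms(3) by (rule measurable_F)
  show "random_variable borel (\<lambda>w. W t w - W s w)"
    using assms by (intro borel_measurable_diff W_measurable) auto
  have 1: "sigma_sets (space M) {Z -` A \<inter> space M |A. A \<in> sets borel} \<subseteq> sets (F s)"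
    using sets.sigma_sets_subset[of "{Z -` A \<inter> space M |A. A \<in> sets borel}" "F s"]
      measurable_sets[OF assms(3)] by fastforce
  have 2: "sigma_sets (space M) {(\<lambda>w. W t w - W s w) -` A \<inter> space M |A. A \<in> sets borel}
      = rv_sets M (\<lambda>w. W t w - W s w)"
    using rv_sets_sigma_sets[of M "\<lambda>w. W t w - W s w"] unfolding rv_sets_def .
  note ind = increment_indep_F[OF assms(1,2)]
  show "indep_set (sigma_sets (space M) {Z -` A \<inter> space M |A. A \<in> sets borel})
     (sigma_sets (space M) {(\<lambda>w. W t w - W s w) -` A \<inter> space M |A. A \<in> sets borel})"
    unfolding 2 using 1 indep_setD[OF ind] sets_F_subset[of s] indep_setD_ev2[OF ind]
    by (intro indep_setI) (auto 4 3)
qed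

text \<open>Equal times are included because partition points of a simple integrand may coincide.
  The Gaussian law is available only for \<open>s < t\<close>; at equal times everything is
  zero.\<close>

lemma increment_moment:
  assumes "0 \<le> s" "s \<le> t"
  shows "has_bochner_integral M (\<lambda>w. W t w - W s w) 0"
    and "has_bochner_integral M (\<lambda>w. (W t w - W s w)\<^sup>2) (t - s)"
    and "has_bochner_integral M (\<lambda>w. (W t w - W s w) ^ 4) (3 * (t - s)\<^sup>2)"
proof -
  let ?D = "\<lambda>w. W t w - W s w"
  let ?n = "normal_density 0 (sqrt (t - s))"
  have *: "has_bochner_integral M ?D 0 \<and> has_bochner_integral M (\<lambda>w. (?D w)\<^sup>2) (t - s) \<and>
    has_bochner_integral M (\<lambda>w. (?D w) ^ 4) (3 * (t - s)\<^sup>2)"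
  proof (cases "s = t")
    case True then show ?thesis by (auto intro: has_bochner_integral_zero)
  next
    case False
    then have pos: "sqrt (t - s) > 0" using assms by simp
    have dist: "distributed M lborel ?D ?n"
      using bm assms False unfolding brownian_motion_def by auto
    have tr: "has_bochner_integral M (\<lambda>w. (?D w) ^ k) c"
      if "has_bochner_integral lborel (\<lambda>x. ?n x * x ^ k) c" for k c
      using that distributed_integral[OF dist, of "\<lambda>x. x ^ k"]
        distributed_integrable[OF dist, of "\<lambda>x. x ^ k"]
      by (auto simp: has_bochner_integral_iff)
    have "(sqrt (t - s))\<^sup>2 = t - s" using assms by simp
    \<comment> \<open>The fourth moment in the shape in which \<open>normal_moment_even\<close>
      delivers it, with \<open>v\<close> the variance.\<close>
    moreover have "fact 4 / ((2 / v) ^ 2 * 2) = 3 * v\<^sup>2" for v :: real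
      by (simp add: fact_numeral power2_eq_square)
    ultimately have "has_bochner_integral lborel (\<lambda>x. ?n x * x ^ 1) 0"
      "has_bochner_integral lborel (\<lambda>x. ?n x * x ^ 2) (t - s)"
      "has_bochner_integral lborel (\<lambda>x. ?n x * x ^ 4) (3 * (t - s)\<^sup>2)"
      using normal_moment_odd[OF pos, of 0 0] normal_moment_even[OF pos, of 0 1]
        normal_moment_even[OF pos, of 0 2]
      by (simp_all add: right_diff_distrib fact_2 diff_divide_distrib)
    from this[THEN tr] show ?thesis by simp
  qed
  then show "has_bochner_integral M ?D 0" "has_bochner_integral M (\<lambda>w. (?D w)\<^sup>2) (t - s)"
    "has_bochner_integral M (\<lambda>w. (?D w) ^ 4) (3 * (t - s)\<^sup>2)" by auto
qed

section \<open>Martingale property and covariances of elementary integrals\<close>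

lemma past_times_increment:
  assumes "0 \<le> s" "s \<le> t" "s < t \<Longrightarrow> Z \<in> borel_measurable (F s)" "integrable M Z"
  shows "has_bochner_integral M (\<lambda>w. Z w * (W t w - W s w)) 0"
    and "has_bochner_integral M (\<lambda>w. Z w * (W t w - W s w)\<^sup>2) ((t - s) * expectation Z)"
proof -
  have *: "has_bochner_integral M (\<lambda>w. Z w * f (W t w - W s w)) (expectation Z * c)"
    if "f \<in> borel_measurable borel" "has_bochner_integral M (\<lambda>w. f (W t w - W s w)) c" "s < t" for f c
  proof -
    have ind: "indep_var borel Z borel (\<lambda>w. f (W t w - W s w))"
      using indep_var_compose[OF indep_var_increment[OF assms(1) that(3) assms(3)], of id borel f borel]
        that by (simp add: comp_def)
    show ?thesis
      using indep_var_lebesgue_integral[OF ind assms(4)] indep_var_integrable[OF ind assms(4)] that(2)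
      by (simp add: has_bochner_integral_iff)
  qed
  show "has_bochner_integral M (\<lambda>w. Z w * (W t w - W s w)) 0"
    using *[of "\<lambda>x. x" 0] increment_moment[OF assms(1,2)] assms(2)
    by (cases "s = t") (auto intro: has_bochner_integral_zero)
  show "has_bochner_integral M (\<lambda>w. Z w * (W t w - W s w)\<^sup>2) ((t - s) * expectation Z)"
    using *[of "\<lambda>x. x\<^sup>2" "t - s"] increment_moment[OF assms(1,2)] assms(2)
    by (cases "s = t") (auto intro: has_bochner_integral_zero simp: mult.commute)
qed

text \<open>An elementary integrand of height \<open>h\<close> on \<open>(a,b]\<close>. That
  \<open>h\<close> is known at time \<open>a\<close> is demanded only on nondegenerate intervals:
  stopping a simple integrand at \<open>r\<close> collapses every later interval to the point
  \<open>r\<close>, where its height is not yet known.\<close>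

definition step :: "real \<Rightarrow> real \<Rightarrow> ('a \<Rightarrow> real) \<Rightarrow> bool" where
  "step a b h \<longleftrightarrow> 0 \<le> a \<and> a \<le> b \<and> h \<in> borel_measurable M \<and> (\<exists>K. \<forall>w\<in>space M. \<bar>h w\<bar> \<le> K) \<and>
     (a < b \<longrightarrow> h \<in> borel_measurable (F a))"

lemma integrable_step_mult:
  assumes "step a b h" "step c d g"
  shows "integrable M (\<lambda>w. h w * g w)"
proof -
  obtain K where K: "\<forall>w\<in>space M. \<bar>g w\<bar> \<le> K" using assms by (auto simp: step_def)
  have "integrable M (\<lambda>w. g w * 1)" by (rule integrable_bounded_mult) (use assms K in \<open>auto simp: step_def\<close>)
  then show ?thesis using assms by (auto intro: integrable_bounded_mult simp: step_def)
qed

text \<open>Everything except the last increment is known at time \<open>c\<close>, so the mean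
  vanishes. If \<open>a = b\<close>, the height \<open>h\<close> may be unknown at \<open>c\<close>,
  but then the product is identically zero.\<close>

lemma cross_disjoint:
  assumes h: "step a b h" and g: "step c d g" and "b \<le> c"
  shows "has_bochner_integral M (\<lambda>w. (h w * (W b w - W a w)) * (g w * (W d w - W c w))) 0"
proof -
  let ?Z = "\<lambda>w. g w * (h w * (W b w - W a w))"
  have "has_bochner_integral M (\<lambda>w. ?Z w * (W d w - W c w)) 0"
  proof (rule past_times_increment)
    show "0 \<le> c" "c \<le> d" using g by (auto simp: step_def)
    show "integrable M ?Z"
    proof -
      have "integrable M (\<lambda>w. W b w - W a w)"
        using increment_moment(1)[of a b] h by (auto simp: step_def has_bochner_integral_iff)
      then have "integrable M (\<lambda>w. h w * (W b w - W a w))"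
        using h by (auto intro: integrable_bounded_mult simp: step_def)
      then show ?thesis using g by (auto intro: integrable_bounded_mult simp: step_def)
    qed
    show "?Z \<in> borel_measurable (F c)" if "c < d"
    proof (cases "a < b")
      case True
      then have "h \<in> borel_measurable (F c)" "W b \<in> borel_measurable (F c)" "W a \<in> borel_measurable (F c)"
        using h assms(3) by (auto simp: step_def intro!: W_measurable_F intro: measurable_F_mono[of a])
      then show ?thesis using g that by (auto simp: step_def)
    next
      case False
      then have "b = a" using h by (auto simp: step_def)
      then show ?thesis by simp
    qed
  qed
  then show ?thesis by (simp add: ac_simps)
qed

text \<open>Cutting the longer increment at \<open>b\<close> leaves the square of the common
  increment and a later increment, which is orthogonal to the past.\<close>

lemma cross_same_left:
  assumes h: "step a b h" and g: "step a d g" and "b \<le> d"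
  shows "has_bochner_integral M (\<lambda>w. (h w * (W b w - W a w)) * (g w * (W d w - W a w)))
    ((b - a) * expectation (\<lambda>w. h w * g w))"
proof (cases "a = b")
  case True then show ?thesis by (auto intro: has_bochner_integral_zero)
next
  case False
  then have ab: "0 \<le> a" "a < b" using h by (auto simp: step_def)
  have 1: "has_bochner_integral M (\<lambda>w. (h w * g w) * (W b w - W a w)\<^sup>2)
      ((b - a) * expectation (\<lambda>w. h w * g w))"
    by (rule past_times_increment) (use h g ab assms(3) integrable_step_mult[OF h g] in \<open>auto simp: step_def\<close>)
  have "step b d g" using g ab assms(3) by (auto simp: step_def intro: measurable_F_mono[of a])
  then have 2: "has_bochner_integral M (\<lambda>w. (h w * (W b w - W a w)) * (g w * (W d w - W b w))) 0"
    by (intro cross_disjoint[OF h]) auto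
  show ?thesis
    using has_bochner_integral_add[OF 1 2] by (simp add: algebra_simps power2_eq_square)
qed

text \<open>The coefficient is the length of the overlap of the two intervals. Cutting the first one
  at \<open>c\<close> leaves a disjoint piece, contributing nothing, and a piece that starts where
  the second interval starts.\<close>

lemma cross_ordered:
  assumes h: "step a b h" and g: "step c d g" and "a \<le> c"
  shows "has_bochner_integral M (\<lambda>w. (h w * (W b w - W a w)) * (g w * (W d w - W c w)))
    (max 0 (min b d - c) * expectation (\<lambda>w. h w * g w))"
proof (cases "b \<le> c")
  case True
  then have "max 0 (min b d - c) = 0" by auto
  then show ?thesis using cross_disjoint[OF h g True] by simp
next
  case False
  have hl: "step a c h" and hr: "step c b h"
    using h assms(3) False by (auto simp: step_def intro: measurable_F_mono[of a])
  have 1: "has_bochner_integral M (\<lambda>w. (h w * (W c w - W a w)) * (g w * (W d w - W c w))) 0"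
    by (rule cross_disjoint[OF hl g]) simp
  have 2: "has_bochner_integral M (\<lambda>w. (h w * (W b w - W c w)) * (g w * (W d w - W c w)))
    ((min b d - c) * expectation (\<lambda>w. h w * g w))"
  proof (cases "b \<le> d")
    case True
    then show ?thesis using cross_same_left[OF hr g True] by (simp add: min_def)
  next
    case False
    then have "d \<le> b" by simp
    from cross_same_left[OF g hr this] show ?thesis using False by (simp add: mult.commute)
  qed
  have "max 0 (min b d - c) = min b d - c" using False g by (auto simp: step_def)
  then show ?thesis using has_bochner_integral_add[OF 1 2]
    by (simp add: distrib_right[symmetric] distrib_left[symmetric])
qed

lemma cross_increments:
  assumes h: "step a b h" and g: "step c d g"
  shows "has_bochner_integral M (\<lambda>w. (h w * (W b w - W a w)) * (g w * (W d w - W c w)))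
    (max 0 (min b d - max a c) * expectation (\<lambda>w. h w * g w))"
proof (cases "a \<le> c")
  case True
  then show ?thesis using cross_ordered[OF h g True] by (simp add: max_def)
next
  case False
  then have "c \<le> a" by simp
  from cross_ordered[OF g h this] show ?thesis using False by (simp add: max_def min.commute mult.commute)
qed

text \<open>The intervals may overlap in any way, since all pairwise covariances are known. So the
  difference of two simple integrals over different partitions is covered without passing to a
  common refinement.\<close>

lemma ito_isometry:
  assumes J: "finite J" and st: "\<And>j. j \<in> J \<Longrightarrow> step (a j) (b j) (h j)"
  shows "(\<integral>\<^sup>+w. ennreal ((\<Sum>j\<in>J. h j w * (W (b j) w - W (a j) w))\<^sup>2) \<partial>M) =
    (\<integral>\<^sup>+w. (\<integral>\<^sup>+s. ennreal ((\<Sum>j\<in>J. h j w * indicator {a j<..b j} s)\<^sup>2) \<partial>lborel) \<partial>M)"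
proof -
  let ?o = "\<lambda>j k. max 0 (min (b j) (b k) - max (a j) (a k))"
  let ?R = "\<Sum>j\<in>J. \<Sum>k\<in>J. ?o j k * expectation (\<lambda>w. h j w * h k w)"
  have "has_bochner_integral M (\<lambda>w. (\<Sum>j\<in>J. h j w * (W (b j) w - W (a j) w))\<^sup>2) ?R"
    unfolding power2_eq_square sum_product
    by (intro has_bochner_integral_sum cross_increments st)
  then have L: "(\<integral>\<^sup>+w. ennreal ((\<Sum>j\<in>J. h j w * (W (b j) w - W (a j) w))\<^sup>2) \<partial>M) = ennreal ?R"
    by (auto simp: has_bochner_integral_iff nn_integral_eq_integral)
  have inner: "has_bochner_integral lborel (\<lambda>s. (\<Sum>j\<in>J. h j w * indicator {a j<..b j} s)\<^sup>2)
      (\<Sum>j\<in>J. \<Sum>k\<in>J. ?o j k * (h j w * h k w))" for w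
    unfolding power2_eq_square sum_product
  proof (intro has_bochner_integral_sum)
    fix j k
    have "{a j<..b j} \<inter> {a k<..b k} = {max (a j) (a k)<..min (b j) (b k)}" by auto
    then have "has_bochner_integral lborel (indicator ({a j<..b j} \<inter> {a k<..b k}) :: real \<Rightarrow> real) (?o j k)"
      using has_bochner_integral_real_indicator[of "{max (a j) (a k)<..min (b j) (b k)}" lborel]
      by (cases "max (a j) (a k) \<le> min (b j) (b k)") (auto simp: max_def)
    from has_bochner_integral_mult_left[where c = "h j w * h k w", OF this]
    show "has_bochner_integral lborel (\<lambda>s. h j w * indicator {a j<..b j} s * (h k w * indicator {a k<..b k} s))
        (?o j k * (h j w * h k w))"
      by (simp add: indicator_inter_arith ac_simps del: Int_greaterThanAtMost)
  qed
  then have inner': "(\<integral>\<^sup>+s. ennreal ((\<Sum>j\<in>J. h j w * indicator {a j<..b j} s)\<^sup>2) \<partial>lborel)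
      = ennreal (\<Sum>j\<in>J. \<Sum>k\<in>J. ?o j k * (h j w * h k w))"
    and nonneg: "0 \<le> (\<Sum>j\<in>J. \<Sum>k\<in>J. ?o j k * (h j w * h k w))" for w
    using inner[of w] integral_nonneg_AE[of "\<lambda>s. (\<Sum>j\<in>J. h j w * indicator {a j<..b j} s)\<^sup>2" lborel]
    by (auto simp: has_bochner_integral_iff nn_integral_eq_integral)
  have "has_bochner_integral M (\<lambda>w. \<Sum>j\<in>J. \<Sum>k\<in>J. ?o j k * (h j w * h k w)) ?R"
    by (intro has_bochner_integral_sum has_bochner_integral_mult_right)
       (auto simp: has_bochner_integral_iff intro!: integrable_step_mult st)
  then have "(\<integral>\<^sup>+w. ennreal (\<Sum>j\<in>J. \<Sum>k\<in>J. ?o j k * (h j w * h k w)) \<partial>M) = ennreal ?R"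
    using nonneg by (auto simp: has_bochner_integral_iff nn_integral_eq_integral)
  then show ?thesis unfolding L inner' by simp
qed

end

section \<open>Dynkin's formula for simple integrands\<close>

lemma continuous_lipschitz2:
  fixes f :: "real \<Rightarrow> real \<Rightarrow> real"
  assumes "\<And>t x s y. \<bar>f t x - f s y\<bar> \<le> C * (\<bar>t - s\<bar> + \<bar>x - y\<bar>)"
  shows "continuous_on UNIV (\<lambda>p. f (fst p) (snd p))"
  unfolding continuous_on
proof (intro ballI)
  fix p :: "real \<times> real"
  have "((\<lambda>q. f (fst q) (snd q) - f (fst p) (snd p)) \<longlongrightarrow> 0) (at p)"
  proof (rule Lim_null_comparison)
    show "\<forall>\<^sub>F q in at p. norm (f (fst q) (snd q) - f (fst p) (snd p))
      \<le> C * (\<bar>fst q - fst p\<bar> + \<bar>snd q - snd p\<bar>)" using assms by auto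
    have "((\<lambda>q. C * (\<bar>fst q - fst p\<bar> + \<bar>snd q - snd p\<bar>)) \<longlongrightarrow> C * (\<bar>fst p - fst p\<bar> + \<bar>snd p - snd p\<bar>)) (at p)"
      by (intro tendsto_intros)
    then show "((\<lambda>q. C * (\<bar>fst q - fst p\<bar> + \<bar>snd q - snd p\<bar>)) \<longlongrightarrow> 0) (at p)" by simp
  qed
  then show "((\<lambda>q. f (fst q) (snd q)) \<longlongrightarrow> f (fst p) (snd p)) (at p)"
    by (simp add: LIM_zero_iff)
qed

text \<open>A single constant bounds all functions and Lipschitz quotients, which keeps the later
  estimates short. Lipschitz continuity of \<open>\<phi>xx\<close> is exactly what makes the spatial
  Taylor remainder cubic, and it still holds for second derivatives that are piecewise
  linear.\<close>

locale lipschitz_test =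
  fixes B :: real and \<phi> \<phi>t \<phi>x \<phi>xx :: "real \<Rightarrow> real \<Rightarrow> real"
  assumes bounded: "\<bar>\<phi> t x\<bar> \<le> B" "\<bar>\<phi>t t x\<bar> \<le> B" "\<bar>\<phi>x t x\<bar> \<le> B" "\<bar>\<phi>xx t x\<bar> \<le> B"
    and deriv_t: "((\<lambda>s. \<phi> s x) has_real_derivative \<phi>t t x) (at t)"
    and deriv_x: "(\<phi> t has_real_derivative \<phi>x t x) (at x)"
    and deriv_xx: "(\<phi>x t has_real_derivative \<phi>xx t x) (at x)"
    and lipschitz_t: "\<bar>\<phi>t t x - \<phi>t s y\<bar> \<le> B * (\<bar>t - s\<bar> + \<bar>x - y\<bar>)"
    and lipschitz_xx: "\<bar>\<phi>xx t x - \<phi>xx s y\<bar> \<le> B * (\<bar>t - s\<bar> + \<bar>x - y\<bar>)"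
begin

lemma B_nonneg: "0 \<le> B"
  using bounded(1)[of 0 0] by linarith

lemma mean_value_t: "\<exists>c. \<phi> v y - \<phi> u y = (v - u) * \<phi>t c y \<and> \<bar>c - u\<bar> \<le> \<bar>v - u\<bar>"
proof (cases u v rule: linorder_cases)
  case less
  from MVT2[OF this, of "\<lambda>s. \<phi> s y" "\<lambda>s. \<phi>t s y"] deriv_t obtain z
    where "u < z" "z < v" "\<phi> v y - \<phi> u y = (v - u) * \<phi>t z y" by blast
  then show ?thesis by (intro exI[of _ z]) auto
next
  case greater
  from MVT2[OF this, of "\<lambda>s. \<phi> s y" "\<lambda>s. \<phi>t s y"] deriv_t obtain z
    where "v < z" "z < u" "\<phi> u y - \<phi> v y = (u - v) * \<phi>t z y" by blast
  then show ?thesis by (intro exI[of _ z]) (auto simp: algebra_simps)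
qed (auto intro!: exI[of _ u])

lemma lipschitz_x: "\<bar>\<phi> t x - \<phi> t y\<bar> \<le> B * \<bar>x - y\<bar>"
proof -
  have "norm (\<phi> t x - \<phi> t y) \<le> B * norm (x - y)"
    by (rule field_differentiable_bound[of UNIV _ "\<phi>x t"])
       (auto intro: has_field_derivative_at_within deriv_x bounded)
  then show ?thesis by simp
qed

text \<open>Taylor's formula leaves \<open>\<phi>xx\<close> at an intermediate point; moving it to
  \<open>x\<close> costs another factor \<open>\<bar>y - x\<bar>\<close> by the Lipschitz
  condition.\<close>

lemma taylor_x:
  "\<bar>\<phi> u y - \<phi> u x - (y - x) * \<phi>x u x - (y - x)\<^sup>2 / 2 * \<phi>xx u x\<bar> \<le> B * \<bar>y - x\<bar> ^ 3"
proof (cases "x = y")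
  case False
  define D where "D = (\<lambda>m::nat. if m = 0 then \<phi> u else if m = 1 then \<phi>x u else \<phi>xx u)"
  have "\<exists>t. (if y < x then y < t \<and> t < x else x < t \<and> t < y) \<and>
     \<phi> u y = (\<Sum>m<2. D m x / fact m * (y - x) ^ m) + D 2 t / fact 2 * (y - x) ^ 2"
    by (rule Taylor[of 2 D "\<phi> u" "min x y" "max x y" x y])
       (use False deriv_x deriv_xx in \<open>auto simp: D_def less_2_cases_iff\<close>)
  then obtain t where *: "(if y < x then y < t \<and> t < x else x < t \<and> t < y) \<and>
     \<phi> u y = (\<Sum>m<2. D m x / fact m * (y - x) ^ m) + D 2 t / fact 2 * (y - x) ^ 2" by blast
  then have t: "\<bar>t - x\<bar> \<le> \<bar>y - x\<bar>" by (auto split: if_splits)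
  have eq: "\<phi> u y = \<phi> u x + \<phi>x u x * (y - x) + \<phi>xx u t / 2 * (y - x)\<^sup>2"
    using * by (simp add: D_def lessThan_Suc numeral_2_eq_2)
  have "\<phi> u y - \<phi> u x - (y - x) * \<phi>x u x - (y - x)\<^sup>2 / 2 * \<phi>xx u x
      = (y - x)\<^sup>2 / 2 * (\<phi>xx u t - \<phi>xx u x)" unfolding eq by (simp add: field_simps)
  also have "\<bar>\<dots>\<bar> = \<bar>y - x\<bar>\<^sup>2 / 2 * \<bar>\<phi>xx u t - \<phi>xx u x\<bar>" by (simp add: abs_mult)
  also have "\<dots> \<le> \<bar>y - x\<bar>\<^sup>2 / 2 * (B * (\<bar>u - u\<bar> + \<bar>t - x\<bar>))"
    by (intro mult_left_mono lipschitz_xx) auto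
  also have "\<dots> \<le> \<bar>y - x\<bar>\<^sup>2 * (B * \<bar>y - x\<bar>)"
    using t B_nonneg by (intro mult_mono) auto
  finally show ?thesis by (simp add: power3_eq_cube power2_eq_square ac_simps)
qed auto

text \<open>Time is moved first, at the end point \<open>y\<close>, and space afterwards, at the
  initial time \<open>u\<close>. Replacing \<open>\<phi>t\<close> at the point thus reached by its
  value at \<open>(u, x)\<close> produces the mixed term.\<close>

lemma taylor:
  "\<bar>\<phi> v y - \<phi> u x - (v - u) * \<phi>t u x - (y - x) * \<phi>x u x - (y - x)\<^sup>2 / 2 * \<phi>xx u x\<bar>
    \<le> B * (\<bar>v - u\<bar>\<^sup>2 + \<bar>v - u\<bar> * \<bar>y - x\<bar> + \<bar>y - x\<bar> ^ 3)"
proof -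
  obtain c where c: "\<phi> v y - \<phi> u y = (v - u) * \<phi>t c y" "\<bar>c - u\<bar> \<le> \<bar>v - u\<bar>"
    using mean_value_t by blast
  have "\<bar>\<phi>t c y - \<phi>t u x\<bar> \<le> B * (\<bar>c - u\<bar> + \<bar>y - x\<bar>)" by (rule lipschitz_t)
  also have "\<dots> \<le> B * (\<bar>v - u\<bar> + \<bar>y - x\<bar>)" using c B_nonneg by (intro mult_left_mono) auto
  finally have "\<bar>v - u\<bar> * \<bar>\<phi>t c y - \<phi>t u x\<bar> \<le> \<bar>v - u\<bar> * (B * (\<bar>v - u\<bar> + \<bar>y - x\<bar>))"
    by (intro mult_left_mono) auto
  then have "\<bar>\<phi> v y - \<phi> u y - (v - u) * \<phi>t u x\<bar> \<le> \<bar>v - u\<bar> * (B * (\<bar>v - u\<bar> + \<bar>y - x\<bar>))"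
    using c(1) by (simp add: abs_mult[symmetric] right_diff_distrib)
  then show ?thesis using taylor_x[of u y x]
    by (simp add: power2_eq_square algebra_simps)
qed

lemma continuous_t: "continuous_on UNIV (\<lambda>p. \<phi>t (fst p) (snd p))"
  by (rule continuous_lipschitz2[OF lipschitz_t])

lemma continuous_xx: "continuous_on UNIV (\<lambda>p. \<phi>xx (fst p) (snd p))"
  by (rule continuous_lipschitz2[OF lipschitz_xx])

lemma measurable_sections [measurable]:
  "\<phi> t \<in> borel_measurable borel" "\<phi>t t \<in> borel_measurable borel"
  "\<phi>x t \<in> borel_measurable borel" "\<phi>xx t \<in> borel_measurable borel"
proof -
  have "continuous_on UNIV (\<lambda>x. f (fst (t, x)) (snd (t, x)))"
    if "continuous_on UNIV (\<lambda>p. f (fst p) (snd p))" for f :: "real \<Rightarrow> real \<Rightarrow> real"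
    by (rule continuous_on_compose2[OF that]) (auto intro!: continuous_intros)
  from this[OF continuous_t] this[OF continuous_xx]
  show "\<phi>t t \<in> borel_measurable borel" "\<phi>xx t \<in> borel_measurable borel"
    by (auto intro: borel_measurable_continuous_onI)
  show "\<phi> t \<in> borel_measurable borel" "\<phi>x t \<in> borel_measurable borel"
    using deriv_x deriv_xx
    by (auto intro!: borel_measurable_continuous_onI DERIV_continuous_on)
qed

end

section \<open>Absolute moments and the expansion over one time step\<close>

context driven_bm
begin

text \<open>With \<open>q = sqrt (t - s)\<close>, the arithmetic-geometric mean inequality gives
  \<open>d \<le> (q + d^2 / q) / 2\<close>, and multiplication by \<open>d^2\<close> gives the cubic
  version. Only even moments remain on the right. The constant 2 is \<open>(1 + 3) / 2\<close>,
  where 3 comes from the fourth moment.\<close>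

lemma increment_abs_moment:
  assumes "0 \<le> s" "s \<le> t"
  shows "integrable M (\<lambda>w. \<bar>W t w - W s w\<bar>)" "expectation (\<lambda>w. \<bar>W t w - W s w\<bar>) \<le> sqrt (t - s)"
    and "integrable M (\<lambda>w. \<bar>W t w - W s w\<bar> ^ 3)"
      "expectation (\<lambda>w. \<bar>W t w - W s w\<bar> ^ 3) \<le> 2 * (t - s) * sqrt (t - s)"
proof -
  let ?D = "\<lambda>w. W t w - W s w" and ?q = "sqrt (t - s)"
  note mom = increment_moment[OF assms]
  have D: "?D \<in> borel_measurable M" using assms by (intro borel_measurable_diff W_measurable) auto
  note [measurable] = D
  show i1: "integrable M (\<lambda>w. \<bar>?D w\<bar>)" using mom(1) by (auto simp: has_bochner_integral_iff)
  have i2: "integrable M (\<lambda>w. (?D w)\<^sup>2)" "integrable M (\<lambda>w. (?D w) ^ 4)"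
    and e2: "expectation (\<lambda>w. (?D w)\<^sup>2) = t - s" "expectation (\<lambda>w. (?D w) ^ 4) = 3 * (t - s)\<^sup>2"
    using mom by (auto simp: has_bochner_integral_iff)
  show i3: "integrable M (\<lambda>w. \<bar>?D w\<bar> ^ 3)"
  proof (rule Bochner_Integration.integrable_bound[of _ "\<lambda>w. (?D w)\<^sup>2 + (?D w) ^ 4"])
    show "AE w in M. norm (\<bar>?D w\<bar> ^ 3) \<le> norm ((?D w)\<^sup>2 + (?D w) ^ 4)"
    proof (rule AE_I2)
      fix w
      define d where "d = \<bar>?D w\<bar>"
      have "0 \<le> d\<^sup>2 * (1 - d)\<^sup>2" by simp
      then have "2 * d ^ 3 \<le> d\<^sup>2 + d ^ 4" by (simp add: power2_eq_square power3_eq_cube power4_eq_xxxx algebra_simps)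
      moreover have "0 \<le> d ^ 3" by (simp add: d_def)
      ultimately have "d ^ 3 \<le> d\<^sup>2 + d ^ 4" by linarith
      then show "norm (\<bar>?D w\<bar> ^ 3) \<le> norm ((?D w)\<^sup>2 + (?D w) ^ 4)"
        by (simp add: d_def power_even_abs)
    qed
  qed (use i2 in auto)
  have *: "expectation (\<lambda>w. \<bar>?D w\<bar>) \<le> ?q \<and> expectation (\<lambda>w. \<bar>?D w\<bar> ^ 3) \<le> 2 * (t - s) * ?q"
  proof (cases "s = t")
    case False
    then have q: "?q > 0" and qq: "t - s = ?q * ?q" using assms by auto
    have 1: "d \<le> (?q + d\<^sup>2 / ?q) / 2" "d ^ 3 \<le> (?q * d\<^sup>2 + d ^ 4 / ?q) / 2" if "d \<ge> 0" for d
    proof -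
      have "0 \<le> (d - ?q)\<^sup>2 / ?q" using q by simp
      then show *: "d \<le> (?q + d\<^sup>2 / ?q) / 2"
        using q by (simp add: power2_eq_square field_simps)
      then have "d * d\<^sup>2 \<le> (?q + d\<^sup>2 / ?q) / 2 * d\<^sup>2" by (intro mult_right_mono) auto
      then show "d ^ 3 \<le> (?q * d\<^sup>2 + d ^ 4 / ?q) / 2"
        by (simp add: power2_eq_square power3_eq_cube power4_eq_xxxx field_simps)
    qed
    have "expectation (\<lambda>w. \<bar>?D w\<bar>) \<le> expectation (\<lambda>w. (?q + (?D w)\<^sup>2 / ?q) / 2)"
      using 1(1)[of "\<bar>_\<bar>"] i1 i2 by (intro integral_mono) auto
    also have "\<dots> = ?q" using i2 e2 q qq by (simp add: prob_space field_simps)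
    finally have a: "expectation (\<lambda>w. \<bar>?D w\<bar>) \<le> ?q" .
    have "expectation (\<lambda>w. \<bar>?D w\<bar> ^ 3) \<le> expectation (\<lambda>w. (?q * (?D w)\<^sup>2 + (?D w) ^ 4 / ?q) / 2)"
      using 1(2)[of "\<bar>_\<bar>"] i3 i2 by (intro integral_mono) (auto simp: power_even_abs)
    also have "\<dots> = (?q * (t - s) + 3 * (t - s)\<^sup>2 / ?q) / 2" using i2 e2 by simp
    also have "\<dots> = (?q * (t - s) + 3 * ((t - s) * ((t - s) / ?q))) / 2" by (simp add: power2_eq_square)
    also have "(t - s) / ?q = ?q" using assms by (intro real_div_sqrt) auto
    finally show ?thesis using a by (simp add: field_simps)
  qed auto
  then show "expectation (\<lambda>w. \<bar>?D w\<bar>) \<le> ?q" "expectation (\<lambda>w. \<bar>?D w\<bar> ^ 3) \<le> 2 * (t - s) * ?q"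
    by auto
qed

end

locale bm_test = driven_bm M W \<xi> + lipschitz_test B \<phi> \<phi>t \<phi>x \<phi>xx
  for M :: "'a measure" and W \<xi> B \<phi> \<phi>t \<phi>x \<phi>xx
begin

text \<open>By the Taylor expansion, \<open>\<phi> v (X v) - \<phi> u (X u)\<close> has expectation \<open>(v - u) g u\<close> up to
  \<open>O((v - u) powr (3 / 2))\<close>: the first-order term has mean zero, and the square of the increment is
  replaced by its mean.\<close>

lemma one_step:
  assumes ab: "0 \<le> a" "a \<le> b"
    and Y: "Y \<in> borel_measurable (F a)" and h: "h \<in> borel_measurable (F a)"
    and K: "\<And>w. w \<in> space M \<Longrightarrow> \<bar>h w\<bar> \<le> K"
  defines "X \<equiv> \<lambda>r w. Y w + h w * (W r w - W a w)"
  defines "g \<equiv> \<lambda>r. expectation (\<lambda>w. \<phi>t r (X r w) + \<phi>xx r (X r w) * (h w)\<^sup>2 / 2)"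
  shows "(g has_integral (expectation (\<lambda>w. \<phi> b (X b w)) - expectation (\<lambda>w. \<phi> a (X a w)))) {a..b}"
proof -
  obtain w0 where "w0 \<in> space M" using not_empty by blast
  then have K0: "0 \<le> K" using K[of w0] by linarith
  have XF: "X r \<in> borel_measurable (F r)" if "a \<le> r" for r
    unfolding X_def using Y h that ab
    by (intro borel_measurable_add borel_measurable_times borel_measurable_diff W_measurable_F)
       (auto intro: measurable_F_mono[of a])
  have Xm: "X r \<in> borel_measurable M" if "a \<le> r" for r using XF[OF that] by (rule measurable_F)
  have hM: "h \<in> borel_measurable M" using h by (rule measurable_F)
  have h2: "(h w)\<^sup>2 \<le> K\<^sup>2" if "w \<in> space M" for w
    using K[OF that] by (simp add: abs_le_square_iff[symmetric] K0)
  let ?F = "\<lambda>r. expectation (\<lambda>w. \<phi> r (X r w))"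
  let ?G = "\<lambda>r w. \<phi>t r (X r w) + \<phi>xx r (X r w) * (h w)\<^sup>2 / 2"
  have iG: "integrable M (?G r)" if "a \<le> r" for r
  proof (rule integrable_bounded[of _ "B + B * K\<^sup>2 / 2"])
    show "?G r \<in> borel_measurable M" using Xm[OF that] hM by measurable
    fix w assume "w \<in> space M"
    then have "\<bar>\<phi>xx r (X r w) * (h w)\<^sup>2 / 2\<bar> \<le> B * K\<^sup>2 / 2"
      using bounded h2 B_nonneg by (auto simp: abs_mult intro!: mult_mono)
    then show "\<bar>?G r w\<bar> \<le> B + B * K\<^sup>2 / 2" using bounded(2)[of r "X r w"] by linarith
  qed
  have iF: "integrable M (\<lambda>w. \<phi> r (X r w))" if "a \<le> r" for r
    by (rule integrable_bounded[of _ B]) (use Xm[OF that] bounded in auto)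
  \<comment> \<open>\<open>m1 d\<close> will bound the oscillation of \<open>g\<close> over a time
    \<open>d\<close>, and \<open>m2 d\<close> the Taylor remainder per unit of time. The factor
    \<open>1 + K\<^sup>2 / 2\<close> collects the two terms of \<open>g\<close>; the last term of
    \<open>m2\<close> comes from the third absolute moment. Both vanish like
    \<open>sqrt d\<close>.\<close>
  define m1 where "m1 = (\<lambda>d. B * (1 + K\<^sup>2 / 2) * (d + K * sqrt d))"
  define m2 where "m2 = (\<lambda>d. B * (d + K * sqrt d + K ^ 3 * (2 * sqrt d)))"
  have incr: "\<bar>X v w - X u w\<bar> = \<bar>h w\<bar> * \<bar>W v w - W u w\<bar>" for u v w
    by (simp add: X_def abs_mult[symmetric] right_diff_distrib)
  have incr_K: "\<bar>X v w - X u w\<bar> \<le> K * \<bar>W v w - W u w\<bar>" if "w \<in> space M" for u v w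
    unfolding incr using K[OF that] by (intro mult_right_mono) auto
  have m1: "\<bar>g u - g v\<bar> \<le> m1 (v - u)" if uv: "a \<le> u" "u \<le> v" for u v
  proof -
    have u0: "0 \<le> u" "a \<le> v" using uv ab by auto
    note D = increment_abs_moment[OF u0(1) uv(2)]
    let ?c = "\<lambda>w. B * (1 + K\<^sup>2 / 2) * ((v - u) + K * \<bar>W v w - W u w\<bar>)"
    have "\<bar>g u - g v\<bar> = \<bar>expectation (\<lambda>w. ?G u w - ?G v w)\<bar>"
      unfolding g_def using iG uv by (subst Bochner_Integration.integral_diff) auto
    also have "\<dots> \<le> expectation (\<lambda>w. \<bar>?G u w - ?G v w\<bar>)" by (rule integral_abs_bound)
    also have "\<dots> \<le> expectation (\<lambda>w. ?c w)"
    proof (rule integral_mono)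
      show "integrable M (\<lambda>w. \<bar>?G u w - ?G v w\<bar>)" using iG[of u] iG[of v] uv u0 by auto
      show "integrable M (\<lambda>w. ?c w)" using D by auto
      fix w assume w: "w \<in> space M"
      let ?b = "B * ((v - u) + K * \<bar>W v w - W u w\<bar>)"
      have le: "B * (\<bar>u - v\<bar> + \<bar>X u w - X v w\<bar>) \<le> ?b"
        using incr_K[OF w, of v u] uv B_nonneg by (intro mult_left_mono) auto
      have 1: "\<bar>\<phi>t u (X u w) - \<phi>t v (X v w)\<bar> \<le> ?b"
        using lipschitz_t le by (rule order_trans)
      have "\<bar>\<phi>xx u (X u w) - \<phi>xx v (X v w)\<bar> \<le> ?b"
        using lipschitz_xx le by (rule order_trans)
      then have "\<bar>\<phi>xx u (X u w) - \<phi>xx v (X v w)\<bar> * (h w)\<^sup>2 \<le> ?b * K\<^sup>2"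
        using h2[OF w] by (intro mult_mono) auto
      moreover have "\<bar>\<phi>xx u (X u w) - \<phi>xx v (X v w)\<bar> * (h w)\<^sup>2
          = \<bar>(\<phi>xx u (X u w) - \<phi>xx v (X v w)) * (h w)\<^sup>2\<bar>" by (simp add: abs_mult)
      moreover have "?G u w - ?G v w = (\<phi>t u (X u w) - \<phi>t v (X v w))
          + ((\<phi>xx u (X u w) - \<phi>xx v (X v w)) * (h w)\<^sup>2) / 2"
        by (simp add: left_diff_distrib diff_divide_distrib)
      ultimately have "\<bar>?G u w - ?G v w\<bar> \<le> ?b + ?b * K\<^sup>2 / 2"
        using 1 by linarith
      moreover have "B * (1 + K\<^sup>2 / 2) * c = B * c + B * c * K\<^sup>2 / 2" for c
        by (simp add: distrib_left distrib_right)
      ultimately show "\<bar>?G u w - ?G v w\<bar> \<le> ?c w"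
        by simp
    qed
    also have "\<dots> = B * (1 + K\<^sup>2 / 2) * ((v - u) + K * expectation (\<lambda>w. \<bar>W v w - W u w\<bar>))"
      using D by (simp add: prob_space)
    also have "\<dots> \<le> m1 (v - u)"
      unfolding m1_def using D B_nonneg K0 by (intro mult_left_mono add_left_mono) auto
    finally show ?thesis .
  qed
  have m2: "\<bar>?F v - ?F u - (v - u) * g u\<bar> \<le> (v - u) * m2 (v - u)" if uv: "a \<le> u" "u \<le> v" for u v
  proof -
    have u0: "0 \<le> u" "a \<le> v" using uv ab by auto
    note D = increment_abs_moment[OF u0(1) uv(2)]
    let ?c = "\<lambda>w. B * ((v - u)\<^sup>2 + (v - u) * (K * \<bar>W v w - W u w\<bar>) + K ^ 3 * \<bar>W v w - W u w\<bar> ^ 3)"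
    let ?Z1 = "\<lambda>w. h w * \<phi>x u (X u w)" and ?Z2 = "\<lambda>w. (h w)\<^sup>2 * \<phi>xx u (X u w)"
    have hu: "h \<in> borel_measurable (F u)" using h uv by (auto intro: measurable_F_mono[of a])
    have Z: "?Z1 \<in> borel_measurable (F u)" "?Z2 \<in> borel_measurable (F u)"
      using XF[OF uv(1)] hu by measurable
    have iZ1: "integrable M ?Z1"
      by (rule integrable_bounded[OF measurable_F[OF Z(1)], of "K * B"])
         (use K bounded K0 in \<open>auto simp: abs_mult intro!: mult_mono\<close>)
    have iZ2: "integrable M ?Z2"
      by (rule integrable_bounded[OF measurable_F[OF Z(2)], of "K\<^sup>2 * B"])
         (use h2 bounded in \<open>auto simp: abs_mult intro!: mult_mono\<close>)
    note P1 = past_times_increment(1)[OF u0(1) uv(2) Z(1) iZ1]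
    note P2 = past_times_increment(2)[OF u0(1) uv(2) Z(2) iZ2]
    have it: "integrable M (\<lambda>w. \<phi>t u (X u w))"
      by (rule integrable_bounded[of _ B]) (use Xm[OF uv(1)] bounded in auto)
    define R where "R = (\<lambda>w. \<phi> v (X v w) - \<phi> u (X u w) - (v - u) * \<phi>t u (X u w)
        - ?Z1 w * (W v w - W u w) - ?Z2 w * (W v w - W u w)\<^sup>2 / 2)"
    have iR: "integrable M R"
      unfolding R_def using iF[of u] iF[of v] uv u0 it P1 P2 by (auto simp: has_bochner_integral_iff)
    have gu: "g u = expectation (\<lambda>w. \<phi>t u (X u w)) + expectation ?Z2 / 2"
    proof -
      have "g u = expectation (\<lambda>w. \<phi>t u (X u w) + ?Z2 w / 2)" unfolding g_def by (simp add: mult.commute)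
      then show ?thesis using it iZ2 by simp
    qed
    have ER: "expectation R = ?F v - ?F u - (v - u) * g u"
    proof -
      have "expectation R = ?F v - ?F u - (v - u) * expectation (\<lambda>w. \<phi>t u (X u w)) - 0
          - (v - u) * expectation ?Z2 / 2"
        unfolding R_def using iF[of u] iF[of v] uv u0 it P1 P2
        by (simp add: has_bochner_integral_iff)
      then show ?thesis unfolding gu by (simp add: field_simps)
    qed
    have "\<bar>expectation R\<bar> \<le> expectation (\<lambda>w. \<bar>R w\<bar>)" by (rule integral_abs_bound)
    also have "\<dots> \<le> expectation (\<lambda>w. ?c w)"
    proof (rule integral_mono)
      show "integrable M (\<lambda>w. \<bar>R w\<bar>)" using iR by auto
      show "integrable M (\<lambda>w. ?c w)" using D by auto
      fix w assume w: "w \<in> space M"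
      let ?d = "\<bar>X v w - X u w\<bar>"
      have XX: "X v w - X u w = h w * (W v w - W u w)" by (simp add: X_def algebra_simps)
      have "R w = \<phi> v (X v w) - \<phi> u (X u w) - (v - u) * \<phi>t u (X u w)
        - (X v w - X u w) * \<phi>x u (X u w) - (X v w - X u w)\<^sup>2 / 2 * \<phi>xx u (X u w)"
        unfolding R_def XX by (simp add: power_mult_distrib)
      then have "\<bar>R w\<bar> \<le> B * (\<bar>v - u\<bar>\<^sup>2 + \<bar>v - u\<bar> * ?d + ?d ^ 3)" using taylor by simp
      also have "\<dots> \<le> B * ((v - u)\<^sup>2 + (v - u) * (K * \<bar>W v w - W u w\<bar>)
        + (K * \<bar>W v w - W u w\<bar>) ^ 3)"
        using incr_K[OF w] uv B_nonneg by (intro mult_left_mono add_mono power_mono) (auto intro!: mult_left_mono)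
      finally show "\<bar>R w\<bar> \<le> ?c w" by (simp add: power_mult_distrib)
    qed
    also have "\<dots> = B * ((v - u)\<^sup>2 + (v - u) * (K * expectation (\<lambda>w. \<bar>W v w - W u w\<bar>))
        + K ^ 3 * expectation (\<lambda>w. \<bar>W v w - W u w\<bar> ^ 3))"
      using D by (simp add: prob_space)
    also have "\<dots> \<le> B * ((v - u)\<^sup>2 + (v - u) * (K * sqrt (v - u)) + K ^ 3 * (2 * (v - u) * sqrt (v - u)))"
      using D B_nonneg K0 uv by (intro mult_left_mono add_mono) auto
    also have "\<dots> = (v - u) * m2 (v - u)" by (simp add: m2_def power2_eq_square algebra_simps)
    finally show ?thesis unfolding ER .
  qed
  define m where "m = (\<lambda>d. m1 d + m2 d)"
  have m1_nonneg: "0 \<le> m1 d" if "0 \<le> d" for d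
    unfolding m1_def using that B_nonneg K0 by simp
  \<comment> \<open>The expansion needs the earlier time as its base point, because only future
    increments are independent. For \<open>v < u\<close> it is therefore made at \<open>v\<close>,
    and \<open>g v\<close> is exchanged for \<open>g u\<close> at the cost \<open>m1\<close>. This
    gives a two-sided derivative.\<close>
  have key: "\<bar>?F v - ?F u - (v - u) * g u\<bar> \<le> \<bar>v - u\<bar> * m \<bar>v - u\<bar>" if uv: "a \<le> u" "a \<le> v" for u v
  proof (cases "u \<le> v")
    case True
    have "\<bar>?F v - ?F u - (v - u) * g u\<bar> \<le> (v - u) * m2 (v - u)" by (rule m2[OF uv(1) True])
    also have "\<dots> \<le> (v - u) * m (v - u)" using True m1_nonneg unfolding m_def by (intro mult_left_mono) auto
    finally show ?thesis using True by simp
  next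
    case False
    then have vu: "v \<le> u" by simp
    have 1: "\<bar>?F u - ?F v - (u - v) * g v\<bar> \<le> (u - v) * m2 (u - v)" by (rule m2[OF uv(2) vu])
    have "\<bar>(u - v) * (g v - g u)\<bar> \<le> (u - v) * m1 (u - v)"
      using m1[OF uv(2) vu] vu by (auto simp: abs_mult intro!: mult_left_mono)
    then have "\<bar>?F v - ?F u - (v - u) * g u\<bar> \<le> (u - v) * m2 (u - v) + (u - v) * m1 (u - v)"
      using 1 by (simp add: algebra_simps)
    then show ?thesis using vu by (simp add: m_def algebra_simps)
  qed
  have "(?F has_real_derivative g u) (at u within {a..b})" if u: "u \<in> {a..b}" for u
    unfolding has_field_derivative_iff
  proof (rule LIM_zero_cancel, rule Lim_null_comparison)
    show "\<forall>\<^sub>F v in at u within {a..b}. norm ((?F v - ?F u) / (v - u) - g u) \<le> m \<bar>v - u\<bar>"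
      unfolding eventually_at_filter
    proof (intro always_eventually allI impI)
      fix v assume v: "v \<noteq> u" "v \<in> {a..b}"
      have "(?F v - ?F u) / (v - u) - g u = (?F v - ?F u - (v - u) * g u) / (v - u)"
        using v by (simp add: field_simps)
      then have "norm ((?F v - ?F u) / (v - u) - g u) = \<bar>?F v - ?F u - (v - u) * g u\<bar> / \<bar>v - u\<bar>" by simp
      also have "\<dots> \<le> m \<bar>v - u\<bar>" using key[of u v] v u by (simp add: divide_le_eq mult.commute)
      finally show "norm ((?F v - ?F u) / (v - u) - g u) \<le> m \<bar>v - u\<bar>" .
    qed
    have "((\<lambda>v. m \<bar>v - u\<bar>) \<longlongrightarrow> m \<bar>u - u\<bar>) (at u within {a..b})"
      unfolding m_def m1_def m2_def by (intro tendsto_intros)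
    then show "((\<lambda>v. m \<bar>v - u\<bar>) \<longlongrightarrow> 0) (at u within {a..b})" by (simp add: m_def m1_def m2_def)
  qed
  then show ?thesis
    using ab by (intro fundamental_theorem_of_calculus)
      (auto simp: has_real_derivative_iff_has_vector_derivative[symmetric])
qed

end

section \<open>Paths of simple integrals\<close>

context driven_bm
begin

text \<open>The initial value plus the integral of the simple process over \<open>[0,r]\<close>:
  capping the partition times at \<open>r\<close> truncates the current increment and cancels all
  later ones.\<close>

definition path :: "nat \<Rightarrow> (nat \<Rightarrow> real) \<Rightarrow> (nat \<Rightarrow> 'a \<Rightarrow> real) \<Rightarrow> real \<Rightarrow> 'a \<Rightarrow> real" where
  "path n \<tau> h r w = \<xi> w + (\<Sum>i<n. h i w * (W (min (\<tau> (Suc i)) r) w - W (min (\<tau> i) r) w))"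

context
  fixes t n \<tau> h
  assumes simple: "simple_integrand M F t n \<tau> h"
begin

lemma times_mono: "i \<le> j \<Longrightarrow> j \<le> n \<Longrightarrow> \<tau> i \<le> \<tau> j"
proof (induction j)
  case (Suc j)
  then show ?case using simple
    by (cases "i = Suc j") (auto simp: simple_integrand_def intro: order_trans[of _ "\<tau> j"])
qed auto

lemma times_nonneg: "i \<le> n \<Longrightarrow> 0 \<le> \<tau> i"
  using times_mono[of 0 i] simple by (auto simp: simple_integrand_def)

lemma times_le: "i \<le> n \<Longrightarrow> \<tau> i \<le> t"
  using times_mono[of i n] simple by (auto simp: simple_integrand_def)

lemma heights: assumes "i < n"
  shows "h i \<in> borel_measurable (F (\<tau> i))" "\<exists>K. \<forall>w\<in>space M. \<bar>h i w\<bar> \<le> K"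
  using simple assms by (auto simp: simple_integrand_def)

lemma path_measurable_F:
  assumes "0 \<le> r" shows "path n \<tau> h r \<in> borel_measurable (F r)"
proof -
  have "(\<lambda>w. h i w * (W (min (\<tau> (Suc i)) r) w - W (min (\<tau> i) r) w)) \<in> borel_measurable (F r)"
    if i: "i < n" for i
  proof (cases "\<tau> i \<le> r")
    case True
    have "0 \<le> \<tau> i" "0 \<le> \<tau> (Suc i)" using times_nonneg[of i] times_nonneg[of "Suc i"] i by auto
    then show ?thesis using heights[OF i] True assms
      by (intro borel_measurable_times borel_measurable_diff W_measurable_F)
         (auto intro: measurable_F_mono[of "\<tau> i"])
  next
    case False
    \<comment> \<open>An interval that begins after \<open>r\<close> contributes zero, so heights
      not yet known at \<open>r\<close> do not enter.\<close>
    then have "min (\<tau> (Suc i)) r = min (\<tau> i) r" using times_mono[of i "Suc i"] i by auto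
    then show ?thesis by simp
  qed
  then show ?thesis unfolding path_def
    by (intro borel_measurable_add borel_measurable_sum init_measurable_F) auto
qed

lemma path_segment:
  assumes "i < n" "\<tau> i \<le> r" "r \<le> \<tau> (Suc i)"
  shows "path n \<tau> h r w = path n \<tau> h (\<tau> i) w + h i w * (W r w - W (\<tau> i) w)"
proof -
  have "path n \<tau> h r w - path n \<tau> h (\<tau> i) w =
    (\<Sum>j<n. h j w * (W (min (\<tau> (Suc j)) r) w - W (min (\<tau> j) r) w)
      - h j w * (W (min (\<tau> (Suc j)) (\<tau> i)) w - W (min (\<tau> j) (\<tau> i)) w))"
    unfolding path_def by (simp add: sum_subtractf)
  also have "\<dots> = (\<Sum>j<n. if j = i then h i w * (W r w - W (\<tau> i) w) else 0)"
  proof (rule sum.cong[OF refl])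
    fix j assume "j \<in> {..<n}"
    then have j: "j < n" by simp
    consider "j = i" | "j < i" | "i < j" by linarith
    then show "h j w * (W (min (\<tau> (Suc j)) r) w - W (min (\<tau> j) r) w)
      - h j w * (W (min (\<tau> (Suc j)) (\<tau> i)) w - W (min (\<tau> j) (\<tau> i)) w)
      = (if j = i then h i w * (W r w - W (\<tau> i) w) else 0)"
    proof cases
      case 1 then show ?thesis using assms by (simp add: min_def)
    next
      case 2
      then have "\<tau> (Suc j) \<le> \<tau> i" "\<tau> j \<le> \<tau> i" using times_mono[of "Suc j" i] times_mono[of j i] assms by auto
      then show ?thesis using 2 assms by (simp add: min_def)
    next
      case 3
      then have "\<tau> (Suc i) \<le> \<tau> j" "\<tau> j \<le> \<tau> (Suc j)"
        using times_mono[of "Suc i" j] times_mono[of j "Suc j"] j by auto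
      then have "min (\<tau> (Suc j)) r = r" "min (\<tau> j) r = r"
        "min (\<tau> (Suc j)) (\<tau> i) = \<tau> i" "min (\<tau> j) (\<tau> i) = \<tau> i" using assms by auto
      then show ?thesis using 3 by simp
    qed
  qed
  also have "\<dots> = h i w * (W r w - W (\<tau> i) w)" using assms by simp
  finally show ?thesis by simp
qed

lemma process_segment:
  assumes "i < n" "\<tau> i < r" "r \<le> \<tau> (Suc i)"
  shows "simple_process n \<tau> h r w = h i w"
proof -
  have "simple_process n \<tau> h r w = (\<Sum>j<n. if j = i then h i w else 0)"
    unfolding simple_process_def
  proof (rule sum.cong[OF refl])
    fix j assume "j \<in> {..<n}"
    then have j: "j < n" by simp
    consider "j = i" | "j < i" | "i < j" by linarith
    then show "h j w * indicator {\<tau> j<..\<tau> (Suc j)} r = (if j = i then h i w else 0)"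
    proof cases
      case 1 then show ?thesis using assms by simp
    next
      case 2
      then have "\<tau> (Suc j) \<le> \<tau> i" using times_mono[of "Suc j" i] assms by auto
      then show ?thesis using 2 assms by simp
    next
      case 3
      then have "\<tau> (Suc i) \<le> \<tau> j" using times_mono[of "Suc i" j] j by auto
      then show ?thesis using 3 assms by simp
    qed
  qed
  then show ?thesis using assms by simp
qed

lemma path_before: "r \<le> \<tau> 0 \<Longrightarrow> path n \<tau> h r w = \<xi> w"
proof -
  assume r: "r \<le> \<tau> 0"
  have "min (\<tau> i) r = r" if "i \<le> n" for i using times_mono[of 0 i] that r by auto
  then show ?thesis unfolding path_def by (auto intro!: sum.neutral)
qed

lemma process_before: "r \<le> \<tau> 0 \<Longrightarrow> simple_process n \<tau> h r w = 0"
proof -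
  assume r: "r \<le> \<tau> 0"
  have "indicator {\<tau> i<..\<tau> (Suc i)} r = (0::real)" if "i < n" for i
    using times_mono[of 0 i] that r by auto
  then show ?thesis unfolding simple_process_def by (auto intro!: sum.neutral)
qed

lemma path_after: "\<tau> n \<le> r \<Longrightarrow> path n \<tau> h r w = path n \<tau> h (\<tau> n) w"
proof -
  assume r: "\<tau> n \<le> r"
  have "min (\<tau> i) r = min (\<tau> i) (\<tau> n)" if "i \<le> n" for i using times_mono[of i n] that r by auto
  then show ?thesis unfolding path_def by (auto intro!: sum.cong)
qed

lemma process_after: "\<tau> n < r \<Longrightarrow> simple_process n \<tau> h r w = 0"
proof -
  assume r: "\<tau> n < r"
  have "indicator {\<tau> i<..\<tau> (Suc i)} r = (0::real)" if "i < n" for i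
    using times_mono[of "Suc i" n] that r by auto
  then show ?thesis unfolding simple_process_def by (auto intro!: sum.neutral)
qed

end

end

context bm_test
begin

text \<open>The pieces before \<open>\<tau> 0\<close> and after \<open>\<tau> n\<close> are
  instances of the one-step formula with height zero; here the path is constant in time, but
  \<open>\<phi>\<close> still varies.\<close>

lemma dynkin_simple:
  assumes simple: "simple_integrand M F t n \<tau> h" and "0 \<le> t"
  defines "X \<equiv> path n \<tau> h"
  defines "g \<equiv> \<lambda>r. expectation (\<lambda>w. \<phi>t r (X r w) + \<phi>xx r (X r w) * (simple_process n \<tau> h r w)\<^sup>2 / 2)"
  shows "(g has_integral (expectation (\<lambda>w. \<phi> t (X t w)) - expectation (\<lambda>w. \<phi> 0 (\<xi> w)))) {0..t}"
proof -
  let ?E = "\<lambda>r. expectation (\<lambda>w. \<phi> r (X r w))"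
  have segment: "(g has_integral (?E b - ?E a)) {a..b}"
    if ab: "0 \<le> a" "a \<le> b" and k: "k \<in> borel_measurable (F a)" "\<forall>w\<in>space M. \<bar>k w\<bar> \<le> K"
      and X: "\<And>r w. a \<le> r \<Longrightarrow> r \<le> b \<Longrightarrow> X r w = X a w + k w * (W r w - W a w)"
      and S: "\<And>r w. a < r \<Longrightarrow> r \<le> b \<Longrightarrow> simple_process n \<tau> h r w = k w" for a b k K
  proof -
    have "X a \<in> borel_measurable (F a)" unfolding X_def by (rule path_measurable_F[OF simple ab(1)])
    note os = one_step[OF ab this k(1) k(2)[rule_format]]
    have X': "X a w + k w * (W r w - W a w) = X r w" if "a \<le> r" "r \<le> b" for r w
      using X[OF that] by simp
    \<comment> \<open>At \<open>a\<close> itself the simple process, which lives on half-open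
      intervals, still has its earlier value. Changing the rate at this one point does not change
      its integral.\<close>
    have "(g has_integral (expectation (\<lambda>w. \<phi> b (X a w + k w * (W b w - W a w)))
       - expectation (\<lambda>w. \<phi> a (X a w + k w * (W a w - W a w))))) {a..b}"
      by (rule has_integral_spike_finite[OF _ _ os, of "{a}"])
         (auto simp: g_def S X' intro!: Bochner_Integration.integral_cong)
    then show ?thesis using X'[of b] X'[of a] ab by simp
  qed
  have "(g has_integral (?E (\<tau> i) - ?E 0)) {0..\<tau> i}" if "i \<le> n" for i
    using that
  proof (induction i)
    case 0
    show ?case
    proof (rule segment[of 0 "\<tau> 0" "\<lambda>_. 0" 0])
      show "0 \<le> \<tau> 0" using times_nonneg[OF simple, of 0] by simp
    qed (auto simp: X_def path_before[OF simple] process_before[OF simple])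
  next
    case (Suc i)
    then have i: "i < n" by simp
    obtain K where K: "\<forall>w\<in>space M. \<bar>h i w\<bar> \<le> K" using heights[OF simple i] by blast
    have le: "0 \<le> \<tau> i" "\<tau> i \<le> \<tau> (Suc i)"
      using times_nonneg[OF simple, of i] times_mono[OF simple, of i "Suc i"] i by auto
    have "(g has_integral (?E (\<tau> (Suc i)) - ?E (\<tau> i))) {\<tau> i..\<tau> (Suc i)}"
      by (rule segment[OF le heights(1)[OF simple i] K])
         (auto simp: X_def process_segment[OF simple i] intro: path_segment[OF simple i])
    from has_integral_combine[OF le Suc.IH this] show ?case using i by simp
  qed
  from this[of n] have 1: "(g has_integral (?E (\<tau> n) - ?E 0)) {0..\<tau> n}" by simp
  have le: "0 \<le> \<tau> n" "\<tau> n \<le> t" using times_nonneg[OF simple, of n] times_le[OF simple, of n] by auto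
  have 2: "(g has_integral (?E t - ?E (\<tau> n))) {\<tau> n..t}"
  proof (rule segment[OF le, of "\<lambda>_. 0" 0])
    show "X r w = X (\<tau> n) w + 0 * (W r w - W (\<tau> n) w)" if "\<tau> n \<le> r" for r w
      using path_after[OF simple that] by (simp add: X_def)
  qed (auto simp: process_after[OF simple])
  have "X 0 w = \<xi> w" for w
    using path_before[OF simple, of 0] times_nonneg[OF simple, of 0] by (simp add: X_def)
  then show ?thesis using has_integral_combine[OF le 1 2] by simp
qed

end

section \<open>Approximation of the solution by simple integrals\<close>

abbreviation time :: "real \<Rightarrow> real measure" where
  "time t \<equiv> restrict_space lborel {0..t}"

lemma space_time [simp]: "space (time t) = {0..t}"
  by (simp add: space_restrict_space)

lemma finite_measure_time: "finite_measure (time t)"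
  by (rule finite_measureI) (simp add: emeasure_restrict_space emeasure_lborel_Icc_eq)

lemma nn_integral_time: "(\<integral>\<^sup>+s. f s \<partial>time t) = (\<integral>\<^sup>+s\<in>{0..t}. f s \<partial>lborel)"
  by (simp add: nn_integral_restrict_space)

lemma set_integrable_time: "set_integrable lborel {0..t} k \<longleftrightarrow> integrable (time t) k" for k :: "real \<Rightarrow> real"
  by (simp add: set_integrable_def integrable_restrict_space)

lemma sets_time: "sets (time t) = sets (restrict_space borel {0..t})"
  by (rule sets_restrict_space_cong) simp

lemma measurable_time_pair:
  "borel_measurable (restrict_space borel {0..t} \<Otimes>\<^sub>M N) = borel_measurable (time t \<Otimes>\<^sub>M N)"
  by (rule measurable_cong_sets[OF sets_pair_measure_cong[OF sets_time[symmetric] refl] refl])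

lemma id_measurable_time [measurable]: "(\<lambda>s. s) \<in> borel_measurable (time t)"
  by (simp add: measurable_restrict_space1)

context prob_space
begin

lemma pair_time: "pair_sigma_finite (time t) M"
  by (intro pair_sigma_finite.intro finite_measure.sigma_finite_measure finite_measure_time
      sigma_finite_measure_axioms)

lemma nn_integral_time_swap:
  assumes "case_prod f \<in> borel_measurable (time t \<Otimes>\<^sub>M M)"
  shows "(\<integral>\<^sup>+w. (\<integral>\<^sup>+s. f s w \<partial>time t) \<partial>M) = (\<integral>\<^sup>+s. (\<integral>\<^sup>+w. f s w \<partial>M) \<partial>time t)"
  using pair_sigma_finite.Fubini'[OF pair_time assms] by simp

text \<open>\<open>Y\<close> need not be jointly measurable, but it is once it is sampled at the times
  \<open>\<lfloor>(k + 1) s\<rfloor> / (k + 1)\<close>, and these converge to \<open>s\<close>.\<close>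

lemma measurable_expectation_process:
  fixes G :: "real \<Rightarrow> real \<Rightarrow> real \<Rightarrow> real"
  assumes Q[measurable]: "case_prod Q \<in> borel_measurable (time t \<Otimes>\<^sub>M M)"
    and Qint: "\<And>s. s \<in> {0..t} \<Longrightarrow> integrable M (Q s)"
    and Y: "\<And>s. s \<in> {0..t} \<Longrightarrow> Y s \<in> borel_measurable M"
    and cont: "AE w in M. continuous_on {0..t} (\<lambda>s. Y s w)"
    and G: "continuous_on UNIV (\<lambda>(s, y, z). G s y z)"
    and C: "\<And>s y z. \<bar>G s y z\<bar> \<le> C * (1 + \<bar>z\<bar>)"
  shows "(\<lambda>s. expectation (\<lambda>w. G s (Y s w) (Q s w))) \<in> borel_measurable (time t)"
proof (rule borel_measurable_LIMSEQ_real)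
  \<comment> \<open>Rounding down keeps every sampling time inside \<open>{0..t}\<close>, where
    \<open>Y\<close> is known to be measurable and continuous.\<close>
  define p where "p = (\<lambda>(k::nat) (s::real). real_of_int \<lfloor>s * real (Suc k)\<rfloor> / real (Suc k))"
  have p: "p k s \<in> {0..t}" "\<bar>p k s - s\<bar> \<le> 1 / real (Suc k)" if "s \<in> {0..t}" for k s
  proof -
    have le: "p k s \<le> s" unfolding p_def by (simp add: divide_le_eq)
    have ge: "0 \<le> p k s" using that by (simp add: p_def)
    have "s * real (Suc k) - 1 \<le> real_of_int \<lfloor>s * real (Suc k)\<rfloor>" by linarith
    then have "(s * real (Suc k) - 1) / real (Suc k) \<le> p k s"
      unfolding p_def by (intro divide_right_mono) auto
    then have "s - 1 / real (Suc k) \<le> p k s" by (simp add: diff_divide_distrib del: of_nat_Suc)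
    then show "p k s \<in> {0..t}" "\<bar>p k s - s\<bar> \<le> 1 / real (Suc k)" using le ge that by auto
  qed
  have Gm[measurable]: "(\<lambda>(s, y, z). G s y z) \<in> borel_measurable (borel \<Otimes>\<^sub>M borel \<Otimes>\<^sub>M borel)"
    using borel_measurable_continuous_onI[OF G] by (simp add: borel_prod)
  fix s assume "s \<in> space (time t)"
  then have s: "s \<in> {0..t}" by simp
  have Qs: "Q s \<in> borel_measurable M" using Qint[OF s] by auto
  have Gs: "(\<lambda>w. G s (Y r w) (Q s w)) \<in> borel_measurable M" if "r \<in> {0..t}" for r
  proof -
    have "(\<lambda>w. (s, Y r w, Q s w)) \<in> M \<rightarrow>\<^sub>M borel \<Otimes>\<^sub>M borel \<Otimes>\<^sub>M borel"
      using Y[OF that] Qs by measurable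
    from measurable_compose[OF this Gm] show ?thesis by simp
  qed
  show "(\<lambda>k. expectation (\<lambda>w. G s (Y (p k s) w) (Q s w))) \<longlonglongrightarrow> expectation (\<lambda>w. G s (Y s w) (Q s w))"
  proof (rule integral_dominated_convergence)
    show "integrable M (\<lambda>w. C * (1 + \<bar>Q s w\<bar>))" using Qint[OF s] by auto
    show "AE w in M. norm (G s (Y (p k s) w) (Q s w)) \<le> C * (1 + \<bar>Q s w\<bar>)" for k
      using C by auto
    show "AE w in M. (\<lambda>k. G s (Y (p k s) w) (Q s w)) \<longlonglongrightarrow> G s (Y s w) (Q s w)"
      using cont
    proof eventually_elim
      fix w assume c: "continuous_on {0..t} (\<lambda>s. Y s w)"
      have "(\<lambda>k. p k s - s) \<longlonglongrightarrow> 0"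
      proof (rule Lim_null_comparison)
        show "\<forall>\<^sub>F k in sequentially. norm (p k s - s) \<le> 1 / real (Suc k)" using p(2)[OF s] by simp
        show "(\<lambda>k. 1 / real (Suc k)) \<longlonglongrightarrow> 0" using LIMSEQ_inverse_real_of_nat by (simp add: inverse_eq_divide)
      qed
      then have "(\<lambda>k. p k s) \<longlonglongrightarrow> s" by (rule LIM_zero_cancel)
      then have Yk: "(\<lambda>k. Y (p k s) w) \<longlonglongrightarrow> Y s w"
        using p(1)[OF s] by (intro continuous_on_tendsto_compose[OF c _ s] always_eventually) auto
      have "(\<lambda>k. (s, Y (p k s) w, Q s w)) \<longlonglongrightarrow> (s, Y s w, Q s w)"
        by (intro tendsto_intros Yk)
      from continuous_on_tendsto_compose[OF G this]
      show "(\<lambda>k. G s (Y (p k s) w) (Q s w)) \<longlonglongrightarrow> G s (Y s w) (Q s w)" by simp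
    qed
  qed (use Gs s p(1)[OF s] in auto)
next
  fix k
  define p where "p = (\<lambda>(k::nat) (s::real). real_of_int \<lfloor>s * real (Suc k)\<rfloor> / real (Suc k))"
  \<comment> \<open>Measurability is checked for each of the countably many values of the floor. The
    default value 0 takes care of those whose sampling time lies outside \<open>{0..t}\<close>; for
    \<open>s\<close> in \<open>{0..t}\<close> it is never taken.\<close>
  have "(\<lambda>(s, w). G s (if p k s \<in> {0..t} then Y (p k s) w else 0) (Q s w))
      \<in> borel_measurable (time t \<Otimes>\<^sub>M M)"
  proof -
    have [measurable]: "case_prod (\<lambda>s w. if p k s \<in> {0..t} then Y (p k s) w else 0)
        \<in> borel_measurable (time t \<Otimes>\<^sub>M M)"
    proof -
      define f where "f = (\<lambda>i (x::real \<times> 'a). if real_of_int i / real (Suc k) \<in> {0..t}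
        then Y (real_of_int i / real (Suc k)) (snd x) else 0)"
      have "f i \<in> borel_measurable (time t \<Otimes>\<^sub>M M)" for i
        using Y[of "real_of_int i / real (Suc k)"] unfolding f_def
        by (cases "real_of_int i / real (Suc k) \<in> {0..t}") (auto intro: measurable_compose[OF measurable_snd])
      moreover have "(\<lambda>x. \<lfloor>fst x * real (Suc k)\<rfloor>) \<in> time t \<Otimes>\<^sub>M M \<rightarrow>\<^sub>M count_space UNIV"
        by measurable
      ultimately have "(\<lambda>x. f \<lfloor>fst x * real (Suc k)\<rfloor> x) \<in> borel_measurable (time t \<Otimes>\<^sub>M M)"
        by (rule measurable_compose_countable)
      then show ?thesis unfolding f_def p_def split_def .
    qed
    have Gm: "(\<lambda>(s, y, z). G s y z) \<in> borel_measurable (borel \<Otimes>\<^sub>M borel \<Otimes>\<^sub>M borel)"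
      using borel_measurable_continuous_onI[OF G] by (simp add: borel_prod)
    have "(\<lambda>x. (fst x, (case_prod (\<lambda>s w. if p k s \<in> {0..t} then Y (p k s) w else 0)) x, case_prod Q x))
        \<in> time t \<Otimes>\<^sub>M M \<rightarrow>\<^sub>M borel \<Otimes>\<^sub>M borel \<Otimes>\<^sub>M borel"
      by measurable
    from measurable_compose[OF this Gm] show ?thesis
      by (simp add: split_def)
  qed
  from borel_measurable_lebesgue_integral[OF this]
  have "(\<lambda>s. expectation (\<lambda>w. G s (if p k s \<in> {0..t} then Y (p k s) w else 0) (Q s w)))
    \<in> borel_measurable (time t)" .
  moreover have "p k s \<in> {0..t}" if "s \<in> {0..t}" for s
  proof -
    have "p k s \<le> s" unfolding p_def by (simp add: divide_le_eq)
    moreover have "0 \<le> p k s" using that by (simp add: p_def)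
    ultimately show ?thesis using that by auto
  qed
  ultimately have "(\<lambda>s. expectation (\<lambda>w. G s (Y (p k s) w) (Q s w))) \<in> borel_measurable (time t)"
    by (subst measurable_cong[where g="\<lambda>s. expectation (\<lambda>w. G s (if p k s \<in> {0..t} then Y (p k s) w else 0) (Q s w))"]) auto
  then show "(\<lambda>s. expectation (\<lambda>w. G s (Y (real_of_int \<lfloor>s * real (Suc k)\<rfloor> / real (Suc k)) w) (Q s w)))
    \<in> borel_measurable (time t)" unfolding p_def .
qed

text \<open>\<open>Z\<close> is integrable but possibly unbounded, so it is truncated at a level
  \<open>N\<close>. Above \<open>N\<close> boundedness of \<open>\<psi>\<close> makes both
  expectations small; below \<open>N\<close> the Lipschitz condition reduces the claim to
  convergence in mean square. No almost surely convergent subsequence is extracted.\<close>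

lemma expectation_limit_L2:
  fixes \<psi> :: "real \<Rightarrow> real"
  assumes bound: "\<And>x. \<bar>\<psi> x\<bar> \<le> B" and lip: "\<And>x y. \<bar>\<psi> x - \<psi> y\<bar> \<le> B * \<bar>x - y\<bar>"
    and \<psi>[measurable]: "\<psi> \<in> borel_measurable borel"
    and Y[measurable]: "\<And>k. Y k \<in> borel_measurable M" "Y' \<in> borel_measurable M"
    and lim: "(\<lambda>k. \<integral>\<^sup>+w. ennreal ((Y k w - Y' w)\<^sup>2) \<partial>M) \<longlonglongrightarrow> 0"
    and Z: "integrable M Z"
  shows "(\<lambda>k. expectation (\<lambda>w. \<psi> (Y k w) * Z w)) \<longlonglongrightarrow> expectation (\<lambda>w. \<psi> (Y' w) * Z w)"
proof (rule LIMSEQ_I)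
  fix e :: real assume e: "0 < e"
  have [measurable]: "Z \<in> borel_measurable M" using Z by auto
  have B0: "0 \<le> B" using bound[of 0] by linarith
  let ?tail = "\<lambda>N w. \<bar>Z w\<bar> * indicator {w. real N < \<bar>Z w\<bar>} w"
  have "(\<lambda>N. expectation (?tail N)) \<longlonglongrightarrow> expectation (\<lambda>w. 0)"
  proof (rule integral_dominated_convergence)
    show "integrable M (\<lambda>w. \<bar>Z w\<bar>)" using Z by auto
    show "AE w in M. (\<lambda>N. ?tail N w) \<longlonglongrightarrow> 0"
    proof (rule AE_I2)
      fix w
      obtain N0 where "\<bar>Z w\<bar> \<le> real N0" using real_arch_simple by blast
      then have "\<forall>\<^sub>F N in sequentially. ?tail N w = 0"
        by (intro eventually_sequentiallyI[of N0]) (auto simp: indicator_def)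
      then show "(\<lambda>N. ?tail N w) \<longlonglongrightarrow> 0" by (rule tendsto_eventually)
    qed
  qed (auto simp: indicator_def)
  then have "(\<lambda>N. 2 * B * expectation (?tail N)) \<longlonglongrightarrow> 2 * B * 0"
    by (intro tendsto_mult tendsto_const) simp
  then have "\<forall>\<^sub>F N in sequentially. 2 * B * expectation (?tail N) < e / 3"
    by (rule order_tendstoD) (use e in auto)
  then obtain N where N: "2 * B * expectation (?tail N) < e / 3"
    by (auto simp: eventually_sequentially)
  \<comment> \<open>The linear distance is turned into a squared one by
    \<open>\<bar>d\<bar> \<le> \<delta> + d^2 / \<delta>\<close>. The choice of
    \<open>\<delta>\<close> makes the constant part at most \<open>e / 3\<close>, and that of
    \<open>\<eta>\<close> below does the same for the quadratic part. Adding 1 keeps the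
    denominators positive when \<open>B * real N\<close> is zero.\<close>
  define \<delta> where "\<delta> = e / (3 * (B * real N + 1))"
  have BN: "0 \<le> B * real N" using B0 by simp
  then have c: "B * real N + 1 \<noteq> 0" by linarith
  have cancel: "x * (y / (3 * x)) = y / 3" "x / z * (y * z / (3 * x)) = y / 3"
    if "x \<noteq> 0" "z \<noteq> 0" for x y z :: real using that by (simp_all add: field_simps)
  have \<delta>: "0 < \<delta>" unfolding \<delta>_def using e BN by (intro divide_pos_pos) auto
  have \<delta>2: "B * real N * \<delta> \<le> e / 3"
  proof -
    have "B * real N * \<delta> \<le> (B * real N + 1) * \<delta>" using \<delta> by (intro mult_right_mono) auto
    also have "\<dots> = e / 3" unfolding \<delta>_def by (rule cancel(1)[OF c c])
    finally show ?thesis .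
  qed
  define \<eta> where "\<eta> = e * \<delta> / (3 * (B * real N + 1))"
  have \<eta>: "0 < \<eta>" unfolding \<eta>_def using e \<delta> BN by (intro divide_pos_pos mult_pos_pos) auto
  have "\<forall>\<^sub>F k in sequentially. (\<integral>\<^sup>+w. ennreal ((Y k w - Y' w)\<^sup>2) \<partial>M) < ennreal \<eta>"
    using lim by (rule order_tendstoD) (use \<eta> in auto)
  then obtain k0 where k0: "\<And>k. k0 \<le> k \<Longrightarrow> (\<integral>\<^sup>+w. ennreal ((Y k w - Y' w)\<^sup>2) \<partial>M) < ennreal \<eta>"
    by (auto simp: eventually_sequentially)
  show "\<exists>k0. \<forall>k\<ge>k0. norm (expectation (\<lambda>w. \<psi> (Y k w) * Z w) - expectation (\<lambda>w. \<psi> (Y' w) * Z w)) < e"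
  proof (intro exI allI impI)
    fix k assume "k0 \<le> k"
    let ?d = "\<lambda>w. Y k w - Y' w"
    let ?f = "\<lambda>w. \<psi> (Y k w) * Z w - \<psi> (Y' w) * Z w"
      and ?b = "\<lambda>w. 2 * B * ?tail N w + (B * real N * \<delta> + B * real N / \<delta> * (?d w)\<^sup>2)"
    have lt: "(\<integral>\<^sup>+w. ennreal ((?d w)\<^sup>2) \<partial>M) < ennreal \<eta>" using k0[OF \<open>k0 \<le> k\<close>] .
    have i2: "integrable M (\<lambda>w. (?d w)\<^sup>2)"
      by (rule integrableI_nonneg) (use lt in \<open>auto intro: less_trans\<close>)
    have e2: "expectation (\<lambda>w. (?d w)\<^sup>2) < \<eta>"
    proof -
      have "ennreal (expectation (\<lambda>w. (?d w)\<^sup>2)) < ennreal \<eta>"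
        using lt nn_integral_eq_integral[OF i2] by simp
      then show ?thesis by (simp add: ennreal_less_iff)
    qed
    have iZ: "integrable M (\<lambda>w. \<psi> (V w) * Z w)" if [measurable]: "V \<in> borel_measurable M" for V
    proof (rule Bochner_Integration.integrable_bound[of _ "\<lambda>w. B * Z w"])
      show "AE w in M. norm (\<psi> (V w) * Z w) \<le> norm (B * Z w)"
        using bound B0 by (intro AE_I2) (auto simp: abs_mult intro!: mult_right_mono)
    qed (use Z in auto)
    have iT: "integrable M (?tail N)"
      by (rule Bochner_Integration.integrable_bound[OF integrable_abs[OF Z]]) (auto simp: indicator_def)
    have "norm (expectation (\<lambda>w. \<psi> (Y k w) * Z w) - expectation (\<lambda>w. \<psi> (Y' w) * Z w))
        = \<bar>expectation ?f\<bar>"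
      using iZ Y by simp
    also have "\<dots> \<le> expectation (\<lambda>w. \<bar>?f w\<bar>)" by (rule integral_abs_bound)
    also have "\<dots> \<le> expectation ?b"
    proof (rule integral_mono)
      show "integrable M (\<lambda>w. \<bar>?f w\<bar>)" using iZ Y by auto
      show "integrable M ?b"
        using iT i2 by auto
      fix w assume "w \<in> space M"
      have eq: "\<bar>?f w\<bar> = \<bar>\<psi> (Y k w) - \<psi> (Y' w)\<bar> * \<bar>Z w\<bar>"
        by (simp add: abs_mult[symmetric] left_diff_distrib)
      have nn: "0 \<le> B * real N * \<delta> + B * real N / \<delta> * (?d w)\<^sup>2" using BN \<delta> by simp
      show "\<bar>?f w\<bar>
        \<le> ?b w"
      proof (cases "real N < \<bar>Z w\<bar>")
        case True
        have "\<bar>\<psi> (Y k w) - \<psi> (Y' w)\<bar> \<le> 2 * B" using bound[of "Y k w"] bound[of "Y' w"] by linarith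
        then have "\<bar>\<psi> (Y k w) - \<psi> (Y' w)\<bar> * \<bar>Z w\<bar> \<le> 2 * B * \<bar>Z w\<bar>" by (intro mult_right_mono) auto
        then show ?thesis using True nn unfolding eq by simp
      next
        case False
        have "0 \<le> (\<bar>?d w\<bar> - \<delta>)\<^sup>2 / \<delta> + \<bar>?d w\<bar>" using \<delta> by simp
        also have "(\<bar>?d w\<bar> - \<delta>)\<^sup>2 / \<delta> + \<bar>?d w\<bar> = \<delta> + (?d w)\<^sup>2 / \<delta> - \<bar>?d w\<bar>"
          using \<delta> by (simp add: power2_diff field_simps power2_eq_square[of \<delta>])
        finally have d: "\<bar>?d w\<bar> \<le> \<delta> + (?d w)\<^sup>2 / \<delta>" by simp
        have "\<bar>\<psi> (Y k w) - \<psi> (Y' w)\<bar> * \<bar>Z w\<bar> \<le> B * \<bar>?d w\<bar> * real N"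
          using lip[of "Y k w" "Y' w"] False by (intro mult_mono) auto
        also have "\<dots> = B * real N * \<bar>?d w\<bar>" by simp
        also have "\<dots> \<le> B * real N * (\<delta> + (?d w)\<^sup>2 / \<delta>)" using d BN by (rule mult_left_mono)
        finally show ?thesis using False unfolding eq by (simp add: distrib_left)
      qed
    qed
    also have "\<dots> = 2 * B * expectation (?tail N) + (B * real N * \<delta> + B * real N / \<delta> * expectation (\<lambda>w. (?d w)\<^sup>2))"
      using iT i2 by (simp add: prob_space)
    also have "B * real N / \<delta> * expectation (\<lambda>w. (?d w)\<^sup>2) \<le> e / 3"
    proof -
      have "B * real N / \<delta> * expectation (\<lambda>w. (?d w)\<^sup>2) \<le> (B * real N + 1) / \<delta> * \<eta>"
        using e2 BN \<delta> by (intro mult_mono divide_right_mono) auto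
      also have "\<dots> = e / 3" unfolding \<eta>_def using \<delta> by (intro cancel(2)[OF c]) auto
      finally show ?thesis .
    qed
    finally show "norm (expectation (\<lambda>w. \<psi> (Y k w) * Z w) - expectation (\<lambda>w. \<psi> (Y' w) * Z w)) < e"
      using N \<delta>2 by linarith
  qed
qed

end

section \<open>Distance between simple integrals and the limiting process\<close>

lemma measurable_simple_process:
  assumes "\<And>i. i < n \<Longrightarrow> h i \<in> borel_measurable N"
  shows "(\<lambda>(s, w). simple_process n \<tau> h s w) \<in> borel_measurable (time t \<Otimes>\<^sub>M N)"
proof -
  have "(\<lambda>x. h i (snd x) * indicator {\<tau> i<..\<tau> (Suc i)} (fst x)) \<in> borel_measurable (time t \<Otimes>\<^sub>M N)"
    if "i < n" for i
  proof (rule borel_measurable_times)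
    show "(\<lambda>x. h i (snd x)) \<in> borel_measurable (time t \<Otimes>\<^sub>M N)"
      using assms[OF that] by (rule measurable_compose[OF measurable_snd])
    show "(\<lambda>x. indicat_real {\<tau> i<..\<tau> (Suc i)} (fst x)) \<in> borel_measurable (time t \<Otimes>\<^sub>M N)"
      by (rule measurable_compose[OF measurable_fst]) (simp add: measurable_restrict_space1)
  qed
  then show ?thesis unfolding simple_process_def split_def by (intro borel_measurable_sum) auto
qed

lemma square_diff_le: "((x::real) - y)\<^sup>2 \<le> 2 * (x - z)\<^sup>2 + 2 * (y - z)\<^sup>2"
proof -
  have "0 \<le> ((x - z) + (y - z))\<^sup>2" by simp
  then show ?thesis by (simp add: power2_eq_square algebra_simps)
qed

lemma ennreal_square_diff_le:
  "ennreal (((x::real) - y)\<^sup>2) \<le> 2 * ennreal ((x - z)\<^sup>2) + 2 * ennreal ((y - z)\<^sup>2)"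
proof -
  have "ennreal ((x - y)\<^sup>2) \<le> ennreal (2 * (x - z)\<^sup>2 + 2 * (y - z)\<^sup>2)"
    using square_diff_le by (rule ennreal_leI)
  also have "\<dots> = 2 * ennreal ((x - z)\<^sup>2) + 2 * ennreal ((y - z)\<^sup>2)"
    by (simp add: ennreal_plus ennreal_mult)
  finally show ?thesis .
qed

text \<open>The existence of the integral makes \<open>H t\<close> square integrable only for almost
  every \<open>t\<close>. Requiring it at every time makes the expected generator meaningful
  pointwise.\<close>

locale ito_process = driven_bm M W "X 0" for M :: "'a measure" and W X :: "real \<Rightarrow> 'a \<Rightarrow> real" +
  fixes T :: real and H :: "real \<Rightarrow> 'a \<Rightarrow> real"
  assumes X_measurable: "t \<in> {0..T} \<Longrightarrow> X t \<in> borel_measurable M"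
    and X_continuous: "AE w in M. continuous_on {0..T} (\<lambda>t. X t w)"
    and ito: "t \<in> {0..T} \<Longrightarrow> has_ito_integral M F W H t (\<lambda>w. X t w - X 0 w)"
    and H_square: "t \<in> {0..T} \<Longrightarrow> integrable M (\<lambda>w. (H t w)\<^sup>2)"
begin

abbreviation error :: "real \<Rightarrow> nat \<Rightarrow> (nat \<Rightarrow> real) \<Rightarrow> (nat \<Rightarrow> 'a \<Rightarrow> real) \<Rightarrow> ennreal" where
  "error t n \<tau> h \<equiv> \<integral>\<^sup>+w. (\<integral>\<^sup>+s. ennreal ((simple_process n \<tau> h s w - H s w)\<^sup>2) \<partial>time t) \<partial>M"

lemma H_measurable:
  assumes "t \<in> {0..T}" shows "case_prod H \<in> borel_measurable (time t \<Otimes>\<^sub>M M)"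
  using ito[OF assms] unfolding has_ito_integral_def measurable_time_pair by (auto simp: split_def)

lemma simple_heights_measurable:
  assumes "simple_integrand M F t n \<tau> h" "i < n" shows "h i \<in> borel_measurable M"
  using heights(1)[OF assms] by (rule measurable_F)

text \<open>The approximating simple integrands are chosen separately for each final time. By the isometry
  those for \<open>t\<close>, stopped at \<open>r\<close>, are close to those for \<open>r\<close>.\<close>

lemma path_close:
  assumes S: "simple_integrand M F t n \<tau> h" and R: "simple_integrand M F r m \<sigma> g"
    and r: "0 \<le> r" "r \<le> t" "t \<le> T"
  shows "(\<integral>\<^sup>+w. ennreal ((path n \<tau> h r w - X r w)\<^sup>2) \<partial>M)
    \<le> 4 * error t n \<tau> h
      + 4 * error r m \<sigma> g
      + 2 * (\<integral>\<^sup>+w. ennreal ((simple_integral W m \<sigma> g w - (X r w - X 0 w))\<^sup>2) \<partial>M)"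
    (is "_ \<le> 4 * ?D + 4 * ?E + 2 * ?J")
proof -
  have tT: "t \<in> {0..T}" "r \<in> {0..T}" using r by auto
  let ?d = "\<lambda>w s. ennreal ((simple_process n \<tau> h s w - H s w)\<^sup>2)"
    and ?e = "\<lambda>w s. ennreal ((simple_process m \<sigma> g s w - H s w)\<^sup>2)"
    and ?S = "\<lambda>w s. simple_process n \<tau> h s w - simple_process m \<sigma> g s w"
    and ?p = "\<lambda>w. path n \<tau> h r w - X 0 w - simple_integral W m \<sigma> g w"
    and ?i = "\<lambda>w. simple_integral W m \<sigma> g w - (X r w - X 0 w)"
  let ?q = "\<lambda>w s. ennreal ((indicator {0..r} s * ?S w s)\<^sup>2)"
  \<comment> \<open>The difference of the two integrals is written as a single sum over the disjoint
    union of both index sets, with the first partition stopped at \<open>r\<close> and the second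
    set of heights negated. This is the form to which \<open>ito_isometry\<close> applies.\<close>
  define I where "I = Inl ` {..<n} \<union> Inr ` {..<m} "
  define a where "a = (\<lambda>j::nat + nat. case j of Inl i \<Rightarrow> min (\<tau> i) r | Inr i \<Rightarrow> \<sigma> i)"
  define b where "b = (\<lambda>j::nat + nat. case j of Inl i \<Rightarrow> min (\<tau> (Suc i)) r | Inr i \<Rightarrow> \<sigma> (Suc i))"
  define k where "k = (\<lambda>j::nat + nat. case j of Inl i \<Rightarrow> h i | Inr i \<Rightarrow> (\<lambda>w. - g i w))"
  have fin: "finite I" by (simp add: I_def)
  have sum_I: "(\<Sum>j\<in>I. f j) = (\<Sum>i<n. f (Inl i)) + (\<Sum>i<m. f (Inr i))" for f :: "nat + nat \<Rightarrow> real"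
    unfolding I_def by (subst sum.union_disjoint) (auto simp: sum.reindex)
  have st: "step (a j) (b j) (k j)" if "j \<in> I" for j
  proof (cases j)
    case (Inl i)
    then have i: "i < n" using that by (auto simp: I_def)
    have "0 \<le> \<tau> i" "\<tau> i \<le> \<tau> (Suc i)" using times_nonneg[OF S, of i] times_mono[OF S, of i "Suc i"] i by auto
    moreover have "h i \<in> borel_measurable (F (min (\<tau> i) r))" if "min (\<tau> i) r < min (\<tau> (Suc i)) r"
    proof -
      have "min (\<tau> i) r = \<tau> i" using that by (auto simp: min_def split: if_splits)
      then show ?thesis using heights(1)[OF S i] by simp
    qed
    ultimately show ?thesis
      using Inl r heights(2)[OF S i] simple_heights_measurable[OF S i]
      by (auto simp: step_def a_def b_def k_def)
  next
    case (Inr i)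
    then have i: "i < m" using that by (auto simp: I_def)
    have "0 \<le> \<sigma> i" "\<sigma> i \<le> \<sigma> (Suc i)" using times_nonneg[OF R, of i] times_mono[OF R, of i "Suc i"] i by auto
    then show ?thesis
      using Inr heights[OF R i] simple_heights_measurable[OF R i]
      by (auto simp: step_def a_def b_def k_def)
  qed
  have diff: "?p w
      = (\<Sum>j\<in>I. k j w * (W (b j) w - W (a j) w))" for w
    unfolding sum_I by (simp add: path_def simple_integral_def a_def b_def k_def sum_negf)
  have proc: "(\<Sum>j\<in>I. k j w * indicator {a j<..b j} s)
      = indicator {0..r} s * ?S w s" for s w
  proof -
    have 1: "indicator {min (\<tau> i) r<..min (\<tau> (Suc i)) r} s = (indicator {0..r} s * indicator {\<tau> i<..\<tau> (Suc i)} s :: real)"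
      if "i < n" for i
      using times_nonneg[OF S, of i] that by (auto simp: indicator_def min_def split: if_splits)
    have 2: "indicator {\<sigma> i<..\<sigma> (Suc i)} s = (indicator {0..r} s * indicator {\<sigma> i<..\<sigma> (Suc i)} s :: real)"
      if "i < m" for i
      using times_nonneg[OF R, of i] times_le[OF R, of "Suc i"] that by (auto simp: indicator_def)
    have "(\<Sum>i<n. h i w * indicator {min (\<tau> i) r<..min (\<tau> (Suc i)) r} s)
        = indicator {0..r} s * simple_process n \<tau> h s w"
      unfolding simple_process_def sum_distrib_left by (intro sum.cong) (auto simp: 1)
    moreover have "(\<Sum>i<m. g i w * indicator {\<sigma> i<..\<sigma> (Suc i)} s)
        = indicator {0..r} s * simple_process m \<sigma> g s w"
      unfolding simple_process_def sum_distrib_left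
      by (intro sum.cong refl) (subst 2, auto)
    ultimately show ?thesis
      unfolding sum_I by (simp add: a_def b_def k_def sum_negf right_diff_distrib)
  qed
  have Sm: "(\<lambda>(s, w). simple_process n \<tau> h s w) \<in> borel_measurable (time t \<Otimes>\<^sub>M M)"
    "(\<lambda>(s, w). simple_process m \<sigma> g s w) \<in> borel_measurable (time r \<Otimes>\<^sub>M M)"
    using simple_heights_measurable[OF S] simple_heights_measurable[OF R]
    by (auto intro: measurable_simple_process)
  have SH: "(\<lambda>(s, w). ?d w s) \<in> borel_measurable (time t \<Otimes>\<^sub>M M)"
    "(\<lambda>(s, w). ?e w s) \<in> borel_measurable (time r \<Otimes>\<^sub>M M)"
    using Sm H_measurable[OF tT(1)] H_measurable[OF tT(2)] by (auto simp: split_def)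
  have sec: "(\<lambda>s. ?d w s * indicator {0..t} s) \<in> borel_measurable lborel"
    "(\<lambda>s. ?e w s * indicator {0..r} s) \<in> borel_measurable lborel" if "w \<in> space M" for w
    using measurable_compose[OF measurable_Pair2'[OF that] SH(1)] measurable_compose[OF measurable_Pair2'[OF that] SH(2)]
    by (auto simp: borel_measurable_restrict_space_iff_ennreal[symmetric])
  have meas: "(\<lambda>w. \<integral>\<^sup>+s. ?d w s \<partial>time t) \<in> borel_measurable M"
     "(\<lambda>w. \<integral>\<^sup>+s. ?e w s \<partial>time r) \<in> borel_measurable M"
    using measurable_pair_swap[OF SH(1)] measurable_pair_swap[OF SH(2)]
    by (intro sigma_finite_measure.borel_measurable_nn_integral finite_measure.sigma_finite_measure
        finite_measure_time; simp add: split_def)+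
  have "(\<integral>\<^sup>+w. ennreal ((?p w)\<^sup>2) \<partial>M)
     = (\<integral>\<^sup>+w. (\<integral>\<^sup>+s. ?q w s \<partial>lborel) \<partial>M)"
    unfolding diff proc[symmetric] by (rule ito_isometry[OF fin st])
  also have "\<dots> \<le> (\<integral>\<^sup>+w. 2 * (\<integral>\<^sup>+s. ?d w s \<partial>time t) + 2 * (\<integral>\<^sup>+s. ?e w s \<partial>time r) \<partial>M)"
  proof (rule nn_integral_mono)
    fix w assume w: "w \<in> space M"
    have "(\<integral>\<^sup>+s. ?q w s \<partial>lborel)
      \<le> (\<integral>\<^sup>+s. 2 * (?d w s * indicator {0..t} s) + 2 * (?e w s * indicator {0..r} s) \<partial>lborel)"
    proof (rule nn_integral_mono)
      fix s
      show "?q w s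
        \<le> 2 * (?d w s * indicator {0..t} s) + 2 * (?e w s * indicator {0..r} s)"
        using ennreal_square_diff_le r by (auto simp: indicator_def)
    qed
    also have "\<dots> = 2 * (\<integral>\<^sup>+s. ?d w s * indicator {0..t} s \<partial>lborel) + 2 * (\<integral>\<^sup>+s. ?e w s * indicator {0..r} s \<partial>lborel)"
      using sec[OF w] by (subst nn_integral_add) (auto simp: nn_integral_cmult)
    finally show "(\<integral>\<^sup>+s. ?q w s \<partial>lborel)
      \<le> 2 * (\<integral>\<^sup>+s. ?d w s \<partial>time t) + 2 * (\<integral>\<^sup>+s. ?e w s \<partial>time r)"
      by (simp add: nn_integral_time)
  qed
  also have "\<dots> = 2 * ?D + 2 * ?E"
    using meas by (subst nn_integral_add) (auto simp: nn_integral_cmult)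
  finally have isom: "(\<integral>\<^sup>+w. ennreal ((?p w)\<^sup>2) \<partial>M) \<le> 2 * ?D + 2 * ?E" .
  have m1: "path n \<tau> h r \<in> borel_measurable M" using path_measurable_F[OF S r(1)] by (rule measurable_F)
  have m2: "simple_integral W m \<sigma> g \<in> borel_measurable M"
    unfolding simple_integral_def using simple_heights_measurable[OF R] times_nonneg[OF R]
    by (intro borel_measurable_sum borel_measurable_times borel_measurable_diff W_measurable) auto
  note [measurable] = m1 m2 X_measurable[OF tT(2)] init_measurable
  have "(\<integral>\<^sup>+w. ennreal ((path n \<tau> h r w - X r w)\<^sup>2) \<partial>M)
    \<le> (\<integral>\<^sup>+w. 2 * ennreal ((?p w)\<^sup>2)
        + 2 * ennreal ((?i w)\<^sup>2) \<partial>M)"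
  proof (rule nn_integral_mono)
    fix w
    show "ennreal ((path n \<tau> h r w - X r w)\<^sup>2)
      \<le> 2 * ennreal ((?p w)\<^sup>2)
        + 2 * ennreal ((?i w)\<^sup>2)"
      using ennreal_square_diff_le[of "path n \<tau> h r w - X 0 w" "X r w - X 0 w" "simple_integral W m \<sigma> g w"]
      by (simp add: power2_commute[of "X r w - X 0 w"])
  qed
  also have "\<dots> = 2 * (\<integral>\<^sup>+w. ennreal ((?p w)\<^sup>2) \<partial>M) + 2 * ?J"
    by (subst nn_integral_add) (auto simp: nn_integral_cmult)
  \<comment> \<open>The factor 4 comes from splitting a squared difference twice: once between the
    integrands, with \<open>H\<close> in the middle, and once here, with the simple integral
    belonging to \<open>r\<close> in the middle.\<close>
  also have "\<dots> \<le> 2 * (2 * ?D + 2 * ?E) + 2 * ?J"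
    using isom by (intro add_right_mono mult_left_mono) auto
  also have "\<dots> = 4 * ?D + 4 * ?E + 2 * ?J"
    by (simp add: distrib_left mult.assoc[symmetric])
  finally show ?thesis .
qed

end

section \<open>Dynkin's formula for Ito processes\<close>

context ito_process
begin

text \<open>The definition of the integral up to \<open>r\<close> provides a second sequence whose
  integrals are known to converge to \<open>X r - X 0\<close>. It serves only as a bridge in
  \<open>path_close\<close>.\<close>

lemma path_tendsto:
  assumes S: "\<And>k. simple_integrand M F t (n k) (\<tau> k) (h k)"
    and lim: "(\<lambda>k. error t (n k) (\<tau> k) (h k)) \<longlonglongrightarrow> 0"
    and r: "0 \<le> r" "r \<le> t" "t \<le> T"
  shows "(\<lambda>k. \<integral>\<^sup>+w. ennreal ((path (n k) (\<tau> k) (h k) r w - X r w)\<^sup>2) \<partial>M) \<longlonglongrightarrow> 0"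
proof -
  have "has_ito_integral M F W H r (\<lambda>w. X r w - X 0 w)" using r by (intro ito) auto
  then obtain m \<sigma> g where R: "\<And>k. simple_integrand M F r (m k) (\<sigma> k) (g k)"
    and E: "(\<lambda>k. error r (m k) (\<sigma> k) (g k)) \<longlonglongrightarrow> 0"
    and J: "(\<lambda>k. \<integral>\<^sup>+w. ennreal ((simple_integral W (m k) (\<sigma> k) (g k) w - (X r w - X 0 w))\<^sup>2) \<partial>M) \<longlonglongrightarrow> 0"
    unfolding has_ito_integral_def nn_integral_time by blast
  have lim0: "(\<lambda>k. c * f k) \<longlonglongrightarrow> 0" if "f \<longlonglongrightarrow> 0" "c < \<top>" for c :: ennreal and f :: "nat \<Rightarrow> ennreal"
    using ennreal_tendsto_cmult[OF that(2,1)] by simp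
  have "(\<lambda>k. 4 * error t (n k) (\<tau> k) (h k)
      + 4 * error r (m k) (\<sigma> k) (g k)
      + 2 * (\<integral>\<^sup>+w. ennreal ((simple_integral W (m k) (\<sigma> k) (g k) w - (X r w - X 0 w))\<^sup>2) \<partial>M)) \<longlonglongrightarrow> 0 + 0 + 0" (is "?u \<longlonglongrightarrow> _")
    by (intro tendsto_add lim0 lim E J) auto
  then have u: "?u \<longlonglongrightarrow> 0" by simp
  show ?thesis
  proof (rule tendsto_sandwich[OF _ _ tendsto_const u])
    show "\<forall>\<^sub>F k in sequentially. (\<integral>\<^sup>+w. ennreal ((path (n k) (\<tau> k) (h k) r w - X r w)\<^sup>2) \<partial>M) \<le> ?u k"
      by (intro always_eventually allI path_close[OF S R r])
  qed simp
qed

lemma path_continuous: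
  assumes S: "simple_integrand M F t n \<tau> h"
  shows "AE w in M. continuous_on {0..t} (\<lambda>r. path n \<tau> h r w)"
proof -
  have "AE w in M. continuous_on {0..} (\<lambda>t. W t w)" using bm by (auto simp: brownian_motion_def)
  then show ?thesis
  proof eventually_elim
    fix w assume c: "continuous_on {0..} (\<lambda>t. W t w)"
    have "continuous_on {0..t} (\<lambda>r. W (min (\<tau> i) r) w)" if "i \<le> n" for i
      by (rule continuous_on_compose2[OF c]) (use times_nonneg[OF S that] in \<open>auto intro!: continuous_intros\<close>)
    then show "continuous_on {0..t} (\<lambda>r. path n \<tau> h r w)"
      unfolding path_def by (intro continuous_intros) auto
  qed
qed

lemma simple_process_bounded:
  assumes S: "simple_integrand M F t n \<tau> h"
  shows "\<exists>K. \<forall>s. \<forall>w\<in>space M. \<bar>simple_process n \<tau> h s w\<bar> \<le> K"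
proof -
  have "\<forall>i\<in>{..<n}. \<exists>K. \<forall>w\<in>space M. \<bar>h i w\<bar> \<le> K" using heights(2)[OF S] by auto
  then obtain K where K: "\<And>i w. i < n \<Longrightarrow> w \<in> space M \<Longrightarrow> \<bar>h i w\<bar> \<le> K i"
    by (metis lessThan_iff bchoice)
  have "\<bar>simple_process n \<tau> h s w\<bar> \<le> (\<Sum>i<n. K i)" if w: "w \<in> space M" for s w
    unfolding simple_process_def
  proof (rule order_trans[OF sum_abs sum_mono])
    fix i assume "i \<in> {..<n}"
    then have "\<bar>h i w\<bar> \<le> K i" using K w by auto
    then show "\<bar>h i w * indicator {\<tau> i<..\<tau> (Suc i)} s\<bar> \<le> K i"
      by (auto simp: indicator_def)
  qed
  then show ?thesis by blast
qed

end

text \<open>The cross term \<open>2 (x - y) y\<close> is split with weight \<open>\<eta>\<close>. In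
  this form \<open>L^2\<close> convergence of integrands controls their squares in mean:
  \<open>\<eta>\<close> is fixed first, against the second moment of \<open>y\<close>, and the
  factor \<open>1 + 1 / \<eta>\<close> is then absorbed by the limit.\<close>

lemma square_diff_AMGM:
  fixes x y \<eta> :: real
  assumes "0 < \<eta>"
  shows "\<bar>x\<^sup>2 - y\<^sup>2\<bar> \<le> (1 + 1 / \<eta>) * (x - y)\<^sup>2 + \<eta> * y\<^sup>2"
proof -
  let ?d = "x - y"
  have "0 \<le> (\<bar>?d\<bar> - \<eta> * \<bar>y\<bar>)\<^sup>2 / \<eta>" using assms by simp
  also have "\<dots> = ?d\<^sup>2 / \<eta> - 2 * (\<bar>?d\<bar> * \<bar>y\<bar>) + \<eta> * y\<^sup>2"
    using assms by (simp add: power2_diff power_mult_distrib add_divide_distrib diff_divide_distrib) (simp add: power2_eq_square)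
  finally have "2 * (\<bar>?d\<bar> * \<bar>y\<bar>) \<le> ?d\<^sup>2 / \<eta> + \<eta> * y\<^sup>2" by simp
  moreover have "x\<^sup>2 - y\<^sup>2 = ?d\<^sup>2 + 2 * (?d * y)" by (simp add: power2_eq_square algebra_simps)
  then have "\<bar>x\<^sup>2 - y\<^sup>2\<bar> \<le> \<bar>?d\<^sup>2\<bar> + \<bar>2 * (?d * y)\<bar>" 
    by (metis abs_triangle_ineq)
  then have "\<bar>x\<^sup>2 - y\<^sup>2\<bar> \<le> ?d\<^sup>2 + 2 * (\<bar>?d\<bar> * \<bar>y\<bar>)" by (simp add: abs_mult)
  ultimately show ?thesis by (simp add: distrib_right)
qed

section \<open>Passage to the limit in Dynkin's formula\<close>

locale ito_test = ito_process M W X T H + bm_test M W "X 0" B \<phi> \<phi>t \<phi>x \<phi>xx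
  for M :: "'a measure" and W X T H B \<phi> \<phi>t \<phi>x \<phi>xx
begin

text \<open>The argument \<open>z\<close> stands for the squared integrand. Being affine in
  \<open>z\<close>, the expression grows linearly there, so second moments of the integrand suffice
  for integrability.\<close>

definition generator :: "real \<Rightarrow> real \<Rightarrow> real \<Rightarrow> real" where
  "generator s y z = \<phi>t s y + \<phi>xx s y * z / 2"

abbreviation rate :: "real \<Rightarrow> real" where
  "rate r \<equiv> expectation (\<lambda>w. generator r (X r w) ((H r w)\<^sup>2))"

abbreviation abs_rate :: "real \<Rightarrow> real" where
  "abs_rate r \<equiv> expectation (\<lambda>w. \<bar>generator r (X r w) ((H r w)\<^sup>2)\<bar>)"

lemma generator_continuous: "continuous_on UNIV (\<lambda>(s, y, z). generator s y z)"
proof -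
  have "continuous_on UNIV (\<lambda>x::real \<times> real \<times> real. \<phi>t (fst (fst x, fst (snd x))) (snd (fst x, fst (snd x))))"
    by (rule continuous_on_compose2[OF continuous_t]) (auto intro!: continuous_intros)
  moreover have "continuous_on UNIV (\<lambda>x::real \<times> real \<times> real. \<phi>xx (fst (fst x, fst (snd x))) (snd (fst x, fst (snd x))))"
    by (rule continuous_on_compose2[OF continuous_xx]) (auto intro!: continuous_intros)
  ultimately show ?thesis
    unfolding generator_def split_def by (auto intro!: continuous_intros)
qed

lemma generator_bound: "\<bar>generator s y z\<bar> \<le> B * (1 + \<bar>z\<bar>)"
proof -
  have "\<bar>\<phi>xx s y * z / 2\<bar> = \<bar>\<phi>xx s y\<bar> * \<bar>z\<bar> / 2" by (simp add: abs_mult)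
  also have "\<dots> \<le> B * \<bar>z\<bar> / 2" using bounded(4) by (intro divide_right_mono mult_right_mono) auto
  also have "\<dots> \<le> B * \<bar>z\<bar>" using B_nonneg by simp
  finally have "\<bar>\<phi>xx s y * z / 2\<bar> \<le> B * \<bar>z\<bar>" .
  then show ?thesis using bounded(2)[of s y] unfolding generator_def distrib_left by linarith
qed

lemma generator_integrable:
  assumes [measurable]: "Y \<in> borel_measurable M" and Q: "integrable M Q"
  shows "integrable M (\<lambda>w. generator s (Y w) (Q w))"
proof (rule Bochner_Integration.integrable_bound[of _ "\<lambda>w. B * (1 + \<bar>Q w\<bar>)"])
  have [measurable]: "Q \<in> borel_measurable M" using Q by auto
  show "(\<lambda>w. generator s (Y w) (Q w)) \<in> borel_measurable M" unfolding generator_def by measurable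
  show "AE w in M. norm (generator s (Y w) (Q w)) \<le> norm (B * (1 + \<bar>Q w\<bar>))"
    using generator_bound B_nonneg by (auto simp: abs_mult)
qed (use Q in auto)

lemma generator_expectation_bound:
  assumes "Y \<in> borel_measurable M" and Q: "integrable M Q" "\<And>w. 0 \<le> Q w"
  shows "\<bar>expectation (\<lambda>w. generator s (Y w) (Q w))\<bar> \<le> B * (1 + expectation Q)"
proof -
  have "\<bar>expectation (\<lambda>w. generator s (Y w) (Q w))\<bar> \<le> expectation (\<lambda>w. \<bar>generator s (Y w) (Q w)\<bar>)"
    by (rule integral_abs_bound)
  also have "\<dots> \<le> expectation (\<lambda>w. B * (1 + Q w))"
    using generator_integrable[OF assms(1,2)] Q generator_bound[of s _ "Q _"]
    by (intro integral_mono) auto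
  also have "\<dots> = B * (1 + expectation Q)" using Q by (simp add: prob_space)
  finally show ?thesis .
qed

lemma generator_measurable:
  assumes "t \<in> {0..T}"
  shows "rate \<in> borel_measurable (time t)"
    and "abs_rate \<in> borel_measurable (time t)"
proof -
  have Q: "case_prod (\<lambda>s w. (H s w)\<^sup>2) \<in> borel_measurable (time t \<Otimes>\<^sub>M M)"
    using H_measurable[OF assms] by (auto simp: split_def)
  have Qi: "integrable M (\<lambda>w. (H s w)\<^sup>2)" if "s \<in> {0..t}" for s using that assms by (intro H_square) auto
  have Xm: "X s \<in> borel_measurable M" if "s \<in> {0..t}" for s using that assms by (intro X_measurable) auto
  have Xc: "AE w in M. continuous_on {0..t} (\<lambda>s. X s w)"
    using X_continuous by eventually_elim (use assms in \<open>auto elim: continuous_on_subset\<close>)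
  show "rate \<in> borel_measurable (time t)"
    by (rule measurable_expectation_process[OF Q Qi Xm Xc generator_continuous generator_bound])
  show "abs_rate \<in> borel_measurable (time t)"
    by (rule measurable_expectation_process[OF Q Qi Xm Xc, of "\<lambda>s y z. \<bar>generator s y z\<bar>" B])
       (use generator_bound continuous_on_rabs[OF generator_continuous] in \<open>auto simp: split_def\<close>)
qed

lemma H_square_integrable_time:
  assumes t: "t \<in> {0..T}"
  shows "integrable (time t) (\<lambda>r. expectation (\<lambda>w. (H r w)\<^sup>2))"
proof (rule integrableI_nonneg)
  have Hm: "case_prod H \<in> borel_measurable (time t \<Otimes>\<^sub>M M)" by (rule H_measurable[OF t])
  then show "(\<lambda>r. expectation (\<lambda>w. (H r w)\<^sup>2)) \<in> borel_measurable (time t)"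
    by (intro borel_measurable_lebesgue_integral) (auto simp: split_def)
  have "(\<integral>\<^sup>+r. ennreal (expectation (\<lambda>w. (H r w)\<^sup>2)) \<partial>time t)
      = (\<integral>\<^sup>+r. (\<integral>\<^sup>+w. ennreal ((H r w)\<^sup>2) \<partial>M) \<partial>time t)"
    using t H_square by (intro nn_integral_cong) (auto simp: nn_integral_eq_integral)
  also have "\<dots> = (\<integral>\<^sup>+w. (\<integral>\<^sup>+r. ennreal ((H r w)\<^sup>2) \<partial>time t) \<partial>M)"
    using Hm by (intro nn_integral_time_swap[symmetric]) (auto simp: split_def)
  also have "\<dots> < \<infinity>" using ito[OF t] unfolding has_ito_integral_def nn_integral_time by auto
  finally show "(\<integral>\<^sup>+r. ennreal (expectation (\<lambda>w. (H r w)\<^sup>2)) \<partial>time t) < \<infinity>" .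
qed auto

lemma generator_integrable_time:
  assumes t: "t \<in> {0..T}"
  shows "integrable (time t) rate"
    and "integrable (time t) abs_rate"
proof -
  have i: "integrable (time t) (\<lambda>r. B * (1 + expectation (\<lambda>w. (H r w)\<^sup>2)))"
    by (intro integrable_mult_right Bochner_Integration.integrable_add H_square_integrable_time[OF t]
        finite_measure.integrable_const[OF finite_measure_time])
  have Xm: "X s \<in> borel_measurable M" "integrable M (\<lambda>w. (H s w)\<^sup>2)" if "s \<in> {0..t}" for s
    using that t X_measurable H_square by auto
  show "integrable (time t) rate"
    by (rule Bochner_Integration.integrable_bound[OF i generator_measurable(1)[OF t]])
       (use generator_expectation_bound[OF Xm] B_nonneg in \<open>auto simp: abs_mult\<close>)
  have "abs_rate r \<le> B * (1 + expectation (\<lambda>w. (H r w)\<^sup>2))"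
    if "r \<in> {0..t}" for r
  proof -
    have "abs_rate r \<le> expectation (\<lambda>w. B * (1 + (H r w)\<^sup>2))"
      using generator_integrable[OF Xm[OF that]] Xm(2)[OF that] generator_bound[of r _ "(H r _)\<^sup>2"]
      by (intro integral_mono) auto
    also have "\<dots> = B * (1 + expectation (\<lambda>w. (H r w)\<^sup>2))" using Xm(2)[OF that] by (simp add: prob_space)
    finally show ?thesis .
  qed
  then show "integrable (time t) abs_rate"
    using B_nonneg
    by (intro Bochner_Integration.integrable_bound[OF i generator_measurable(2)[OF t]])
       (auto simp: abs_mult)
qed

text \<open>Three rates are compared: \<open>c k\<close> has the simple path and the simple
  integrand, \<open>b k\<close> the simple path and the true integrand, and \<open>a\<close> is the
  true rate. The step from \<open>c k\<close> to \<open>b k\<close> depends only on the distance of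
  the integrands; the step from \<open>b k\<close> to \<open>a\<close> is pointwise in time, with a
  dominating function independent of \<open>k\<close>.\<close>

lemma dynkin:
  assumes t: "t \<in> {0..T}"
  shows "(\<integral>r. rate r \<partial>time t)
    = expectation (\<lambda>w. \<phi> t (X t w)) - expectation (\<lambda>w. \<phi> 0 (X 0 w))"
proof -
  obtain n \<tau> h where S: "\<And>k. simple_integrand M F t (n k) (\<tau> k) (h k)"
    and D: "(\<lambda>k. error t (n k) (\<tau> k) (h k)) \<longlonglongrightarrow> 0"
    using ito[OF t] unfolding has_ito_integral_def nn_integral_time by blast
  define P where "P = (\<lambda>k. simple_process (n k) (\<tau> k) (h k))"
  define Y where "Y = (\<lambda>k. path (n k) (\<tau> k) (h k))"
  obtain K where K: "\<And>k s w. w \<in> space M \<Longrightarrow> \<bar>P k s w\<bar> \<le> K k"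
    using simple_process_bounded[OF S] unfolding P_def by metis
  have P2: "(P k s w)\<^sup>2 \<le> (K k)\<^sup>2" if "w \<in> space M" for k s w
    using K[OF that, of k s] by (simp add: abs_le_square_iff[symmetric])
  have Pm: "case_prod (P k) \<in> borel_measurable (time t \<Otimes>\<^sub>M M)" for k
    unfolding P_def using simple_heights_measurable[OF S] by (intro measurable_simple_process) auto
  have Hm: "case_prod H \<in> borel_measurable (time t \<Otimes>\<^sub>M M)" by (rule H_measurable[OF t])
  have Pms: "P k s \<in> borel_measurable M" for k s
    unfolding P_def simple_process_def using simple_heights_measurable[OF S] by auto
  have iP: "integrable M (\<lambda>w. (P k s w)\<^sup>2)" for k s
    by (rule integrable_bounded[of _ "(K k)\<^sup>2"]) (use Pms P2 in auto)
  have iH: "integrable M (\<lambda>w. (H s w)\<^sup>2)" if "s \<in> {0..t}" for s using that t by (intro H_square) auto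
  have Xm: "X s \<in> borel_measurable M" if "s \<in> {0..t}" for s using that t by (intro X_measurable) auto
  have Ym: "Y k s \<in> borel_measurable M" if "s \<in> {0..t}" for k s
    unfolding Y_def using path_measurable_F[OF S, of s] that by (auto intro: measurable_F)
  have Hms: "H s \<in> borel_measurable M" if "s \<in> {0..t}" for s
    using measurable_compose[OF measurable_Pair1'[of s "time t" M] Hm] that by simp
  have Yc: "AE w in M. continuous_on {0..t} (\<lambda>s. Y k s w)" for k
    unfolding Y_def by (rule path_continuous[OF S])
  have Ylim: "(\<lambda>k. \<integral>\<^sup>+w. ennreal ((Y k r w - X r w)\<^sup>2) \<partial>M) \<longlonglongrightarrow> 0" if "r \<in> {0..t}" for r
    unfolding Y_def by (rule path_tendsto[OF S D]) (use that t in auto)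
  define a where "a = rate"
  define b where "b = (\<lambda>k r. expectation (\<lambda>w. generator r (Y k r w) ((H r w)\<^sup>2)))"
  define c where "c = (\<lambda>k r. expectation (\<lambda>w. generator r (Y k r w) ((P k r w)\<^sup>2)))"
  define m where "m = (\<lambda>r. expectation (\<lambda>w. (H r w)\<^sup>2))"
  define d where "d = (\<lambda>k r. expectation (\<lambda>w. (P k r w - H r w)\<^sup>2))"
  have am: "a \<in> borel_measurable (time t)" unfolding a_def by (rule generator_measurable(1)[OF t])
  have bm': "b k \<in> borel_measurable (time t)" for k
    unfolding b_def
    by (rule measurable_expectation_process[OF _ iH Ym Yc generator_continuous generator_bound])
       (use Hm in \<open>auto simp: split_def\<close>)
  have cm: "c k \<in> borel_measurable (time t)" for k
    unfolding c_def
    by (rule measurable_expectation_process[OF _ iP Ym Yc generator_continuous generator_bound])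
       (use Pm[of k] in \<open>auto simp: split_def\<close>)
  have mi: "integrable (time t) m" unfolding m_def by (rule H_square_integrable_time[OF t])
  have const: "integrable (time t) (\<lambda>_. C)" for C :: real
    by (rule finite_measure.integrable_const[OF finite_measure_time])
  have bi: "integrable (time t) (b k)" for k
    by (rule Bochner_Integration.integrable_bound[of _ "\<lambda>r. B * (1 + m r)"])
       (use mi const bm' generator_expectation_bound[OF Ym[of _ k] iH] B_nonneg in \<open>auto simp: b_def m_def abs_mult\<close>)
  have ci: "integrable (time t) (c k)" for k
  proof (rule Bochner_Integration.integrable_bound[OF const cm])
    show "AE r in time t. norm (c k r) \<le> norm (B * (1 + (K k)\<^sup>2))"
    proof (rule AE_I2)
      fix r assume "r \<in> space (time t)"
      then have "\<bar>c k r\<bar> \<le> B * (1 + expectation (\<lambda>w. (P k r w)\<^sup>2))"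
        unfolding c_def by (intro generator_expectation_bound Ym iP) auto
      also have "\<dots> \<le> B * (1 + expectation (\<lambda>w. (K k)\<^sup>2))"
        using B_nonneg iP P2 by (intro mult_left_mono add_left_mono integral_mono) auto
      finally show "norm (c k r) \<le> norm (B * (1 + (K k)\<^sup>2))" using B_nonneg by (simp add: prob_space abs_mult)
    qed
  qed
  have id: "integrable M (\<lambda>w. (P k r w - H r w)\<^sup>2)" if r: "r \<in> {0..t}" for k r
    by (rule Bochner_Integration.integrable_bound[of _ "\<lambda>w. 2 * (P k r w)\<^sup>2 + 2 * (H r w)\<^sup>2"])
       (use iP iH[OF r] Pms Hms[OF r] square_diff_le[of _ _ 0] in auto)
  have dm: "d k \<in> borel_measurable (time t)" for k
    unfolding d_def using Pm[of k] Hm by (intro borel_measurable_lebesgue_integral) (auto simp: split_def)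
  have dD: "(\<integral>\<^sup>+r. ennreal (d k r) \<partial>time t)
      = (\<integral>\<^sup>+w. (\<integral>\<^sup>+s. ennreal ((P k s w - H s w)\<^sup>2) \<partial>time t) \<partial>M)" for k
  proof -
    have "(\<integral>\<^sup>+r. ennreal (d k r) \<partial>time t) = (\<integral>\<^sup>+r. (\<integral>\<^sup>+w. ennreal ((P k r w - H r w)\<^sup>2) \<partial>M) \<partial>time t)"
      unfolding d_def using id by (intro nn_integral_cong) (auto simp: nn_integral_eq_integral)
    also have "\<dots> = (\<integral>\<^sup>+w. (\<integral>\<^sup>+s. ennreal ((P k s w - H s w)\<^sup>2) \<partial>time t) \<partial>M)"
      using Hm Pm[of k] by (intro nn_integral_time_swap[symmetric]) (auto simp: split_def)
    finally show ?thesis .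
  qed
  have di: "integrable (time t) (d k)" for k
  proof (rule Bochner_Integration.integrable_bound[of _ "\<lambda>r. 2 * (K k)\<^sup>2 + 2 * m r"])
    show "AE r in time t. norm (d k r) \<le> norm (2 * (K k)\<^sup>2 + 2 * m r)"
    proof (rule AE_I2)
      fix r assume "r \<in> space (time t)"
      then have r: "r \<in> {0..t}" by simp
      have "d k r \<le> expectation (\<lambda>w. 2 * (K k)\<^sup>2 + 2 * (H r w)\<^sup>2)"
        unfolding d_def
      proof (rule integral_mono)
        fix w assume "w \<in> space M"
        then show "(P k r w - H r w)\<^sup>2 \<le> 2 * (K k)\<^sup>2 + 2 * (H r w)\<^sup>2"
          using square_diff_le[of "P k r w" "H r w" 0] P2[of w k r] by simp
      qed (use id[OF r] iH[OF r] in auto)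
      also have "\<dots> = 2 * (K k)\<^sup>2 + 2 * m r" unfolding m_def using iH[OF r] by (simp add: prob_space)
      finally show "norm (d k r) \<le> norm (2 * (K k)\<^sup>2 + 2 * m r)"
        by (simp add: d_def)
    qed
  qed (use mi const dm in auto)
  have dlim: "(\<lambda>k. \<integral>r. d k r \<partial>time t) \<longlonglongrightarrow> 0"
  proof -
    have "(\<lambda>k. ennreal (\<integral>r. d k r \<partial>time t)) \<longlonglongrightarrow> ennreal 0"
      using D dD nn_integral_eq_integral[OF di] by (simp add: d_def P_def)
    then show ?thesis by (rule tendsto_ennrealD) (auto simp: d_def)
  qed
  have blim: "(\<lambda>k. \<integral>r. b k r \<partial>time t) \<longlonglongrightarrow> (\<integral>r. a r \<partial>time t)"
  proof (rule integral_dominated_convergence[where w="\<lambda>r. B * (1 + m r)"])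
    show "AE r in time t. (\<lambda>k. b k r) \<longlonglongrightarrow> a r"
    proof (rule AE_I2)
      fix r assume "r \<in> space (time t)"
      then have r: "r \<in> {0..t}" by simp
      \<comment> \<open>Both terms are brought into the form of a bounded Lipschitz function of the
        path times an integrable factor, which is 1 or half the squared integrand.\<close>
      have split: "expectation (\<lambda>w. generator r (V w) ((H r w)\<^sup>2))
          = expectation (\<lambda>w. \<phi>t r (V w) * 1) + expectation (\<lambda>w. \<phi>xx r (V w) * ((H r w)\<^sup>2 / 2))"
        if [measurable]: "V \<in> borel_measurable M" for V
      proof -
        have "integrable M (\<lambda>w. \<phi>t r (V w))"
          by (rule integrable_bounded[of _ B]) (use bounded in auto)
        moreover have "integrable M (\<lambda>w. \<phi>xx r (V w) * ((H r w)\<^sup>2 / 2))"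
          by (rule integrable_bounded_mult[of _ B]) (use bounded iH[OF r] in auto)
        ultimately show ?thesis by (simp add: generator_def)
      qed
      show "(\<lambda>k. b k r) \<longlonglongrightarrow> a r"
        unfolding a_def b_def split[OF Ym[OF r]] split[OF Xm[OF r]]
      proof (intro tendsto_add)
        show "(\<lambda>k. expectation (\<lambda>w. \<phi>t r (Y k r w) * 1)) \<longlonglongrightarrow> expectation (\<lambda>w. \<phi>t r (X r w) * 1)"
          by (rule expectation_limit_L2[OF bounded(2) _ _ Ym[OF r] Xm[OF r] Ylim[OF r]])
             (use lipschitz_t[of r _ r] in auto)
        show "(\<lambda>k. expectation (\<lambda>w. \<phi>xx r (Y k r w) * ((H r w)\<^sup>2 / 2)))
          \<longlonglongrightarrow> expectation (\<lambda>w. \<phi>xx r (X r w) * ((H r w)\<^sup>2 / 2))"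
          by (rule expectation_limit_L2[OF bounded(4) _ _ Ym[OF r] Xm[OF r] Ylim[OF r]])
             (use lipschitz_xx[of r _ r] iH[OF r] in auto)
      qed
    qed
    show "AE r in time t. norm (b k r) \<le> B * (1 + m r)" for k
      unfolding b_def m_def real_norm_def
      by (intro AE_I2 generator_expectation_bound Ym iH) auto
  qed (use am bm' mi const in auto)
  have bc: "\<bar>c k r - b k r\<bar> \<le> B / 2 * ((1 + 1 / \<eta>) * d k r + \<eta> * m r)"
    if r: "r \<in> {0..t}" and \<eta>: "0 < \<eta>" for k r \<eta>
  proof -
    let ?f = "\<lambda>w. generator r (Y k r w) ((P k r w)\<^sup>2) - generator r (Y k r w) ((H r w)\<^sup>2)"
      and ?b = "\<lambda>w. B / 2 * ((1 + 1 / \<eta>) * (P k r w - H r w)\<^sup>2 + \<eta> * (H r w)\<^sup>2)"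
    have i: "integrable M (\<lambda>w. generator r (Y k r w) ((P k r w)\<^sup>2))"
      "integrable M (\<lambda>w. generator r (Y k r w) ((H r w)\<^sup>2))"
      using generator_integrable[OF Ym[OF r] iP] generator_integrable[OF Ym[OF r] iH[OF r]] by auto
    have "\<bar>c k r - b k r\<bar> = \<bar>expectation (\<lambda>w. ?f w)\<bar>"
      unfolding b_def c_def using i by simp
    also have "\<dots> \<le> expectation (\<lambda>w. \<bar>?f w\<bar>)"
      by (rule integral_abs_bound)
    also have "\<dots> \<le> expectation (\<lambda>w. ?b w)"
    proof (rule integral_mono)
      fix w assume "w \<in> space M"
      have "\<bar>?f w\<bar>
          = \<bar>\<phi>xx r (Y k r w) / 2 * ((P k r w)\<^sup>2 - (H r w)\<^sup>2)\<bar>"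
        by (simp add: generator_def right_diff_distrib)
      also have "\<dots> = \<bar>\<phi>xx r (Y k r w)\<bar> / 2 * \<bar>(P k r w)\<^sup>2 - (H r w)\<^sup>2\<bar>" by (simp add: abs_mult)
      also have "\<dots> \<le> ?b w"
        using bounded(4) B_nonneg square_diff_AMGM[OF \<eta>] by (intro mult_mono divide_right_mono) auto
      finally show "\<bar>?f w\<bar>
        \<le> ?b w" .
    qed (use i id[OF r] iH[OF r] in auto)
    also have "\<dots> = B / 2 * ((1 + 1 / \<eta>) * d k r + \<eta> * m r)"
      unfolding d_def m_def using id[OF r] iH[OF r] by simp
    finally show ?thesis .
  qed
  have clim: "(\<lambda>k. (\<integral>r. c k r \<partial>time t) - (\<integral>r. b k r \<partial>time t)) \<longlonglongrightarrow> 0"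
  proof (rule LIMSEQ_I)
    fix e :: real assume e: "0 < e"
    define I where "I = (\<integral>r. m r \<partial>time t)"
    have I0: "0 \<le> I" unfolding I_def m_def by (intro Bochner_Integration.integral_nonneg) auto
    have pos: "0 < B * I + 1" using mult_nonneg_nonneg[OF B_nonneg I0] by linarith
    \<comment> \<open>The part of the error that does not tend to zero with \<open>k\<close> is
      \<open>B / 2 * (\<eta> * I)\<close>; this choice keeps it at most \<open>e / 2\<close> before
      \<open>k\<close> is sent to infinity.\<close>
    define \<eta> where "\<eta> = e / (B * I + 1)"
    have \<eta>: "0 < \<eta>" unfolding \<eta>_def using e pos by simp
    have "\<eta> * (B * I) \<le> \<eta> * (B * I + 1)" using \<eta> by (intro mult_left_mono) auto
    also have "\<dots> = e" unfolding \<eta>_def using pos by simp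
    finally have \<eta>I: "B / 2 * (\<eta> * I) \<le> e / 2" by (simp add: mult.left_commute)
    have "(\<lambda>k. B / 2 * (1 + 1 / \<eta>) * (\<integral>r. d k r \<partial>time t)) \<longlonglongrightarrow> B / 2 * (1 + 1 / \<eta>) * 0"
      by (intro tendsto_mult tendsto_const dlim)
    then have "\<forall>\<^sub>F k in sequentially. B / 2 * (1 + 1 / \<eta>) * (\<integral>r. d k r \<partial>time t) < e / 2"
      by (rule order_tendstoD) (use e in auto)
    then obtain k0 where k0: "\<And>k. k0 \<le> k \<Longrightarrow> B / 2 * (1 + 1 / \<eta>) * (\<integral>r. d k r \<partial>time t) < e / 2"
      by (auto simp: eventually_sequentially)
    show "\<exists>k0. \<forall>k\<ge>k0. norm ((\<integral>r. c k r \<partial>time t) - (\<integral>r. b k r \<partial>time t) - 0) < e"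
    proof (intro exI allI impI)
      fix k assume "k0 \<le> k"
      have "norm ((\<integral>r. c k r \<partial>time t) - (\<integral>r. b k r \<partial>time t) - 0) = \<bar>\<integral>r. c k r - b k r \<partial>time t\<bar>"
        using ci bi by simp
      also have "\<dots> \<le> (\<integral>r. \<bar>c k r - b k r\<bar> \<partial>time t)" by (rule integral_abs_bound)
      also have "\<dots> \<le> (\<integral>r. B / 2 * ((1 + 1 / \<eta>) * d k r + \<eta> * m r) \<partial>time t)"
        using bc[OF _ \<eta>] ci[of k] bi[of k] di[of k] mi by (intro integral_mono) auto
      also have "\<dots> = B / 2 * (1 + 1 / \<eta>) * (\<integral>r. d k r \<partial>time t) + B / 2 * (\<eta> * I)"
        unfolding I_def using di[of k] mi by (simp add: distrib_left)
      also have "\<dots> < e" using k0[OF \<open>k0 \<le> k\<close>] \<eta>I by linarith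
      finally show "norm ((\<integral>r. c k r \<partial>time t) - (\<integral>r. b k r \<partial>time t) - 0) < e" .
    qed
  qed
  have "(\<lambda>k. \<integral>r. c k r \<partial>time t) \<longlonglongrightarrow> (\<integral>r. a r \<partial>time t)"
    using tendsto_add[OF clim blim] by simp
  \<comment> \<open>\<open>dynkin_simple\<close> rests on the fundamental theorem of calculus and
    speaks of the gauge integral; integrability of \<open>c k\<close> identifies it with the
    Lebesgue integral.\<close>
  moreover have "(\<integral>r. c k r \<partial>time t) = expectation (\<lambda>w. \<phi> t (Y k t w)) - expectation (\<lambda>w. \<phi> 0 (X 0 w))" for k
  proof -
    have "set_integrable lborel {0..t} (c k)"
      using ci[of k] by (simp add: integrable_restrict_space set_integrable_def)
    from set_borel_integral_eq_integral(2)[OF this]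
    have "(\<integral>r. c k r \<partial>time t) = integral {0..t} (c k)"
      by (simp add: integral_restrict_space set_lebesgue_integral_def)
    also have "(c k has_integral (expectation (\<lambda>w. \<phi> t (Y k t w)) - expectation (\<lambda>w. \<phi> 0 (X 0 w)))) {0..t}"
      using dynkin_simple[OF S[of k]] t unfolding c_def Y_def P_def generator_def by auto
    then have "integral {0..t} (c k) = expectation (\<lambda>w. \<phi> t (Y k t w)) - expectation (\<lambda>w. \<phi> 0 (X 0 w))"
      by (rule integral_unique)
    finally show ?thesis .
  qed
  moreover have "(\<lambda>k. expectation (\<lambda>w. \<phi> t (Y k t w) * 1)) \<longlonglongrightarrow> expectation (\<lambda>w. \<phi> t (X t w) * 1)"
    using t by (intro expectation_limit_L2[OF bounded(1) lipschitz_x _ Ym Xm Ylim]) auto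
  then have "(\<lambda>k. expectation (\<lambda>w. \<phi> t (Y k t w)) - expectation (\<lambda>w. \<phi> 0 (X 0 w)))
      \<longlonglongrightarrow> expectation (\<lambda>w. \<phi> t (X t w)) - expectation (\<lambda>w. \<phi> 0 (X 0 w))"
    by (intro tendsto_diff tendsto_const) simp
  ultimately show ?thesis unfolding a_def using LIMSEQ_unique by auto
qed

end

section \<open>The weak equation\<close>

locale mckean_vlasov =
  fixes T :: real
    and M :: "'a measure"
    and W X :: "real \<Rightarrow> 'a \<Rightarrow> real"
    and \<nu> :: "real \<Rightarrow> real \<Rightarrow> real measure \<Rightarrow> real"
    and \<mu>0 :: "real measure"
    and \<mu> :: "real \<Rightarrow> real measure"
    and u :: "real \<Rightarrow> real \<Rightarrow> real"
    and u\<^sub>0 :: "real \<Rightarrow> real"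
  assumes T: "T > 0"
    and bm: "brownian_motion M W"
    and regular: "lipschitz_regular T \<nu>"
    and flow: "W2_continuous_flow T \<mu>"
    and solution: "mckean_vlasov_strong_solution M W T \<nu> \<mu>0 \<mu> X"
    and density: "\<forall>t\<in>{0..T}. is_density (u t) (\<mu> t)"
    and density0: "is_density u\<^sub>0 \<mu>0"
begin

abbreviation vol :: "real \<Rightarrow> real \<Rightarrow> real" where "vol t x \<equiv> \<nu> t x (\<mu> t)"

lemma mu_P2: "t \<in> {0..T} \<Longrightarrow> \<mu> t \<in> P2"
  using flow by (auto simp: W2_continuous_flow_def)

lemma density_u: "t \<in> {0..T} \<Longrightarrow> density lborel (\<lambda>z. ennreal (u t z)) = \<mu> t"
  using density by (auto simp: is_density_def)

lemma u_measurable: "t \<in> {0..T} \<Longrightarrow> u t \<in> borel_measurable borel"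
  and u_nonneg: "t \<in> {0..T} \<Longrightarrow> 0 \<le> u t x"
  using density by (auto simp: is_density_def)

lemma law: "t \<in> {0..T} \<Longrightarrow> distr M borel (X t) = \<mu> t"
  using solution by (auto simp: mckean_vlasov_strong_solution_def)

lemma vol_lipschitz:
  obtains L where "L > 0" "\<And>t x y. t \<in> {0..T} \<Longrightarrow> \<bar>vol t x - vol t y\<bar> \<le> L * \<bar>x - y\<bar>"
  using regular mu_P2 unfolding lipschitz_regular_def by metis

lemma vol_continuous: "t \<in> {0..T} \<Longrightarrow> continuous_on UNIV (vol t)"
proof -
  assume t: "t \<in> {0..T}"
  obtain L where L: "L > 0" "\<And>t x y. t \<in> {0..T} \<Longrightarrow> \<bar>vol t x - vol t y\<bar> \<le> L * \<bar>x - y\<bar>"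
    using vol_lipschitz by blast
  have "L-lipschitz_on UNIV (vol t)"
    using L t by (intro lipschitz_onI) (auto simp: dist_real_def)
  then show ?thesis by (rule lipschitz_on_continuous_on)
qed

lemma vol_measurable: "t \<in> {0..T} \<Longrightarrow> vol t \<in> borel_measurable borel"
  by (rule borel_measurable_continuous_onI[OF vol_continuous])

sublocale driven_bm M W "X 0"
proof -
  interpret prob_space M using bm by (simp add: brownian_motion_def)
  show "driven_bm M W (X 0)"
    using bm solution by unfold_locales (auto simp: mckean_vlasov_strong_solution_def)
qed

lemma X_measurable': "t \<in> {0..T} \<Longrightarrow> X t \<in> borel_measurable M"
  using solution by (auto simp: mckean_vlasov_strong_solution_def intro: measurable_F)

lemma expectation_density:
  assumes t: "t \<in> {0..T}" and f: "f \<in> borel_measurable borel"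
  shows "expectation (\<lambda>w. f (X t w)) = (\<integral>x. u t x * f x \<partial>lborel)"
    and "integrable M (\<lambda>w. f (X t w)) \<longleftrightarrow> integrable lborel (\<lambda>x. u t x * f x)"
proof -
  have "expectation (\<lambda>w. f (X t w)) = (\<integral>x. f x \<partial>\<mu> t)"
    unfolding law[OF t, symmetric] by (rule integral_distr[symmetric]) (use X_measurable'[OF t] f in auto)
  also have "\<dots> = (\<integral>x. u t x * f x \<partial>lborel)"
    unfolding density_u[OF t, symmetric]
    by (rule integral_real_density) (use u_measurable[OF t] u_nonneg[OF t] f in auto)
  finally show "expectation (\<lambda>w. f (X t w)) = (\<integral>x. u t x * f x \<partial>lborel)" .
  have "integrable M (\<lambda>w. f (X t w)) \<longleftrightarrow> integrable (\<mu> t) f"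
    unfolding law[OF t, symmetric] by (rule integrable_distr_eq[symmetric]) (use X_measurable'[OF t] f in auto)
  also have "\<dots> \<longleftrightarrow> integrable lborel (\<lambda>x. u t x * f x)"
    unfolding density_u[OF t, symmetric]
    by (rule integrable_real_density) (use u_measurable[OF t] u_nonneg[OF t] f in auto)
  finally show "integrable M (\<lambda>w. f (X t w)) \<longleftrightarrow> integrable lborel (\<lambda>x. u t x * f x)" .
qed

lemma X_square_integrable:
  assumes t: "t \<in> {0..T}" shows "integrable M (\<lambda>w. (X t w)\<^sup>2)"
proof -
  have "integrable (distr M borel (X t)) (\<lambda>x. x\<^sup>2)"
    using mu_P2[OF t] law[OF t] by (simp add: P2_def)
  then show ?thesis using X_measurable'[OF t] by (simp add: integrable_distr_eq)
qed

lemma vol_growth: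
  obtains C where "\<And>t x m. t \<in> {0..T} \<Longrightarrow> m \<in> P2 \<Longrightarrow>
    (\<nu> t x m)\<^sup>2 \<le> C\<^sup>2 * (1 + x\<^sup>2 + (W2 m (return borel 0))\<^sup>2)"
proof -
  obtain C where C: "\<And>t x m n. t \<in> {0..T} \<Longrightarrow> m \<in> P2 \<Longrightarrow> n \<in> P2 \<Longrightarrow>
      \<bar>\<nu> t x m\<bar>\<^sup>2 \<le> C\<^sup>2 * (1 + \<bar>x\<bar>\<^sup>2 + (W2 m (return borel 0))\<^sup>2)"
    using regular unfolding lipschitz_regular_def by meson
  show ?thesis using C by (intro that[of C]) (force simp only: power2_abs)
qed

text \<open>Square integrability of the volatility at every single time comes from the growth bound
  together with the finite second moment of \<open>\<mu> t\<close>.\<close>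

sublocale ito_process M W X T "\<lambda>s w. vol s (X s w)"
proof
  show "t \<in> {0..T} \<Longrightarrow> X t \<in> borel_measurable M" for t by (rule X_measurable')
  show "AE w in M. continuous_on {0..T} (\<lambda>t. X t w)"
    using solution by (auto simp: mckean_vlasov_strong_solution_def)
  show "t \<in> {0..T} \<Longrightarrow> has_ito_integral M F W (\<lambda>s w. vol s (X s w)) t (\<lambda>w. X t w - X 0 w)" for t
    using solution by (auto simp: mckean_vlasov_strong_solution_def)
  fix t assume t: "t \<in> {0..T}"
  obtain C where C: "\<And>t x m. t \<in> {0..T} \<Longrightarrow> m \<in> P2 \<Longrightarrow>
    (\<nu> t x m)\<^sup>2 \<le> C\<^sup>2 * (1 + x\<^sup>2 + (W2 m (return borel 0))\<^sup>2)"
    using vol_growth by blast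
  show "integrable M (\<lambda>w. (vol t (X t w))\<^sup>2)"
  proof (rule Bochner_Integration.integrable_bound)
    show "integrable M (\<lambda>w. C\<^sup>2 * (1 + (X t w)\<^sup>2 + (W2 (\<mu> t) (return borel 0))\<^sup>2))"
      using X_square_integrable[OF t] by auto
    show "(\<lambda>w. (vol t (X t w))\<^sup>2) \<in> borel_measurable M"
      using measurable_compose[OF X_measurable'[OF t] vol_measurable[OF t]] by auto
    show "AE w in M. norm ((vol t (X t w))\<^sup>2) \<le> norm (C\<^sup>2 * (1 + (X t w)\<^sup>2 + (W2 (\<mu> t) (return borel 0))\<^sup>2))"
      using C[OF t mu_P2[OF t]] by (intro AE_I2) (auto intro: order_trans[OF _ abs_ge_self])
  qed
qed

end

locale mckean_vlasov_test = mckean_vlasov T M W X \<nu> \<mu>0 \<mu> u u\<^sub>0 + lipschitz_test B \<phi> \<phi>t \<phi>x \<phi>xx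
  for T and M :: "'a measure" and W X \<nu> \<mu>0 \<mu> u u\<^sub>0 B \<phi> \<phi>t \<phi>x \<phi>xx
begin

sublocale ito_test M W X T "\<lambda>s w. vol s (X s w)" B \<phi> \<phi>t \<phi>x \<phi>xx ..

abbreviation integrand :: "real \<Rightarrow> real \<Rightarrow> real" where
  "integrand t x \<equiv> u t x * (\<phi>t t x + \<phi>xx t x * (vol t x)\<^sup>2 / 2)"

lemma generator_section_measurable:
  "t \<in> {0..T} \<Longrightarrow> (\<lambda>x. generator t x ((vol t x)\<^sup>2)) \<in> borel_measurable borel"
  unfolding generator_def using vol_measurable by measurable

lemma integrand_integrable:
  assumes t: "t \<in> {0..T}" shows "integrable lborel (integrand t)"
proof -
  have "integrable M (\<lambda>w. generator t (X t w) ((vol t (X t w))\<^sup>2))"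
    by (rule generator_integrable[OF X_measurable[OF t] H_square[OF t]])
  then show ?thesis
    using expectation_density(2)[OF t generator_section_measurable[OF t]] by (simp add: generator_def)
qed

lemma integrand_integral:
  assumes t: "t \<in> {0..T}"
  shows "rate t = (\<integral>x. integrand t x \<partial>lborel)"
    and "abs_rate t = (\<integral>x. \<bar>integrand t x\<bar> \<partial>lborel)"
  using expectation_density(1)[OF t generator_section_measurable[OF t]]
    expectation_density(1)[OF t borel_measurable_abs[OF generator_section_measurable[OF t]]] u_nonneg[OF t]
  by (simp_all add: generator_def abs_mult)

lemma integrand_integrable_time:
  assumes t: "t \<in> {0..T}"
  shows "integrable (time t) (\<lambda>r. \<integral>x. integrand r x \<partial>lborel)"
    and "integrable (time t) (\<lambda>r. \<integral>x. \<bar>integrand r x\<bar> \<partial>lborel)"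
proof -
  have sub: "r \<in> {0..t} \<Longrightarrow> r \<in> {0..T}" for r using t by auto
  show "integrable (time t) (\<lambda>r. \<integral>x. integrand r x \<partial>lborel)"
    using generator_integrable_time(1)[OF t]
    by (rule Bochner_Integration.integrable_cong[OF refl, THEN iffD1, rotated])
       (simp add: integrand_integral(1)[OF sub])
  show "integrable (time t) (\<lambda>r. \<integral>x. \<bar>integrand r x\<bar> \<partial>lborel)"
    using generator_integrable_time(2)[OF t]
    by (rule Bochner_Integration.integrable_cong[OF refl, THEN iffD1, rotated])
       (simp add: integrand_integral(2)[OF sub])
qed

lemma dynkin_density:
  assumes t: "t \<in> {0..T}"
  shows "(\<integral>r. (\<integral>x. integrand r x \<partial>lborel) \<partial>time t)
    = (\<integral>x. u t x * \<phi> t x \<partial>lborel) - (\<integral>x. u 0 x * \<phi> 0 x \<partial>lborel)"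
proof -
  have sub: "r \<in> {0..t} \<Longrightarrow> r \<in> {0..T}" for r using t by auto
  have "(\<integral>r. (\<integral>x. integrand r x \<partial>lborel) \<partial>time t)
      = (\<integral>r. rate r \<partial>time t)"
    by (rule Bochner_Integration.integral_cong[OF refl]) (simp add: integrand_integral(1)[OF sub])
  then show ?thesis
    using dynkin[OF t] expectation_density(1)[OF t, of "\<phi> t"] expectation_density(1)[of 0 "\<phi> 0"] T by simp
qed

end

text \<open>A test function is only required to vanish itself off a compact set. On the open
  complement its derivatives vanish too: induction over the space order comes first, then over the
  time order with the space order fixed.\<close>

lemma vanishing_derivatives:
  fixes D :: "nat \<Rightarrow> nat \<Rightarrow> real \<Rightarrow> real \<Rightarrow> real"
  assumes t: "\<And>i j t x. ((\<lambda>s. D i j s x) has_real_derivative D (Suc i) j t x) (at t)"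
    and x: "\<And>i j t x. (D i j t has_real_derivative D i (Suc j) t x) (at x)"
    and U: "open U" and zero: "\<And>t x. (t, x) \<in> U \<Longrightarrow> D 0 0 t x = 0"
  shows "(t, x) \<in> U \<Longrightarrow> D i j t x = 0"
proof -
  have nbhd: "\<exists>A B. open A \<and> open B \<and> t \<in> A \<and> x \<in> B \<and> A \<times> B \<subseteq> U" if "(t, x) \<in> U" for t x
    using open_prod_elim[OF U that] by (metis mem_Sigma_iff)
  have J: "D 0 j t x = 0" if "(t, x) \<in> U" for j t x
    using that
  proof (induction j arbitrary: t x)
    case (Suc j)
    obtain A B where AB: "open A" "open B" "t \<in> A" "x \<in> B" "A \<times> B \<subseteq> U" using nbhd[OF Suc.prems] by blast
    have "(D 0 j t has_real_derivative 0) (at x)"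
      by (rule has_field_derivative_transform_within_open[of "\<lambda>_. 0" _ _ B])
         (use AB Suc.IH in \<open>auto simp: subset_iff\<close>)
    then show ?case using x DERIV_unique by blast
  qed (use zero in auto)
  have I: "D i j t x = 0" if "(t, x) \<in> U" for i j t x
    using that
  proof (induction i arbitrary: t x)
    case (Suc i)
    obtain A B where AB: "open A" "open B" "t \<in> A" "x \<in> B" "A \<times> B \<subseteq> U" using nbhd[OF Suc.prems] by blast
    have "((\<lambda>s. D i j s x) has_real_derivative 0) (at t)"
      by (rule has_field_derivative_transform_within_open[of "\<lambda>_. 0" _ _ A])
         (use AB Suc.IH in \<open>auto simp: subset_iff\<close>)
    then show ?case using t DERIV_unique by blast
  qed (use J in auto)
  show "(t, x) \<in> U \<Longrightarrow> D i j t x = 0" by (rule I)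
qed

lemma test_function_lipschitz:
  assumes "test_function T \<phi>"
  obtains B \<phi>x where
    "lipschitz_test B \<phi> (\<lambda>t x. deriv (\<lambda>s. \<phi> s x) t) \<phi>x (\<lambda>t x. deriv (deriv (\<phi> t)) x)"
    "\<And>x. \<phi> T x = 0"
proof -
  from assms obtain D :: "nat \<Rightarrow> nat \<Rightarrow> real \<Rightarrow> real \<Rightarrow> real" and K where D0: "D 0 0 = \<phi>"
    and cont: "\<And>i j. continuous_on UNIV (\<lambda>(t, x). D i j t x)"
    and dt: "\<And>i j t x. ((\<lambda>s. D i j s x) has_real_derivative D (Suc i) j t x) (at t)"
    and dx: "\<And>i j t x. (D i j t has_real_derivative D i (Suc j) t x) (at x)"
    and K: "compact K" "K \<subseteq> {..<T} \<times> UNIV" and out: "\<And>t x. (t, x) \<notin> K \<Longrightarrow> \<phi> t x = 0"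
    unfolding test_function_def by blast
  have "open (- K)" using K by (simp add: compact_imp_closed open_Compl)
  from vanishing_derivatives[of D, OF dt dx this] have zero: "D i j t x = 0" if "(t, x) \<notin> K" for i j t x
    using that out D0 by simp
  have "\<exists>b. \<forall>t x. \<bar>D i j t x\<bar> \<le> b" for i j
  proof -
    have "bounded ((\<lambda>(t, x). D i j t x) ` K)"
      by (intro compact_imp_bounded compact_continuous_image K(1) continuous_on_subset[OF cont]) auto
    then obtain b where b: "\<forall>y\<in>(\<lambda>(t, x). D i j t x) ` K. norm y \<le> b" by (auto simp: bounded_iff)
    have "\<bar>D i j t x\<bar> \<le> max b 0" for t x
      using b zero[of t x i j] by (cases "(t, x) \<in> K") fastforce+
    then show ?thesis by blast
  qed
  then obtain b where b: "\<And>i j t x. \<bar>D i j t x\<bar> \<le> b i j" by metis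
  have b0: "0 \<le> b i j" for i j using b[of i j 0 0] by linarith
  \<comment> \<open>Orders up to 3 in each variable are needed, one more than the second space
    derivative, because the Lipschitz constants are bounds on the next derivative. Summing
    nonnegative bounds dominates each of them.\<close>
  define B where "B = (\<Sum>i<4. \<Sum>j<4. b i j)"
  have bB: "b i j \<le> B" if "i < 4" "j < 4" for i j
  proof -
    have "b i j \<le> (\<Sum>j<4. b i j)" using that b0 by (intro member_le_sum) auto
    also have "\<dots> \<le> B" unfolding B_def using that b0 by (intro member_le_sum[of i]) (auto intro: sum_nonneg)
    finally show ?thesis .
  qed
  have bd: "\<bar>D i j t x\<bar> \<le> B" if "i < 4" "j < 4" for i j t x
    using b bB[OF that] by (rule order_trans)
  have lip: "\<bar>D i j t x - D i j s y\<bar> \<le> B * (\<bar>t - s\<bar> + \<bar>x - y\<bar>)" if "Suc i < 4" "Suc j < 4" for i j t s x y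
  proof -
    have "norm (D i j t x - D i j s x) \<le> B * norm (t - s)"
      by (rule field_differentiable_bound[of UNIV "\<lambda>s. D i j s x" "\<lambda>t. D (Suc i) j t x"])
         (use bd that in \<open>auto intro: has_field_derivative_at_within dt\<close>)
    moreover have "norm (D i j s x - D i j s y) \<le> B * norm (x - y)"
      by (rule field_differentiable_bound[of UNIV "D i j s" "D i (Suc j) s"])
         (use bd that in \<open>auto intro: has_field_derivative_at_within dx\<close>)
    ultimately show ?thesis by (simp add: distrib_left)
  qed
  have e1: "(\<lambda>t x. deriv (\<lambda>s. \<phi> s x) t) = D 1 0"
    using DERIV_imp_deriv[OF dt[of 0 0]] D0 by (intro ext) simp
  have "deriv (\<phi> t) = D 0 1 t" for t
    using DERIV_imp_deriv[OF dx[of 0 0]] D0 by (intro ext) simp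
  then have e2: "(\<lambda>t x. deriv (deriv (\<phi> t)) x) = D 0 2"
    using DERIV_imp_deriv[OF dx[of 0 1]] by (intro ext) (simp add: numeral_2_eq_2)
  have "lipschitz_test B (D 0 0) (D 1 0) (D 0 1) (D 0 2)"
  proof
    show "\<bar>D 0 0 t x\<bar> \<le> B" "\<bar>D 1 0 t x\<bar> \<le> B" "\<bar>D 0 1 t x\<bar> \<le> B" "\<bar>D 0 2 t x\<bar> \<le> B" for t x
      using bd by auto
    show "((\<lambda>s. D 0 0 s x) has_real_derivative D 1 0 t x) (at t)"
      "(D 0 0 t has_real_derivative D 0 1 t x) (at x)"
      "(D 0 1 t has_real_derivative D 0 2 t x) (at x)" for t x
      using dt[of 0 0] dx[of 0 0] dx[of 0 1] by (auto simp: numeral_2_eq_2)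
    show "\<bar>D 1 0 t x - D 1 0 s y\<bar> \<le> B * (\<bar>t - s\<bar> + \<bar>x - y\<bar>)"
      "\<bar>D 0 2 t x - D 0 2 s y\<bar> \<le> B * (\<bar>t - s\<bar> + \<bar>x - y\<bar>)" for t x s y
      by (rule lip; simp)+
  qed
  then have "lipschitz_test B \<phi> (\<lambda>t x. deriv (\<lambda>s. \<phi> s x) t) (D 0 1) (\<lambda>t x. deriv (deriv (\<phi> t)) x)"
    unfolding e1 e2 D0 .
  moreover have "\<phi> T x = 0" for x using out[of T x] K(2) by auto
  ultimately show ?thesis by (rule that)
qed

context mckean_vlasov
begin

lemma init_law: "expectation (\<lambda>w. f (X 0 w)) = (\<integral>x. u\<^sub>0 x * f x \<partial>lborel)"
    "integrable M (\<lambda>w. f (X 0 w)) \<longleftrightarrow> integrable lborel (\<lambda>x. u\<^sub>0 x * f x)"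
  if f: "f \<in> borel_measurable borel" for f :: "real \<Rightarrow> real"
proof -
  have d: "distr M borel (X 0) = density lborel (\<lambda>x. ennreal (u\<^sub>0 x))"
    using solution density0 by (auto simp: mckean_vlasov_strong_solution_def is_density_def)
  have m: "u\<^sub>0 \<in> borel_measurable lborel" "\<And>x. 0 \<le> u\<^sub>0 x" using density0 by (auto simp: is_density_def)
  have "expectation (\<lambda>w. f (X 0 w)) = (\<integral>x. f x \<partial>distr M borel (X 0))"
    by (rule integral_distr[symmetric]) (use init_measurable f in auto)
  then show "expectation (\<lambda>w. f (X 0 w)) = (\<integral>x. u\<^sub>0 x * f x \<partial>lborel)"
    unfolding d by (subst (asm) integral_real_density) (use m f in auto)
  have "integrable M (\<lambda>w. f (X 0 w)) \<longleftrightarrow> integrable (distr M borel (X 0)) f"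
    by (rule integrable_distr_eq[symmetric]) (use init_measurable f in auto)
  then show "integrable M (\<lambda>w. f (X 0 w)) \<longleftrightarrow> integrable lborel (\<lambda>x. u\<^sub>0 x * f x)"
    unfolding d by (subst (asm) integrable_real_density) (use m f in auto)
qed

text \<open>In Dynkin's formula up to \<open>T\<close> the terminal term vanishes, since the support
  lies strictly before \<open>T\<close>. In the initial term \<open>u 0\<close> may be exchanged for
  \<open>u\<^sub>0\<close>, both being densities of the law of \<open>X 0\<close>.\<close>

lemma weak_solution: "weak_solution T \<nu> u\<^sub>0 u"
  unfolding weak_solution_def
proof (intro allI impI conjI)
  fix \<phi> assume "test_function T \<phi>"
  then obtain B \<phi>x where L: "lipschitz_test B \<phi> (\<lambda>t x. deriv (\<lambda>s. \<phi> s x) t) \<phi>x (\<lambda>t x. deriv (deriv (\<phi> t)) x)"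
    and end0: "\<And>x. \<phi> T x = 0" using test_function_lipschitz by blast
  interpret L: mckean_vlasov_test T M W X \<nu> \<mu>0 \<mu> u u\<^sub>0 B \<phi> "\<lambda>t x. deriv (\<lambda>s. \<phi> s x) t" \<phi>x "\<lambda>t x. deriv (deriv (\<phi> t)) x"
    by (intro mckean_vlasov_test.intro L) unfold_locales
  have w: "weak_integrand \<nu> u \<phi> t = L.integrand t" if "t \<in> {0..T}" for t
    unfolding weak_integrand_def density_u[OF that] by (intro ext) simp
  have TT: "T \<in> {0..T}" using T by simp
  show "\<forall>t\<in>{0..T}. integrable lborel (weak_integrand \<nu> u \<phi> t)"
    using w L.integrand_integrable by simp
  show "set_integrable lborel {0..T} (\<lambda>t. \<integral>x. \<bar>weak_integrand \<nu> u \<phi> t x\<bar> \<partial>lborel)"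
    unfolding set_integrable_time using L.integrand_integrable_time(2)[OF TT]
    by (rule Bochner_Integration.integrable_cong[OF refl, THEN iffD1, rotated]) (simp add: w)
  show "set_integrable lborel {0..T} (\<lambda>t. \<integral>x. weak_integrand \<nu> u \<phi> t x \<partial>lborel)"
    unfolding set_integrable_time using L.integrand_integrable_time(1)[OF TT]
    by (rule Bochner_Integration.integrable_cong[OF refl, THEN iffD1, rotated]) (simp add: w)
  have m: "\<phi> 0 \<in> borel_measurable borel" by (rule L.measurable_sections(1))
  show "integrable lborel (\<lambda>x. u\<^sub>0 x * \<phi> 0 x)"
    unfolding init_law(2)[OF m, symmetric]
    by (rule integrable_bounded[of _ B]) (use init_measurable L.bounded(1) in auto)
  have "(LINT t:{0..T}|lborel. (\<integral>x. weak_integrand \<nu> u \<phi> t x \<partial>lborel))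
      = (\<integral>t. (\<integral>x. weak_integrand \<nu> u \<phi> t x \<partial>lborel) \<partial>time T)"
    by (simp add: set_lebesgue_integral_def integral_restrict_space)
  also have "\<dots> = (\<integral>t. (\<integral>x. L.integrand t x \<partial>lborel) \<partial>time T)"
    by (rule Bochner_Integration.integral_cong) (simp_all add: w)
  also have "\<dots> = (\<integral>x. u T x * \<phi> T x \<partial>lborel) - (\<integral>x. u 0 x * \<phi> 0 x \<partial>lborel)"
    by (rule L.dynkin_density[OF TT])
  also have "(\<integral>x. u 0 x * \<phi> 0 x \<partial>lborel) = (\<integral>x. u\<^sub>0 x * \<phi> 0 x \<partial>lborel)"
    using expectation_density(1)[of 0 "\<phi> 0"] init_law(1)[OF m] T m by simp
  finally show "(LINT t:{0..T}|lborel. (\<integral>x. weak_integrand \<nu> u \<phi> t x \<partial>lborel))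
      + (\<integral>x. u\<^sub>0 x * \<phi> 0 x \<partial>lborel) = 0" by (simp add: end0)
qed

end

section \<open>Recovering a second derivative from its weak form\<close>

lemma compact_support_integral:
  fixes g :: "real \<Rightarrow> real"
  assumes g: "continuous_on UNIV g" and zero: "\<And>y. y \<notin> {a..b} \<Longrightarrow> g y = 0"
  shows "integrable lborel g" "(\<integral>y. g y \<partial>lborel) = integral {a..b} g"
proof -
  have si: "set_integrable lborel {a..b} g"
    using g by (intro borel_integrable_atLeastAtMost' continuous_on_subset[OF g]) auto
  have eq: "(\<lambda>y. indicator {a..b} y *\<^sub>R g y) = g" using zero by (auto simp: indicator_def fun_eq_iff)
  show "integrable lborel g" using si unfolding set_integrable_def eq .
  show "(\<integral>y. g y \<partial>lborel) = integral {a..b} g"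
    using set_borel_integral_eq_integral(2)[OF si] unfolding set_lebesgue_integral_def eq .
qed

lemma compact_support_bounded:
  fixes g :: "real \<Rightarrow> real"
  assumes g: "continuous_on UNIV g" and zero: "\<And>y. y \<notin> {a..b} \<Longrightarrow> g y = 0"
  shows "\<exists>K. \<forall>y. \<bar>g y\<bar> \<le> K"
proof -
  have "bounded (g ` {a..b})"
    by (intro compact_imp_bounded compact_continuous_image continuous_on_subset[OF g]) auto
  then obtain K where K: "\<forall>y\<in>{a..b}. \<bar>g y\<bar> \<le> K" by (auto simp: bounded_iff)
  have "\<bar>g y\<bar> \<le> max K 0" for y using K zero[of y] by (cases "y \<in> {a..b}") fastforce+
  then show ?thesis by blast
qed

lemma antiderivative_exists:
  fixes q :: "real \<Rightarrow> real"
  assumes "continuous_on UNIV q"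
  obtains Q where "\<And>x. (Q has_real_derivative q x) (at x)"
proof -
  have "\<exists>F. \<forall>x::real. - \<infinity> < ereal x \<longrightarrow> ereal x < \<infinity> \<longrightarrow> (F has_vector_derivative q x) (at x)"
    by (rule einterval_antiderivative) (use assms in \<open>auto simp: continuous_on_eq_continuous_at\<close>)
  then show ?thesis using that by (auto simp: has_real_derivative_iff_has_vector_derivative)
qed

lemma continuous_eq_on_Rats:
  fixes f g :: "real \<Rightarrow> real"
  assumes "continuous_on UNIV f" "continuous_on UNIV g" and eq: "\<And>r. r \<in> \<rat> \<Longrightarrow> f r = g r"
  shows "f x = g x"
proof (rule ccontr)
  assume "f x \<noteq> g x"
  have "open {x. f x \<noteq> g x}" using assms(1,2) by (rule open_Collect_neq)
  then obtain e where e: "e > 0" "\<And>y. dist y x < e \<Longrightarrow> f y \<noteq> g y"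
    using \<open>f x \<noteq> g x\<close> unfolding open_dist by auto
  obtain r where "r \<in> \<rat>" "x < r" "r < x + e" using Rats_dense_in_real[of x "x + e"] e by auto
  then show False using e(2)[of r] eq by (auto simp: dist_real_def)
qed

section \<open>Approximate point masses with explicit antiderivatives\<close>

lemma DERIV_times_abs: "((\<lambda>y::real. y * \<bar>y\<bar>) has_real_derivative 2 * \<bar>y\<bar>) (at y)"
proof (cases y "0::real" rule: linorder_cases)
  case less
  have "((\<lambda>y. - (y * y)) has_real_derivative 2 * \<bar>y\<bar>) (at y)"
    using less by (auto intro!: derivative_eq_intros)
  then show ?thesis
    by (rule has_field_derivative_transform_within_open[of _ _ _ "{..<0}"]) (use less in auto)
next
  case greater
  have "((\<lambda>y. y * y) has_real_derivative 2 * \<bar>y\<bar>) (at y)"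
    using greater by (auto intro!: derivative_eq_intros)
  then show ?thesis
    by (rule has_field_derivative_transform_within_open[of _ _ _ "{0<..}"]) (use greater in auto)
next
  case equal
  have "((\<lambda>z::real. z * \<bar>z\<bar> / z) \<longlongrightarrow> 0) (at 0)"
  proof (rule Lim_null_comparison)
    show "\<forall>\<^sub>F z::real in at 0. norm (z * \<bar>z\<bar> / z) \<le> \<bar>z\<bar>" by (auto simp: eventually_at_filter)
    show "((\<lambda>z::real. \<bar>z\<bar>) \<longlongrightarrow> 0) (at 0)" by (rule tendsto_rabs_zero) (rule tendsto_ident_at)
  qed
  then show ?thesis using equal by (simp add: has_field_derivative_iff)
qed

text \<open>\<open>hat e\<close> is the second difference quotient of \<open>\<bar>y\<bar> / 2\<close>; \<open>hat1 e\<close> and \<open>hat2 e\<close> are those of its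
  antiderivatives \<open>y \<bar>y\<bar> / 4\<close> and \<open>\<bar>y\<bar>\<^sup>3 / 12\<close>.\<close>

definition hat :: "real \<Rightarrow> real \<Rightarrow> real" where
  "hat e y = (\<bar>y + e\<bar> - 2 * \<bar>y\<bar> + \<bar>y - e\<bar>) / (2 * e\<^sup>2)"

definition hat1 :: "real \<Rightarrow> real \<Rightarrow> real" where
  "hat1 e y = ((y + e) * \<bar>y + e\<bar> - 2 * (y * \<bar>y\<bar>) + (y - e) * \<bar>y - e\<bar>) / (4 * e\<^sup>2)"

definition hat2 :: "real \<Rightarrow> real \<Rightarrow> real" where
  "hat2 e y = ((y + e) * ((y + e) * \<bar>y + e\<bar>) - 2 * (y * (y * \<bar>y\<bar>))
     + (y - e) * ((y - e) * \<bar>y - e\<bar>)) / (12 * e\<^sup>2)"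

lemma DERIV_hat2: "(hat2 e has_real_derivative hat1 e y) (at y)"
proof -
  have c: "((\<lambda>y. (y + a) * ((y + a) * \<bar>y + a\<bar>)) has_real_derivative 3 * ((y + a) * \<bar>y + a\<bar>)) (at y)" for a y :: real
  proof -
    have "((\<lambda>y::real. y * (y * \<bar>y\<bar>)) has_real_derivative y * (2 * \<bar>y\<bar>) + 1 * (y * \<bar>y\<bar>)) (at y)" for y
      by (rule DERIV_mult'[OF DERIV_ident DERIV_times_abs])
    from DERIV_shift[THEN iffD1, OF this[of "y + a"]] show ?thesis by (simp add: algebra_simps)
  qed
  have "((\<lambda>y. ((y + e) * ((y + e) * \<bar>y + e\<bar>) - 2 * ((y + 0) * ((y + 0) * \<bar>y + 0\<bar>))
     + (y + - e) * ((y + - e) * \<bar>y + - e\<bar>)) / (12 * e\<^sup>2)) has_real_derivative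
     (3 * ((y + e) * \<bar>y + e\<bar>) - 2 * (3 * ((y + 0) * \<bar>y + 0\<bar>)) + 3 * ((y + - e) * \<bar>y + - e\<bar>)) / (12 * e\<^sup>2)) (at y)"
    by (intro DERIV_cdivide DERIV_add DERIV_diff DERIV_cmult c)
  moreover have "(3 * A - 2 * (3 * C) + 3 * D) / (12 * E) = (A - 2 * C + D) / (4 * E)" for A C D E :: real
  proof -
    have "(3 * A - 2 * (3 * C) + 3 * D) / (12 * E) = (3 * (A - 2 * C + D)) / (3 * (4 * E))" by (simp add: algebra_simps)
    then show ?thesis by (simp only: mult_divide_mult_cancel_left_if) simp
  qed
  ultimately show ?thesis unfolding hat2_def hat1_def by simp
qed

lemma DERIV_hat1: "(hat1 e has_real_derivative hat e y) (at y)"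
proof -
  have c: "((\<lambda>y. (y + a) * \<bar>y + a\<bar>) has_real_derivative 2 * \<bar>y + a\<bar>) (at y)" for a y :: real
    using DERIV_shift[THEN iffD1, OF DERIV_times_abs[of "y + a"]] .
  have "((\<lambda>y. ((y + e) * \<bar>y + e\<bar> - 2 * ((y + 0) * \<bar>y + 0\<bar>) + (y + - e) * \<bar>y + - e\<bar>) / (4 * e\<^sup>2)) has_real_derivative
     (2 * \<bar>y + e\<bar> - 2 * (2 * \<bar>y + 0\<bar>) + 2 * \<bar>y + - e\<bar>) / (4 * e\<^sup>2)) (at y)"
    by (intro DERIV_cdivide DERIV_add DERIV_diff DERIV_cmult c)
  moreover have "(2 * A - 2 * (2 * C) + 2 * D) / (4 * E) = (A - 2 * C + D) / (2 * E)" for A C D E :: real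
  proof -
    have "(2 * A - 2 * (2 * C) + 2 * D) / (4 * E) = (2 * (A - 2 * C + D)) / (2 * (2 * E))" by (simp add: algebra_simps)
    then show ?thesis by (simp only: mult_divide_mult_cancel_left_if) simp
  qed
  ultimately show ?thesis unfolding hat1_def hat_def by simp
qed

lemma hat_nonneg: "0 \<le> hat e y"
proof -
  have "0 \<le> \<bar>y + e\<bar> - 2 * \<bar>y\<bar> + \<bar>y - e\<bar>" by (simp add: abs_if)
  then show ?thesis unfolding hat_def by simp
qed

text \<open>At distance at least \<open>e\<close> from 0 the absolute value has a constant sign on
  \<open>[y - e, y + e]\<close>. There the second difference quotients act on polynomials of degree
  at most three, for which they equal the second derivative exactly.\<close>

lemma hat_outside:
  assumes "0 < e" "e \<le> \<bar>y\<bar>"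
  shows "hat e y = 0" "hat1 e y = sgn y / 2" "hat2 e y = \<bar>y\<bar> / 2"
proof -
  consider "e \<le> y" | "y \<le> - e" using assms by (auto simp: abs_if split: if_splits)
  then have "hat e y = 0 \<and> hat1 e y = sgn y / 2 \<and> hat2 e y = \<bar>y\<bar> / 2"
  proof cases
    case 1
    then have a: "\<bar>y + e\<bar> = y + e" "\<bar>y\<bar> = y" "\<bar>y - e\<bar> = y - e" "sgn y = 1" using assms by auto
    have "(y + e) * (y + e) - 2 * (y * y) + (y - e) * (y - e) = 2 * e\<^sup>2"
      "(y + e) * ((y + e) * (y + e)) - 2 * (y * (y * y)) + (y - e) * ((y - e) * (y - e)) = 6 * y * e\<^sup>2"
      by (simp_all add: power2_eq_square algebra_simps)
    then show ?thesis unfolding hat_def hat1_def hat2_def a using assms by simp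
  next
    case 2
    then have a: "\<bar>y + e\<bar> = - (y + e)" "\<bar>y\<bar> = - y" "\<bar>y - e\<bar> = - (y - e)" "sgn y = - 1" using assms by auto
    have "(y + e) * (- (y + e)) - 2 * (y * (- y)) + (y - e) * (- (y - e)) = - 2 * e\<^sup>2"
      "(y + e) * ((y + e) * (- (y + e))) - 2 * (y * (y * (- y))) + (y - e) * ((y - e) * (- (y - e))) = - 6 * y * e\<^sup>2"
      by (simp_all add: power2_eq_square algebra_simps)
    then show ?thesis unfolding hat_def hat1_def hat2_def a using assms by simp
  qed
  then show "hat e y = 0" "hat1 e y = sgn y / 2" "hat2 e y = \<bar>y\<bar> / 2" by auto
qed

lemma hat_lipschitz:
  assumes "0 < e" shows "\<bar>hat e y - hat e z\<bar> \<le> 2 / e\<^sup>2 * \<bar>y - z\<bar>"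
proof -
  have "hat e y - hat e z
      = ((\<bar>y + e\<bar> - \<bar>z + e\<bar>) - 2 * (\<bar>y\<bar> - \<bar>z\<bar>) + (\<bar>y - e\<bar> - \<bar>z - e\<bar>)) / (2 * e\<^sup>2)"
    unfolding hat_def by (simp add: diff_divide_distrib[symmetric] algebra_simps)
  then have "\<bar>hat e y - hat e z\<bar>
      = \<bar>(\<bar>y + e\<bar> - \<bar>z + e\<bar>) - 2 * (\<bar>y\<bar> - \<bar>z\<bar>) + (\<bar>y - e\<bar> - \<bar>z - e\<bar>)\<bar> / (2 * e\<^sup>2)" by simp
  also have "\<dots> \<le> (4 * \<bar>y - z\<bar>) / (2 * e\<^sup>2)"
  proof (rule divide_right_mono)
    have t: "\<bar>\<bar>y + a\<bar> - \<bar>z + a\<bar>\<bar> \<le> \<bar>y - z\<bar>" for a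
      using abs_triangle_ineq3[of "y + a" "z + a"] by simp
    have sum: "\<bar>a - 2 * b + c\<bar> \<le> 4 * m" if "\<bar>a\<bar> \<le> m" "\<bar>b\<bar> \<le> m" "\<bar>c\<bar> \<le> m" for a b c m :: real
      using that by linarith
    show "\<bar>(\<bar>y + e\<bar> - \<bar>z + e\<bar>) - 2 * (\<bar>y\<bar> - \<bar>z\<bar>) + (\<bar>y - e\<bar> - \<bar>z - e\<bar>)\<bar> \<le> 4 * \<bar>y - z\<bar>"
      using t[of e] t[of "- e"] t[of 0] by (intro sum) simp_all
  qed simp
  also have "\<dots> = 2 / e\<^sup>2 * \<bar>y - z\<bar>" using assms by (simp add: field_simps)
  finally show ?thesis .
qed

lemma hat_continuous: "continuous_on UNIV (\<lambda>y. hat e (y - p))"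
  unfolding hat_def by (cases "e = 0") (auto intro!: continuous_intros)

text \<open>The unit mass is the jump of \<open>hat1\<close> from -1/2 to 1/2 across the
  support.\<close>

lemma hat_integral:
  assumes "0 < e"
  shows "integrable lborel (\<lambda>y. hat e (y - p))" "(\<integral>y. hat e (y - p) \<partial>lborel) = 1"
proof -
  have zero: "hat e (y - p) = 0" if "y \<notin> {p - e..p + e}" for y
    using that assms by (intro hat_outside) (auto simp: abs_if)
  note c = compact_support_integral[OF hat_continuous zero]
  show "integrable lborel (\<lambda>y. hat e (y - p))" by (rule c(1))
  have "((\<lambda>y. hat e (y - p)) has_integral (hat1 e (p + e - p) - hat1 e (p - e - p))) {p - e..p + e}"
  proof (rule fundamental_theorem_of_calculus)
    fix y
    have "((\<lambda>y. hat1 e (y + - p)) has_real_derivative hat e (y + - p)) (at y)"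
      using DERIV_shift[THEN iffD1, OF DERIV_hat1] .
    then show "((\<lambda>y. hat1 e (y - p)) has_vector_derivative hat e (y - p)) (at y within {p - e..p + e})"
      by (auto simp: has_real_derivative_iff_has_vector_derivative intro: has_vector_derivative_at_within)
  qed (use assms in auto)
  moreover have "hat1 e (p + e - p) - hat1 e (p - e - p) = 1"
    using hat_outside(2)[OF assms, of e] hat_outside(2)[OF assms, of "- e"] assms by simp
  ultimately show "(\<integral>y. hat e (y - p) \<partial>lborel) = 1"
    using c(2) integral_unique by metis
qed

lemma hat_times_integrable:
  assumes "0 < e" and v: "continuous_on UNIV v"
  shows "integrable lborel (\<lambda>y. v y * hat e (y - p))"
  by (rule compact_support_integral(1)[of _ "p - e" "p + e"])
     (use hat_outside(1)[OF assms(1)] in \<open>auto intro!: continuous_intros v hat_continuous simp: abs_if\<close>)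

lemma hat_approximates:
  assumes v: "continuous_on UNIV v"
  shows "(\<lambda>n. \<integral>y. v y * hat (1 / real (Suc n)) (y - p) \<partial>lborel) \<longlonglongrightarrow> v p"
proof (rule LIMSEQ_I)
  fix r :: real assume "0 < r"
  have "isCont v p" using v by (simp add: continuous_on_eq_continuous_at)
  then obtain d where d: "0 < d" "\<And>y. \<bar>y - p\<bar> < d \<Longrightarrow> \<bar>v y - v p\<bar> < r / 2"
    using \<open>0 < r\<close> unfolding continuous_at_eps_delta dist_real_def by (metis half_gt_zero)
  obtain N where N: "1 / real (Suc N) < d" using d(1) nat_approx_posE by (metis)
  show "\<exists>N. \<forall>n\<ge>N. norm ((\<integral>y. v y * hat (1 / real (Suc n)) (y - p) \<partial>lborel) - v p) < r"
  proof (intro exI allI impI)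
    fix n assume "N \<le> n"
    define e where "e = 1 / real (Suc n)"
    have e: "0 < e" by (simp add: e_def)
    have "e \<le> 1 / real (Suc N)" unfolding e_def using \<open>N \<le> n\<close> by (intro divide_left_mono) auto
    then have ed: "e < d" using N by simp
    note i1 = hat_times_integrable[OF e v] and i2 = hat_integral[OF e]
    have "(\<integral>y. v y * hat e (y - p) \<partial>lborel) - v p = (\<integral>y. v y * hat e (y - p) - v p * hat e (y - p) \<partial>lborel)"
      using i1 i2 by simp
    then have "\<bar>(\<integral>y. v y * hat e (y - p) \<partial>lborel) - v p\<bar>
        \<le> (\<integral>y. \<bar>v y * hat e (y - p) - v p * hat e (y - p)\<bar> \<partial>lborel)"
      using integral_abs_bound by metis
    also have "\<dots> \<le> (\<integral>y. r / 2 * hat e (y - p) \<partial>lborel)"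
    proof (rule integral_mono)
      fix y
      have "\<bar>v y * hat e (y - p) - v p * hat e (y - p)\<bar> = \<bar>v y - v p\<bar> * hat e (y - p)"
        using hat_nonneg[of e "y - p"] by (simp add: left_diff_distrib[symmetric] abs_mult)
      also have "\<dots> \<le> r / 2 * hat e (y - p)"
      proof (cases "e \<le> \<bar>y - p\<bar>")
        case True then show ?thesis using hat_outside(1)[OF e] by simp
      next
        case False
        then show ?thesis using d(2)[of y] ed hat_nonneg by (intro mult_right_mono) auto
      qed
      finally show "\<bar>v y * hat e (y - p) - v p * hat e (y - p)\<bar> \<le> r / 2 * hat e (y - p)" .
    qed (use i1 i2 in auto)
    also have "\<dots> = r / 2" using i2 by simp
    finally show "norm ((\<integral>y. v y * hat (1 / real (Suc n)) (y - p) \<partial>lborel) - v p) < r"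
      using \<open>0 < r\<close> by (simp add: e_def)
  qed
qed

text \<open>As \<open>e \<rightarrow> 0\<close>, the second derivative \<open>bump2 e p\<close> tends to \<open>\<delta>\<^sub>p - (1 - p) \<delta>\<^sub>0 - p \<delta>\<^sub>1\<close>. A
  continuous function annihilated by all these functionals is affine; conversely they annihilate
  affine functions, which is why \<open>bump e p\<close> has compact support.\<close>

definition bump :: "real \<Rightarrow> real \<Rightarrow> real \<Rightarrow> real" where
  "bump e p y = hat2 e (y - p) - (1 - p) * hat2 e y - p * hat2 e (y - 1)"

definition bump1 :: "real \<Rightarrow> real \<Rightarrow> real \<Rightarrow> real" where
  "bump1 e p y = hat1 e (y - p) - (1 - p) * hat1 e y - p * hat1 e (y - 1)"

definition bump2 :: "real \<Rightarrow> real \<Rightarrow> real \<Rightarrow> real" where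
  "bump2 e p y = hat e (y - p) - (1 - p) * hat e y - p * hat e (y - 1)"

lemma DERIV_bump: "(bump e p has_real_derivative bump1 e p y) (at y)"
  and DERIV_bump1: "(bump1 e p has_real_derivative bump2 e p y) (at y)"
proof -
  have s: "((\<lambda>y. f (y - a)) has_real_derivative f' (y - a)) (at y)"
    if "\<And>y. (f has_real_derivative f' y) (at y)" for f f' a y
    using DERIV_shift[THEN iffD1, OF that[of "y + - a"]] by simp
  show "(bump e p has_real_derivative bump1 e p y) (at y)"
    unfolding bump_def bump1_def by (intro DERIV_diff DERIV_cmult s[OF DERIV_hat2] DERIV_hat2)
  show "(bump1 e p has_real_derivative bump2 e p y) (at y)"
    unfolding bump1_def bump2_def by (intro DERIV_diff DERIV_cmult s[OF DERIV_hat1] DERIV_hat1)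
qed

lemma bump_continuous:
  "continuous_on UNIV (bump e p)" "continuous_on UNIV (bump1 e p)" "continuous_on UNIV (bump2 e p)"
proof -
  show "continuous_on UNIV (bump e p)" "continuous_on UNIV (bump1 e p)"
    by (rule DERIV_continuous_on[OF has_field_derivative_at_within[OF DERIV_bump]],
        rule DERIV_continuous_on[OF has_field_derivative_at_within[OF DERIV_bump1]])
  show "continuous_on UNIV (bump2 e p)"
    unfolding bump2_def using hat_continuous[of e 0] by (auto intro!: continuous_intros hat_continuous)
qed

text \<open>So far out, \<open>y - p\<close>, \<open>y\<close> and \<open>y - 1\<close> have the
  same sign and \<open>hat2\<close> is linear on that side. The contributions then cancel because
  \<open>y - p = (1 - p) * y + p * (y - 1)\<close>; for \<open>bump1\<close> the weights
  \<open>1 - p\<close> and \<open>p\<close> add up to 1.\<close>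

lemma bump_outside:
  assumes "0 < e" "\<bar>p\<bar> + 1 + e \<le> \<bar>y\<bar>"
  shows "bump e p y = 0" "bump1 e p y = 0" "bump2 e p y = 0"
proof -
  have "e \<le> \<bar>y - p\<bar>" "e \<le> \<bar>y\<bar>" "e \<le> \<bar>y - 1\<bar>" using assms by auto
  note o = this[THEN hat_outside(1)[OF assms(1)]] this[THEN hat_outside(2)[OF assms(1)]] this[THEN hat_outside(3)[OF assms(1)]]
  have "0 \<le> \<bar>p\<bar>" by simp
  consider "0 < y - p" "0 < y" "0 < y - 1" | "y - p < 0" "y < 0" "y - 1 < 0"
    using assms by (cases "0 \<le> y") (auto simp: abs_if split: if_splits)
  then show "bump e p y = 0" "bump1 e p y = 0" "bump2 e p y = 0"
    unfolding bump_def bump1_def bump2_def o by (cases; simp add: algebra_simps diff_divide_distrib)+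
qed

lemma bump_lipschitz_test:
  assumes "0 < e"
  shows "\<exists>B. lipschitz_test B (\<lambda>t. bump e p) (\<lambda>t x. 0) (\<lambda>t. bump1 e p) (\<lambda>t. bump2 e p)"
proof -
  let ?R = "\<bar>p\<bar> + 1 + e"
  have out: "\<bar>p\<bar> + 1 + e \<le> \<bar>y\<bar>" if "y \<notin> {- ?R..?R}" for y using that by auto
  obtain K0 K1 K2 where K: "\<And>y. \<bar>bump e p y\<bar> \<le> K0" "\<And>y. \<bar>bump1 e p y\<bar> \<le> K1" "\<And>y. \<bar>bump2 e p y\<bar> \<le> K2"
    using compact_support_bounded[OF bump_continuous(1) bump_outside(1)[OF assms out]]
      compact_support_bounded[OF bump_continuous(2) bump_outside(2)[OF assms out]]
      compact_support_bounded[OF bump_continuous(3) bump_outside(3)[OF assms out]] by metis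
  \<comment> \<open>The first factor is the constant of \<open>hat_lipschitz\<close>; the bracket
    adds the absolute weights of the three hats.\<close>
  define L where "L = 2 / e\<^sup>2 * (1 + \<bar>1 - p\<bar> + \<bar>p\<bar>)"
  have L: "\<bar>bump2 e p y - bump2 e p z\<bar> \<le> L * \<bar>y - z\<bar>" for y z
  proof -
    have h: "\<bar>c * hat e (y - a) - c * hat e (z - a)\<bar> \<le> \<bar>c\<bar> * (2 / e\<^sup>2 * \<bar>y - z\<bar>)" for c a
      using mult_left_mono[OF hat_lipschitz[OF assms, of "y - a" "z - a"], of "\<bar>c\<bar>"]
      by (simp add: abs_mult[symmetric] right_diff_distrib)
    have "\<bar>bump2 e p y - bump2 e p z\<bar> \<le> \<bar>1\<bar> * (2 / e\<^sup>2 * \<bar>y - z\<bar>)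
      + \<bar>1 - p\<bar> * (2 / e\<^sup>2 * \<bar>y - z\<bar>) + \<bar>p\<bar> * (2 / e\<^sup>2 * \<bar>y - z\<bar>)"
      using h[of 1 p] h[of "1 - p" 0] h[of p 1] unfolding bump2_def mult_1 diff_0_right by linarith
    also have "\<dots> = L * \<bar>y - z\<bar>" unfolding L_def by (simp add: algebra_simps add_divide_distrib)
    finally show ?thesis .
  qed
  define B where "B = max (max K0 K1) (max K2 L)"
  have B: "K0 \<le> B" "K1 \<le> B" "K2 \<le> B" "L \<le> B" by (auto simp: B_def)
  have B0: "0 \<le> B" using K(1)[of 0] B(1) by linarith
  have "lipschitz_test B (\<lambda>t. bump e p) (\<lambda>t x. 0) (\<lambda>t. bump1 e p) (\<lambda>t. bump2 e p)"
  proof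
    show "\<bar>bump2 e p x - bump2 e p y\<bar> \<le> B * (\<bar>t - s\<bar> + \<bar>x - y\<bar>)" for t s x y :: real
    proof -
      have "\<bar>bump2 e p x - bump2 e p y\<bar> \<le> L * \<bar>x - y\<bar>" by (rule L)
      also have "\<dots> \<le> B * \<bar>x - y\<bar>" using B by (intro mult_right_mono) auto
      also have "\<dots> \<le> B * (\<bar>t - s\<bar> + \<bar>x - y\<bar>)" using B0 by (intro mult_left_mono) auto
      finally show ?thesis .
    qed
  qed (use K B B0 DERIV_bump DERIV_bump1 in \<open>auto intro: order_trans\<close>)
  then show ?thesis by blast
qed

text \<open>The derivatives of \<open>w\<close> are a conclusion, so integration by parts is applied
  only to the second primitive \<open>Q2\<close> of \<open>2 * q\<close>. The difference
  \<open>v = w - Q2\<close> is then annihilated by every \<open>bump2\<close> in the family.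
  Shrinking the hats gives the interpolation identity for \<open>v\<close> at rational points, and
  continuity extends it to the line.\<close>

lemma weak_imp_second_derivative:
  fixes q w :: "real \<Rightarrow> real"
  assumes q: "continuous_on UNIV q" and w: "continuous_on UNIV w"
    and weak: "\<And>n p. p \<in> \<rat> \<Longrightarrow> (\<integral>y. q y * bump (1 / real (Suc n)) p y \<partial>lborel)
      = 1 / 2 * (\<integral>y. w y * bump2 (1 / real (Suc n)) p y \<partial>lborel)"
  shows "has_second_derivative w (2 * q x) x"
proof -
  have "continuous_on UNIV (\<lambda>x. 2 * q x)" using q by (intro continuous_intros)
  then obtain Q1 where Q1: "\<And>x. (Q1 has_real_derivative 2 * q x) (at x)"
    using antiderivative_exists by blast
  have Q1c: "continuous_on UNIV Q1"
    by (rule DERIV_continuous_on[OF has_field_derivative_at_within[OF Q1]])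
  obtain Q2 where Q2: "\<And>x. (Q2 has_real_derivative Q1 x) (at x)"
    using antiderivative_exists[OF Q1c] by blast
  have Q2c: "continuous_on UNIV Q2"
    by (rule DERIV_continuous_on[OF has_field_derivative_at_within[OF Q2]])
  define v where "v = (\<lambda>y. w y - Q2 y)"
  have v: "continuous_on UNIV v" unfolding v_def using w Q2c by (intro continuous_intros)
  have vbump: "(\<integral>y. v y * bump2 (1 / real (Suc n)) p y \<partial>lborel) = 0" if p: "p \<in> \<rat>" for n p
  proof -
    define e where "e = 1 / real (Suc n)"
    have e: "0 < e" by (simp add: e_def)
    let ?R = "\<bar>p\<bar> + 1 + e"
    have out: "\<bar>p\<bar> + 1 + e \<le> \<bar>y\<bar>" if "y \<notin> {- ?R..?R}" for y using that by auto
    note o = bump_outside[OF e out]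
    note cs = compact_support_integral[where a="- ?R" and b="?R"]
    have i: "integrable lborel (\<lambda>y. q y * bump e p y)" "integrable lborel (\<lambda>y. w y * bump2 e p y)"
      "integrable lborel (\<lambda>y. Q2 y * bump2 e p y)"
      by (rule cs(1); use o in \<open>auto intro!: continuous_intros bump_continuous q w Q2c\<close>)+
    \<comment> \<open>Two integrations by parts at once: \<open>?k\<close> is the derivative of
      \<open>Q1 * bump - Q2 * bump1\<close>, where the terms \<open>Q1 * bump1\<close> cancel. The
      boundary values vanish at both ends of the interval.\<close>
    let ?k = "\<lambda>y. 2 * q y * bump e p y - Q2 y * bump2 e p y"
    have "(?k has_integral
        ((Q1 ?R * bump e p ?R - Q2 ?R * bump1 e p ?R)
        - (Q1 (- ?R) * bump e p (- ?R) - Q2 (- ?R) * bump1 e p (- ?R)))) {- ?R..?R}"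
    proof (rule fundamental_theorem_of_calculus)
      fix y
      have "((\<lambda>y. Q1 y * bump e p y - Q2 y * bump1 e p y) has_real_derivative
        (Q1 y * bump1 e p y + 2 * q y * bump e p y) - (Q2 y * bump2 e p y + Q1 y * bump1 e p y)) (at y)"
        by (intro DERIV_diff DERIV_mult' Q1 Q2 DERIV_bump DERIV_bump1)
      then show "((\<lambda>y. Q1 y * bump e p y - Q2 y * bump1 e p y) has_vector_derivative
          ?k y) (at y within {- ?R..?R})"
        by (auto simp: has_real_derivative_iff_has_vector_derivative intro: has_vector_derivative_at_within)
    qed (use e in auto)
    moreover have "bump e p ?R = 0" "bump1 e p ?R = 0" "bump e p (- ?R) = 0" "bump1 e p (- ?R) = 0"
      by (rule bump_outside[OF e]; use e in simp)+
    ultimately have "(?k has_integral 0) {- ?R..?R}" by simp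
    then have "integral {- ?R..?R} ?k = 0"
      by (rule integral_unique)
    moreover have "(\<integral>y. ?k y \<partial>lborel)
      = integral {- ?R..?R} ?k"
      by (rule cs(2)) (use o in \<open>auto intro!: continuous_intros bump_continuous q Q2c\<close>)
    moreover have "(\<integral>y. ?k y \<partial>lborel)
      = 2 * (\<integral>y. q y * bump e p y \<partial>lborel) - (\<integral>y. Q2 y * bump2 e p y \<partial>lborel)"
      using i by (simp add: mult.assoc)
    moreover have "(\<integral>y. v y * bump2 e p y \<partial>lborel) = (\<integral>y. w y * bump2 e p y \<partial>lborel) - (\<integral>y. Q2 y * bump2 e p y \<partial>lborel)"
      unfolding v_def using i by (simp add: left_diff_distrib)
    ultimately show ?thesis using weak[OF p, of n] unfolding e_def by simp
  qed
  have aff: "v p = (1 - p) * v 0 + p * v 1" if p: "p \<in> \<rat>" for p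
  proof -
    let ?V = "\<lambda>n a. \<integral>y. v y * hat (1 / real (Suc n)) (y - a) \<partial>lborel"
    have "?V n p - (1 - p) * ?V n 0 - p * ?V n 1 = 0" for n
    proof -
      have e: "0 < 1 / real (Suc n)" by simp
      note i = hat_times_integrable[OF e v]
      have "(\<integral>y. v y * bump2 (1 / real (Suc n)) p y \<partial>lborel)
        = (\<integral>y. v y * hat (1 / real (Suc n)) (y - p) - (1 - p) * (v y * hat (1 / real (Suc n)) (y - 0))
            - p * (v y * hat (1 / real (Suc n)) (y - 1)) \<partial>lborel)"
        by (rule Bochner_Integration.integral_cong) (auto simp: bump2_def right_diff_distrib mult.left_commute)
      also have "\<dots> = ?V n p - (1 - p) * ?V n 0 - p * ?V n 1"
        using i[of p] i[of 0] i[of 1] by simp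
      finally show ?thesis using vbump[OF p] by simp
    qed
    moreover have "(\<lambda>n. ?V n p - (1 - p) * ?V n 0 - p * ?V n 1) \<longlonglongrightarrow> v p - (1 - p) * v 0 - p * v 1"
      by (intro tendsto_intros hat_approximates v)
    ultimately have "(\<lambda>n. 0 :: real) \<longlonglongrightarrow> v p - (1 - p) * v 0 - p * v 1" by simp
    then have "v p - (1 - p) * v 0 - p * v 1 = 0" using LIMSEQ_unique[OF tendsto_const] by metis
    then show ?thesis by simp
  qed
  have "v p = (1 - p) * v 0 + p * v 1" for p
    by (rule continuous_eq_on_Rats[OF v _ aff]) (auto intro!: continuous_intros)
  then have weq: "w = (\<lambda>y. Q2 y + ((1 - y) * v 0 + y * v 1))"
    by (auto simp: v_def fun_eq_iff algebra_simps)
  have "((\<lambda>y. Q2 y + ((1 - y) * v 0 + y * v 1)) has_real_derivative Q1 y + (v 1 - v 0)) (at y)" for y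
    by (auto intro!: derivative_eq_intros Q2)
  moreover have "((\<lambda>y. Q1 y + (v 1 - v 0)) has_real_derivative 2 * q x) (at x)"
    using DERIV_add[OF Q1 DERIV_const] by simp
  ultimately show ?thesis unfolding has_second_derivative_def weq
    by (intro exI[of _ "\<lambda>y. Q1 y + (v 1 - v 0)"]) auto
qed

section \<open>The classical equation\<close>

text \<open>The positive and negative parts of \<open>h\<close> are densities of two finite measures
  with the same distribution function. The measures therefore coincide, so the two parts agree
  almost everywhere, which is possible only where both are zero.\<close>

lemma AE_zero_of_initial_integrals:
  fixes h :: "real \<Rightarrow> real"
  assumes h: "integrable lborel h"
    and zero: "\<And>x. (\<integral>s. indicator {..x} s * h s \<partial>lborel) = 0"
  shows "AE s in lborel. h s = 0"
proof -
  define P where "P = (\<lambda>k. density lborel (\<lambda>s. ennreal (max 0 (k s))) :: real measure)"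
  have fin: "finite_borel_measure (P k)" and cdf: "cdf (P k) x = (\<integral>s. indicator {..x} s * max 0 (k s) \<partial>lborel)"
    if k: "integrable lborel k" for k :: "real \<Rightarrow> real" and x
  proof -
    have km: "k \<in> borel_measurable borel" using k by auto
    have ik: "integrable lborel (\<lambda>s. indicator {..x} s * max 0 (k s))" for x
      using integrable_mult_indicator[of "{..x}" lborel "\<lambda>s. max 0 (k s)"] k by simp
    have em: "emeasure (P k) A = (\<integral>\<^sup>+s. ennreal (indicator A s * max 0 (k s)) \<partial>lborel)" if "A \<in> sets borel" for A
      unfolding P_def using that km
      by (subst emeasure_density) (auto intro!: nn_integral_cong simp: indicator_def)
    have "emeasure (P k) UNIV = (\<integral>\<^sup>+s. ennreal (max 0 (k s)) \<partial>lborel)"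
      by (subst em) auto
    also have "\<dots> = ennreal (\<integral>s. max 0 (k s) \<partial>lborel)"
      by (rule nn_integral_eq_integral) (use k in auto)
    finally show "finite_borel_measure (P k)"
      by (intro finite_borel_measure.intro finite_measureI finite_borel_measure_axioms.intro)
         (auto simp: P_def)
    have "emeasure (P k) {..x} = ennreal (\<integral>s. indicator {..x} s * max 0 (k s) \<partial>lborel)"
      using nn_integral_eq_integral[OF ik[of x]] by (subst em) auto
    then show "cdf (P k) x = (\<integral>s. indicator {..x} s * max 0 (k s) \<partial>lborel)"
      unfolding cdf_def measure_def by (simp add: integral_nonneg_AE)
  qed
  have h': "integrable lborel (\<lambda>s. - h s)" using h by simp
  have "cdf (P h) x = cdf (P (\<lambda>s. - h s)) x" for x
  proof -
    have i: "integrable lborel (\<lambda>s. indicator {..x} s * max 0 (h s))"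
      "integrable lborel (\<lambda>s. indicator {..x} s * max 0 (- h s))"
      using integrable_mult_indicator[of "{..x}" lborel "\<lambda>s. max 0 (h s)"]
        integrable_mult_indicator[of "{..x}" lborel "\<lambda>s. max 0 (- h s)"] h by simp_all
    have "cdf (P h) x - cdf (P (\<lambda>s. - h s)) x
      = (\<integral>s. indicator {..x} s * max 0 (h s) - indicator {..x} s * max 0 (- h s) \<partial>lborel)"
      unfolding cdf[OF h] cdf[OF h'] using i by simp
    also have "\<dots> = (\<integral>s. indicator {..x} s * h s \<partial>lborel)"
      by (rule Bochner_Integration.integral_cong) (auto simp: indicator_def)
    finally show ?thesis using zero by simp
  qed
  then have "P h = P (\<lambda>s. - h s)" by (intro cdf_unique' fin h h') auto
  then have "AE s in lborel. ennreal (max 0 (h s)) = ennreal (max 0 (- h s))"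
    using h unfolding P_def by (subst (asm) sigma_finite_measure.density_unique_iff[OF sigma_finite_lborel]) auto
  then show ?thesis by eventually_elim (auto simp: max_def split: if_splits)
qed

lemma AE_eq_continuous:
  fixes f g :: "real \<Rightarrow> real"
  assumes "AE x in lborel. f x = g x" "continuous_on UNIV f" "continuous_on UNIV g"
  shows "f x = g x"
proof (rule ccontr)
  assume "f x \<noteq> g x"
  have o: "open {x. f x \<noteq> g x}" using assms(2,3) by (rule open_Collect_neq)
  have "{x. f x \<noteq> g x} \<in> sets lborel" using o by auto
  then have "{x. f x \<noteq> g x} \<in> null_sets lborel" using assms(1) AE_iff_null[of lborel "\<lambda>x. f x = g x"] by auto
  then have "negligible {x. f x \<noteq> g x}" by (simp add: negligible_iff_null_sets null_sets_completionI)
  then show False using open_not_negligible[OF o] \<open>f x \<noteq> g x\<close> by auto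
qed

section \<open>Time derivative against flux, tested with bumps\<close>

locale mckean_vlasov_C12 = mckean_vlasov +
  fixes ut :: "real \<Rightarrow> real \<Rightarrow> real"
  assumes u_deriv: "t \<in> {0..T} \<Longrightarrow> ((\<lambda>s. u s x) has_real_derivative ut t x) (at t within {0..T})"
    and u_cont: "continuous_on ({0..T} \<times> UNIV) (\<lambda>(t, x). u t x)"
    and ut_cont: "continuous_on ({0..T} \<times> UNIV) (\<lambda>(t, x). ut t x)"
begin

lemma section_continuous:
  fixes k :: "real \<Rightarrow> real \<Rightarrow> real"
  assumes "continuous_on ({0..T} \<times> UNIV) (\<lambda>(t, x). k t x)" "t \<in> {0..T}"
  shows "continuous_on UNIV (k t)"
proof -
  have "continuous_on UNIV (\<lambda>x. (\<lambda>(t, x). k t x) (t, x))"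
    by (rule continuous_on_compose2[OF assms(1)]) (use assms(2) in \<open>auto intro!: continuous_intros\<close>)
  then show ?thesis by simp
qed

definition flux :: "real \<Rightarrow> real \<Rightarrow> real" where
  "flux t x = (vol t x)\<^sup>2 * u t x"

lemma flux_continuous: "t \<in> {0..T} \<Longrightarrow> continuous_on UNIV (flux t)"
  unfolding flux_def using vol_continuous section_continuous[OF u_cont] by (intro continuous_intros) auto

lemma pde_at:
  assumes t: "t \<in> {0..T}"
    and weak: "\<And>n p. p \<in> \<rat> \<Longrightarrow> (\<integral>y. ut t y * bump (1 / real (Suc n)) p y \<partial>lborel)
      = 1 / 2 * (\<integral>y. flux t y * bump2 (1 / real (Suc n)) p y \<partial>lborel)"
  shows "mckean_vlasov_pde_at T \<nu> u t"
proof -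
  have "has_second_derivative (flux t) (2 * ut t x) x" for x
    by (rule weak_imp_second_derivative[OF section_continuous[OF ut_cont t] flux_continuous[OF t] weak])
  then show ?thesis
    unfolding mckean_vlasov_pde_at_def density_u[OF t] flux_def
    using u_deriv[OF t] by (intro allI exI[of _ "ut t _"] exI[of _ "2 * ut t _"]) auto
qed

text \<open>Two densities of one measure agree almost everywhere, and continuous functions that do
  so agree everywhere.\<close>

lemma initial: "initial_condition u u\<^sub>0"
proof -
  have "density lborel (\<lambda>x. ennreal (u 0 x)) = density lborel (\<lambda>x. ennreal (u\<^sub>0 x))"
    using density_u[of 0] law[of 0] T solution density0
    by (simp add: mckean_vlasov_strong_solution_def is_density_def)
  moreover have "u 0 \<in> borel_measurable borel" "u\<^sub>0 \<in> borel_measurable borel"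
    using u_measurable[of 0] T density0 by (auto simp: is_density_def)
  ultimately have "AE x in lborel. ennreal (u 0 x) = ennreal (u\<^sub>0 x)"
    by (subst (asm) sigma_finite_measure.density_unique_iff[OF sigma_finite_lborel]) auto
  moreover have "0 \<le> u 0 x" "0 \<le> u\<^sub>0 x" for x using u_nonneg[of 0] T density0 by (auto simp: is_density_def)
  ultimately have ae: "AE x in lborel. u 0 x = u\<^sub>0 x" by simp
  have "u 0 x = u\<^sub>0 x" if "continuous_on UNIV u\<^sub>0" for x
    by (rule AE_eq_continuous[OF ae section_continuous[OF u_cont] that]) (use T in auto)
  then show ?thesis using ae by (auto simp: initial_condition_def)
qed

context
  fixes e p :: real
  assumes e: "0 < e"
begin

abbreviation mass :: "real \<Rightarrow> real" where "mass t \<equiv> \<integral>y. u t y * bump e p y \<partial>lborel"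
abbreviation drift :: "real \<Rightarrow> real" where "drift t \<equiv> \<integral>y. ut t y * bump e p y \<partial>lborel"
abbreviation diffusion :: "real \<Rightarrow> real" where
  "diffusion t \<equiv> 1 / 2 * (\<integral>y. flux t y * bump2 e p y \<partial>lborel)"
abbreviation R :: real where "R \<equiv> \<bar>p\<bar> + 1 + e"

lemma outside_support:
  assumes "y \<notin> {- R..R}" shows "bump e p y = 0" "bump2 e p y = 0"
proof -
  have "\<bar>p\<bar> + 1 + e \<le> \<bar>y\<bar>" using assms by auto
  then show "bump e p y = 0" "bump2 e p y = 0" using bump_outside[OF e] by auto
qed

lemma diffusion_mass:
  assumes t: "t \<in> {0..T}"
  shows "integrable (time t) diffusion" "(\<integral>r. diffusion r \<partial>time t) = mass t - mass 0"
proof -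
  obtain B where L: "lipschitz_test B (\<lambda>t. bump e p) (\<lambda>t x. 0) (\<lambda>t. bump1 e p) (\<lambda>t. bump2 e p)"
    using bump_lipschitz_test[OF e] by blast
  interpret L: mckean_vlasov_test T M W X \<nu> \<mu>0 \<mu> u u\<^sub>0 B "\<lambda>t. bump e p" "\<lambda>t x. 0" "\<lambda>t. bump1 e p" "\<lambda>t. bump2 e p"
    by (intro mckean_vlasov_test.intro L) unfold_locales
  have eq: "(\<lambda>r. \<integral>x. L.integrand r x \<partial>lborel) = diffusion"
  proof
    fix r
    have "(\<integral>x. L.integrand r x \<partial>lborel) = (\<integral>x. 1 / 2 * (flux r x * bump2 e p x) \<partial>lborel)"
      by (rule Bochner_Integration.integral_cong) (auto simp: flux_def)
    then show "(\<integral>x. L.integrand r x \<partial>lborel) = diffusion r" by simp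
  qed
  show "integrable (time t) diffusion" using L.integrand_integrable_time(1)[OF t] unfolding eq .
  show "(\<integral>r. diffusion r \<partial>time t) = mass t - mass 0" using L.dynkin_density[OF t] unfolding eq .
qed

text \<open>The support of \<open>bump\<close> confines the integral to a compact interval, where
  continuity of \<open>ut\<close> on a rectangle justifies differentiating under the integral
  sign.\<close>

lemma mass_derivative:
  assumes t: "t \<in> {0..T}"
  shows "(mass has_real_derivative drift t) (at t within {0..T})"
proof -
  have c: "(\<integral>y. k y * bump e p y \<partial>lborel) = integral (cbox (- R) R) (\<lambda>y. k y * bump e p y)"
    if "continuous_on UNIV k" for k :: "real \<Rightarrow> real"
    unfolding cbox_interval
    by (rule compact_support_integral(2)) (use outside_support that in \<open>auto intro!: continuous_intros bump_continuous\<close>)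
  have "((\<lambda>s. integral (cbox (- R) R) (\<lambda>y. u s y * bump e p y)) has_real_derivative
      integral (cbox (- R) R) (\<lambda>y. ut t y * bump e p y)) (at t within {0..T})"
  proof (rule leibniz_rule_field_derivative)
    show "((\<lambda>s. u s y * bump e p y) has_real_derivative ut s y * bump e p y) (at s within {0..T})"
      if "s \<in> {0..T}" for s y using u_deriv[OF that] by (rule DERIV_cmult_right)
    show "(\<lambda>y. u s y * bump e p y) integrable_on cbox (- R) R" if "s \<in> {0..T}" for s
      using section_continuous[OF u_cont that] bump_continuous(1)
      by (intro integrable_continuous continuous_intros) (auto intro: continuous_on_subset)
    have "continuous_on ({0..T} \<times> cbox (- R) R) (\<lambda>z. (\<lambda>(s, y). ut s y) z * bump e p (snd z))"
      by (intro continuous_on_mult continuous_on_subset[OF ut_cont]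
            continuous_on_compose2[OF bump_continuous(1)] continuous_intros) auto
    then show "continuous_on ({0..T} \<times> cbox (- R) R) (\<lambda>(s, y). ut s y * bump e p y)"
      by (simp add: split_def)
  qed (use t in auto)
  then show ?thesis
    unfolding c[OF section_continuous[OF ut_cont t]]
    \<comment> \<open>The radius 1 is arbitrary, since the two functions of time agree on all of
      \<open>{0..T}\<close>.\<close>
    by (rule has_field_derivative_transform_within[of _ _ _ _ 1])
       (use t in \<open>auto simp: c[OF section_continuous[OF u_cont]]\<close>)
qed

lemma drift_continuous: "continuous_on {0..T} drift"
proof -
  have c: "drift t = integral (cbox (- R) R) (\<lambda>y. ut t y * bump e p y)" if "t \<in> {0..T}" for t
    unfolding cbox_interval
    by (rule compact_support_integral(2))
       (use outside_support section_continuous[OF ut_cont that] in \<open>auto intro!: continuous_intros bump_continuous\<close>)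
  have "continuous_on ({0..T} \<times> cbox (- R) R) (\<lambda>z. (\<lambda>(s, y). ut s y) z * bump e p (snd z))"
    by (intro continuous_on_mult continuous_on_subset[OF ut_cont]
          continuous_on_compose2[OF bump_continuous(1)] continuous_intros) auto
  then have "continuous_on ({0..T} \<times> cbox (- R) R) (\<lambda>(s, y). ut s y * bump e p y)"
    by (simp add: split_def)
  from integral_continuous_on_param[OF this] show ?thesis
    by (rule continuous_on_cong[THEN iffD1, rotated 2]) (auto simp: c)
qed

lemma drift_integral:
  assumes t: "t \<in> {0..T}" shows "(drift has_integral (mass t - mass 0)) {0..t}"
proof (rule fundamental_theorem_of_calculus)
  fix s assume s: "s \<in> {0..t}"
  then have "(mass has_real_derivative drift s) (at s within {0..t})"
    using t by (intro DERIV_subset[OF mass_derivative]) auto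
  then show "(mass has_vector_derivative drift s) (at s within {0..t})"
    by (simp add: has_real_derivative_iff_has_vector_derivative)
qed (use t in auto)

lemma diffusion_integral:
  assumes t: "t \<in> {0..T}"
  shows "diffusion integrable_on {0..t}" "integral {0..t} diffusion = mass t - mass 0"
proof -
  have "set_integrable lborel {0..t} diffusion"
    unfolding set_integrable_time by (rule diffusion_mass(1)[OF t])
  from set_borel_integral_eq_integral[OF this] diffusion_mass(2)[OF t]
  show "diffusion integrable_on {0..t}" "integral {0..t} diffusion = mass t - mass 0"
    by (simp_all add: set_lebesgue_integral_def integral_restrict_space)
qed

lemma AE_drift_eq_diffusion: "AE t in lborel. t \<in> {0..T} \<longrightarrow> drift t = diffusion t"
proof -
  \<comment> \<open>Extension by zero reduces the integral up to an arbitrary \<open>x\<close> to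
    one over \<open>{0..min x T}\<close>, or to zero for negative \<open>x\<close>.\<close>
  define h where "h = (\<lambda>t. indicator {0..T} t * (drift t - diffusion t))"
  have TT: "T \<in> {0..T}" using T by simp
  have si: "set_integrable lborel {0..t} drift" "set_integrable lborel {0..t} diffusion" if "t \<in> {0..T}" for t
  proof -
    show "set_integrable lborel {0..t} drift"
      by (intro borel_integrable_atLeastAtMost' continuous_on_subset[OF drift_continuous]) (use that in auto)
    show "set_integrable lborel {0..t} diffusion"
      unfolding set_integrable_time by (rule diffusion_mass(1)[OF that])
  qed
  have "set_integrable lborel {0..T} (\<lambda>t. drift t - diffusion t)"
    using si[OF TT] by (rule set_integral_diff(1))
  then have "integrable lborel h" by (simp add: h_def set_integrable_def)
  moreover have "(\<integral>s. indicator {..x} s * h s \<partial>lborel) = 0" for x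
  proof (cases "x < 0")
    case True
    then have "(\<lambda>s. indicator {..x} s * h s) = (\<lambda>_. 0)" by (auto simp: h_def indicator_def fun_eq_iff)
    then show ?thesis by simp
  next
    case False
    define t where "t = min x T"
    have t: "t \<in> {0..T}" using False T by (auto simp: t_def)
    have "(\<integral>s. indicator {..x} s * h s \<partial>lborel) = (LINT s:{0..t}|lborel. drift s - diffusion s)"
      unfolding set_lebesgue_integral_def
      by (rule Bochner_Integration.integral_cong) (auto simp: h_def t_def indicator_def)
    also have "\<dots> = (LINT s:{0..t}|lborel. drift s) - (LINT s:{0..t}|lborel. diffusion s)"
      using si[OF t] by (rule set_integral_diff(2))
    also have "\<dots> = 0"
      using set_borel_integral_eq_integral(2)[OF si(1)[OF t]] set_borel_integral_eq_integral(2)[OF si(2)[OF t]]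
        diffusion_integral(2)[OF t] integral_unique[OF drift_integral[OF t]] by simp
    finally show ?thesis .
  qed
  ultimately have "AE s in lborel. h s = 0" by (rule AE_zero_of_initial_integrals)
  then show ?thesis by eventually_elim (auto simp: h_def)
qed

text \<open>Comparing \<open>\<mu>\<^sub>s\<close> with \<open>\<mu>\<^sub>t\<close> inside \<open>\<nu>\<close> and using the growth bound at \<open>\<mu>\<^sub>t\<close> only avoids the triangle
  inequality for \<^const>\<open>W2\<close>.\<close>

lemma diffusion_continuous:
  assumes t: "t \<in> {0..T}" and cont: "\<And>x. continuous (at t within {0..T}) (\<lambda>s. \<nu> s x (\<mu> t))"
  shows "continuous (at t within {0..T}) diffusion"
  unfolding continuous_within tendsto_at_iff_sequentially
proof (intro allI impI)
  fix S :: "nat \<Rightarrow> real" assume S: "\<forall>i. S i \<in> {0..T} - {t}" and lim: "S \<longlonglongrightarrow> t"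
  have ST: "S i \<in> {0..T}" for i using S by auto
  have along: "(\<lambda>i. k (S i)) \<longlonglongrightarrow> l" if "(k \<longlongrightarrow> l) (at t within {0..T})" for k :: "real \<Rightarrow> real" and l
    using that S lim unfolding tendsto_at_iff_sequentially by (auto simp: comp_def)
  obtain L where L: "0 < L" "\<And>t x m n. t \<in> {0..T} \<Longrightarrow> m \<in> P2 \<Longrightarrow> n \<in> P2 \<Longrightarrow> \<bar>\<nu> t x m - \<nu> t x n\<bar> \<le> L * W2 m n"
    using regular unfolding lipschitz_regular_def by meson
  obtain C where C: "\<And>t x m. t \<in> {0..T} \<Longrightarrow> m \<in> P2 \<Longrightarrow>
    (\<nu> t x m)\<^sup>2 \<le> C\<^sup>2 * (1 + x\<^sup>2 + (W2 m (return borel 0))\<^sup>2)"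
    using vol_growth by blast
  have W2lim: "(\<lambda>i. W2 (\<mu> (S i)) (\<mu> t)) \<longlonglongrightarrow> 0"
    using flow t by (intro along) (auto simp: W2_continuous_flow_def)
  then obtain b where b: "\<And>i. \<bar>W2 (\<mu> (S i)) (\<mu> t)\<bar> \<le> b"
    using convergent_imp_Bseq[OF convergentI[OF W2lim]] by (auto simp: Bseq_def)
  have dist: "\<bar>vol (S i) y - \<nu> (S i) y (\<mu> t)\<bar> \<le> L * W2 (\<mu> (S i)) (\<mu> t)" for i y
    by (rule L(2)[OF ST mu_P2[OF ST] mu_P2[OF t]])
  have vlim: "(\<lambda>i. vol (S i) y) \<longlonglongrightarrow> vol t y" for y
  proof -
    have "(\<lambda>i. vol (S i) y - \<nu> (S i) y (\<mu> t)) \<longlonglongrightarrow> 0"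
    proof (rule Lim_null_comparison)
      show "\<forall>\<^sub>F i in sequentially. norm (vol (S i) y - \<nu> (S i) y (\<mu> t)) \<le> L * W2 (\<mu> (S i)) (\<mu> t)"
        using dist by simp
      show "(\<lambda>i. L * W2 (\<mu> (S i)) (\<mu> t)) \<longlonglongrightarrow> 0"
        using tendsto_mult_left[OF W2lim, of L] by simp
    qed
    moreover have "(\<lambda>i. \<nu> (S i) y (\<mu> t)) \<longlonglongrightarrow> vol t y"
      using cont[of y] by (intro along) (simp add: continuous_within)
    ultimately show ?thesis using tendsto_add by force
  qed
  have ulim: "(\<lambda>i. u (S i) y) \<longlonglongrightarrow> u t y" for y
    using DERIV_continuous[OF u_deriv[OF t, of y]] by (intro along) (simp add: continuous_within)
  let ?c = "C\<^sup>2 * (1 + R\<^sup>2 + (W2 (\<mu> t) (return borel 0))\<^sup>2)"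
  \<comment> \<open>The growth bound controls the square, and
    \<open>\<bar>z\<bar> \<le> z^2 + 1\<close> turns this into a bound on the volatility at the law
    \<open>\<mu> t\<close>. The term \<open>L * b\<close> pays for passing to
    \<open>\<mu> (S i)\<close>, with \<open>b\<close> a bound for the convergent sequence of
    Wasserstein distances.\<close>
  define c where "c = ?c + 1 + L * b"
  have vbound: "\<bar>vol (S i) y\<bar> \<le> c" if "y \<in> {- R..R}" for i y
  proof -
    have "\<bar>y\<bar> \<le> R" using that by auto
    then have "y\<^sup>2 \<le> R\<^sup>2" by (metis abs_ge_zero power2_abs power_mono)
    then have "C\<^sup>2 * (1 + y\<^sup>2 + (W2 (\<mu> t) (return borel 0))\<^sup>2) \<le> ?c"
      by (intro mult_left_mono) auto
    then have sq: "(\<nu> (S i) y (\<mu> t))\<^sup>2 \<le> ?c"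
      using C[OF ST mu_P2[OF t], of i y] by (rule order_trans[rotated])
    have "0 \<le> (\<bar>\<nu> (S i) y (\<mu> t)\<bar> - 1)\<^sup>2" by simp
    then have "2 * \<bar>\<nu> (S i) y (\<mu> t)\<bar> \<le> (\<nu> (S i) y (\<mu> t))\<^sup>2 + 1" by (simp add: power2_diff)
    then have 1: "\<bar>\<nu> (S i) y (\<mu> t)\<bar> \<le> (\<nu> (S i) y (\<mu> t))\<^sup>2 + 1" by (smt (verit) zero_le_power2)
    have "W2 (\<mu> (S i)) (\<mu> t) \<le> b" using b[of i] by simp
    then have "L * W2 (\<mu> (S i)) (\<mu> t) \<le> L * b" using L(1) by (intro mult_left_mono) auto
    then show ?thesis using dist[of i y] 1 sq unfolding c_def by linarith
  qed
  have "compact ({0..T} \<times> {- R..R})" by (intro compact_Times) auto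
  then have "bounded ((\<lambda>(t, x). u t x) ` ({0..T} \<times> {- R..R}))"
    by (intro compact_imp_bounded compact_continuous_image continuous_on_subset[OF u_cont]) auto
  then obtain Ku where Ku: "\<And>s y. s \<in> {0..T} \<Longrightarrow> y \<in> {- R..R} \<Longrightarrow> \<bar>u s y\<bar> \<le> Ku"
    by (fastforce simp: bounded_iff)
  obtain K2 where K2: "\<And>y. \<bar>bump2 e p y\<bar> \<le> K2"
    using compact_support_bounded[OF bump_continuous(3) outside_support(2)] by blast
  have "(\<lambda>i. \<integral>y. flux (S i) y * bump2 e p y \<partial>lborel) \<longlonglongrightarrow> (\<integral>y. flux t y * bump2 e p y \<partial>lborel)"
  proof (rule integral_dominated_convergence[where w="\<lambda>y. c\<^sup>2 * Ku * K2 * indicator {- R..R} y"])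
    have m: "(\<lambda>y. flux s y * bump2 e p y) \<in> borel_measurable lborel" if "s \<in> {0..T}" for s
      using borel_measurable_continuous_onI[OF continuous_on_mult[OF flux_continuous[OF that] bump_continuous(3)]] by simp
    show "(\<lambda>y. flux t y * bump2 e p y) \<in> borel_measurable lborel" by (rule m[OF t])
    show "(\<lambda>y. flux (S i) y * bump2 e p y) \<in> borel_measurable lborel" for i by (rule m[OF ST])
    show "integrable lborel (\<lambda>y. c\<^sup>2 * Ku * K2 * indicator {- R..R} y)"
      by (intro integrable_mult_right integrable_real_indicator) (auto simp: emeasure_lborel_Icc_eq)
    show "AE y in lborel. (\<lambda>i. flux (S i) y * bump2 e p y) \<longlonglongrightarrow> flux t y * bump2 e p y"
      unfolding flux_def by (intro AE_I2 tendsto_intros vlim ulim)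
    show "AE y in lborel. norm (flux (S i) y * bump2 e p y) \<le> c\<^sup>2 * Ku * K2 * indicator {- R..R} y" for i
    proof (rule AE_I2)
      fix y
      show "norm (flux (S i) y * bump2 e p y) \<le> c\<^sup>2 * Ku * K2 * indicator {- R..R} y"
      proof (cases "y \<in> {- R..R}")
        case True
        have "(vol (S i) y)\<^sup>2 \<le> c\<^sup>2"
          using vbound[OF True, of i] by (metis abs_ge_zero power2_abs power_mono)
        moreover have "0 \<le> Ku" using Ku[OF ST True, of i] by linarith
        ultimately have "(vol (S i) y)\<^sup>2 * \<bar>u (S i) y\<bar> * \<bar>bump2 e p y\<bar> \<le> c\<^sup>2 * Ku * K2"
          using Ku[OF ST True, of i] K2[of y] by (intro mult_mono) auto
        then show ?thesis using True by (simp add: flux_def abs_mult)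
      next
        case False
        then show ?thesis using outside_support(2)[OF False] by simp
      qed
    qed
  qed
  from tendsto_mult_left[OF this, of "1 / 2"] show "(diffusion \<circ> S) \<longlonglongrightarrow> diffusion t" by (simp add: comp_def)
qed

text \<open>Both sides are the derivative of \<open>mass s - mass 0\<close> at \<open>t\<close>: one
  by differentiation under the integral sign, the other because an indefinite integral is
  differentiable where its integrand is continuous. Derivatives within \<open>{0..T}\<close> are
  unique, also at the end points, because \<open>T > 0\<close>.\<close>

lemma drift_eq_diffusion:
  assumes t: "t \<in> {0..T}" and cont: "\<And>x. continuous (at t within {0..T}) (\<lambda>s. \<nu> s x (\<mu> t))"
  shows "drift t = diffusion t"
proof -
  have TT: "T \<in> {0..T}" using T by simp
  have "((\<lambda>s. integral {0..s} diffusion) has_vector_derivative diffusion t) (at t within ({0..T} - {}))"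
    by (rule integral_has_vector_derivative_continuous_at)
       (use diffusion_integral(1)[OF TT] diffusion_continuous[OF t cont] t in auto)
  then have "((\<lambda>s. integral {0..s} diffusion) has_vector_derivative diffusion t) (at t within {0..T})" by simp
  then have 1: "((\<lambda>s. mass s - mass 0) has_vector_derivative diffusion t) (at t within {0..T})"
    by (rule has_vector_derivative_transform[OF t, rotated]) (rule diffusion_integral(2)[symmetric])
  have "((\<lambda>s. mass s - mass 0) has_real_derivative drift t - 0) (at t within {0..T})"
    by (intro DERIV_diff mass_derivative[OF t] DERIV_const)
  then have 2: "((\<lambda>s. mass s - mass 0) has_vector_derivative drift t) (at t within {0..T})"
    by (simp add: has_real_derivative_iff_has_vector_derivative)
  show ?thesis
    using vector_derivative_unique_within_closed_interval[OF T, of t] 1 2 t unfolding cbox_interval by blast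
qed

end

text \<open>The exceptional set of \<open>AE_drift_eq_diffusion\<close> depends on the bump. Only
  countably many bumps occur, so one null set of times serves all of them, and with them all points
  of the line.\<close>

lemma AE_pde: "\<exists>N\<in>null_sets lborel. \<forall>t\<in>{0..T} - N. mckean_vlasov_pde_at T \<nu> u t"
proof -
  let ?eq = "\<lambda>n p t. (\<integral>y. ut t y * bump (1 / real (Suc n)) p y \<partial>lborel)
      = 1 / 2 * (\<integral>y. flux t y * bump2 (1 / real (Suc n)) p y \<partial>lborel)"
  have "AE t in lborel. \<forall>n::nat. \<forall>p\<in>\<rat>. t \<in> {0..T} \<longrightarrow> ?eq n p t"
    unfolding AE_all_countable AE_ball_countable[OF countable_rat]
    by (intro allI ballI AE_drift_eq_diffusion) simp
  then obtain N where N: "N \<in> null_sets lborel"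
    "{t \<in> space lborel. \<not> (\<forall>n::nat. \<forall>p\<in>\<rat>. t \<in> {0..T} \<longrightarrow> ?eq n p t)} \<subseteq> N"
    by (auto elim!: AE_E simp: null_sets_def)
  have "mckean_vlasov_pde_at T \<nu> u t" if "t \<in> {0..T} - N" for t
    by (rule pde_at) (use that N(2) in auto)
  then show ?thesis using N(1) by blast
qed

lemma pde_at_continuity:
  assumes "t \<in> {0..T}" "\<And>x. continuous (at t within {0..T}) (\<lambda>s. \<nu> s x (\<mu> t))"
  shows "mckean_vlasov_pde_at T \<nu> u t"
  by (rule pde_at[OF assms(1) drift_eq_diffusion[OF _ assms]]) simp

end

theorem proposition6p7:
  fixes T :: real
    and M :: "'a measure"
    and W X :: "real \<Rightarrow> 'a \<Rightarrow> real"
    and \<nu> :: "real \<Rightarrow> real \<Rightarrow> real measure \<Rightarrow> real"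
    and \<mu>0 :: "real measure"
    and \<mu> :: "real \<Rightarrow> real measure"
    and u :: "real \<Rightarrow> real \<Rightarrow> real"
    and u\<^sub>0 :: "real \<Rightarrow> real"
  assumes "T > 0"
    and "brownian_motion M W"
    and "lipschitz_regular T \<nu>"
    and "\<mu>0 \<in> P2"
    and "W2_continuous_flow T \<mu>"
    and "mckean_vlasov_strong_solution M W T \<nu> \<mu>0 \<mu> X"
    and "\<forall>t\<in>{0..T}. is_density (u t) (\<mu> t)"
    and "is_density u\<^sub>0 \<mu>0"
  shows "(C12 T u \<longrightarrow>
           (\<exists>N\<in>null_sets lborel. classical_solution T \<nu> ({0..T} - N) u\<^sub>0 u) \<and>
           classical_solution T \<nu>
             {t\<in>{0..T}. \<forall>x. continuous (at t within {0..T}) (\<lambda>s. \<nu> s x (\<mu> t))} u\<^sub>0 u)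
         \<and> weak_solution T \<nu> u\<^sub>0 u"
proof -
  interpret mckean_vlasov T M W X \<nu> \<mu>0 \<mu> u u\<^sub>0
    by (rule mckean_vlasov.intro) (fact assms)+
  have "(\<exists>N\<in>null_sets lborel. classical_solution T \<nu> ({0..T} - N) u\<^sub>0 u) \<and>
      classical_solution T \<nu>
        {t\<in>{0..T}. \<forall>x. continuous (at t within {0..T}) (\<lambda>s. \<nu> s x (\<mu> t))} u\<^sub>0 u"
    if C: "C12 T u"
  proof -
    from C obtain ut where ut:
      "\<forall>t\<in>{0..T}. \<forall>x. ((\<lambda>s. u s x) has_real_derivative ut t x) (at t within {0..T})"
      "continuous_on ({0..T} \<times> UNIV) (\<lambda>(t, x). u t x)" "continuous_on ({0..T} \<times> UNIV) (\<lambda>(t, x). ut t x)"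
      unfolding C12_def by blast
    interpret mckean_vlasov_C12 T M W X \<nu> \<mu>0 \<mu> u u\<^sub>0 ut
      by unfold_locales (use ut in auto)
    show ?thesis
      using AE_pde pde_at_continuity initial C unfolding classical_solution_def by blast
  qed
  then show ?thesis using weak_solution by blast
qed

end
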